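(* Let $R$ and $S$ be finitely generated $\mathbb{C}$-algebras that are normal domains, let $I\subset R$ and $J\subset S$ be nonzero ideals, and set $T:=R\otimes_{\mathbb C} S$. Then there exists $w_0\in\mathbb{Q}_{>0}$ such that for all rational numbers $w,\tau$ with $w_0\leqslant \tau\leqslant w-w_0$ we have $$\sum_{\alpha\in\mathbb Q,\ 0\leqslant\alpha\leqslant w}\overline{I^\alpha}\,\overline{J^{w-\alpha}}\,T\ \subseteq\ \overline{(IT+JT)^w}\ \subseteq\ \overline{I^\tau}T+\overline{J^{w-\tau}}T=\overline{(IT)^\tau}+\overline{(JT)^{w-\tau}}.$$
   Context: For an ideal $K$ of a Noetherian ring $A$, $\overline{K}$ denotes the integral closure of $K$ (the ideal of elements $x$ satisfying an equation $x^n+a_1x^{n-1}+\cdots+a_n=0$ with $a_i\in K^i$). For a nonnegative rational number $w=p/q$ with $p\in\mathbb Z_{\geqslant0}$, $q\in\mathbb Z_{>0}$, the $w$-th rational power of $K$ is $\overline{K^w}:=\{x\in A\mid x^q\in\overline{K^p}\}$; it does not depend on the representation $p/q$, and $\overline{K^0}=A$. The sum on the left is a sum of ideals of $T$. *)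

theory Defs
  imports Complex_Main "HOL-Computational_Algebra.Fraction_Field"
begin

definition is_ring_hom :: "('a::comm_ring_1 \<Rightarrow> 'b::comm_ring_1) \<Rightarrow> bool" where
  "is_ring_hom f \<longleftrightarrow> f 1 = 1 \<and> (\<forall>x y. f (x + y) = f x + f y) \<and> (\<forall>x y. f (x * y) = f x * f y)"

definition alg_gen :: "(complex \<Rightarrow> 'a::comm_ring_1) \<Rightarrow> 'a set \<Rightarrow> 'a set" where
  "alg_gen phi G = \<Inter>{A. range phi \<subseteq> A \<and> G \<subseteq> A \<and> (\<forall>x\<in>A. \<forall>y\<in>A. x + y \<in> A \<and> x * y \<in> A)}"

definition fg_C_algebra :: "(complex \<Rightarrow> 'a::comm_ring_1) \<Rightarrow> bool" where
  "fg_C_algebra phi \<longleftrightarrow> is_ring_hom phi \<and> (\<exists>G. finite G \<and> alg_gen phi G = UNIV)"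

definition is_normal_domain :: "'a::idom itself \<Rightarrow> bool" where
  "is_normal_domain _ \<longleftrightarrow>
     (\<forall>x :: 'a fract.
        (\<exists>n::nat. n \<ge> 1 \<and> (\<exists>c :: nat \<Rightarrow> 'a.
            x ^ n + (\<Sum>i=1..n. Fract (c i) 1 * x ^ (n - i)) = 0))
        \<longrightarrow> (\<exists>a. x = Fract a 1))"

definition lin_indep :: "(complex \<Rightarrow> 'a::comm_ring_1) \<Rightarrow> nat \<Rightarrow> (nat \<Rightarrow> 'a) \<Rightarrow> bool" where
  "lin_indep phi n r \<longleftrightarrow> (\<forall>c. (\<Sum>k<n. phi (c k) * r k) = 0 \<longrightarrow> (\<forall>k<n. c k = 0))"

text \<open>(T, phiT, iR, iS) is the tensor product of the C-algebras R and S: iR, iS are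
  C-algebra homomorphisms and the induced C-linear map R \<otimes>_C S \<rightarrow> T,
  r \<otimes> s \<mapsto> iR r * iS s, is bijective (surjective; and injective, expressed by: if
  sum iR(r_k) iS(s_k) = 0 with r_k C-linearly independent then all s_k = 0).\<close>
definition is_tensor_product ::
  "(complex \<Rightarrow> 'r::comm_ring_1) \<Rightarrow> (complex \<Rightarrow> 's::comm_ring_1) \<Rightarrow> (complex \<Rightarrow> 't::comm_ring_1)
   \<Rightarrow> ('r \<Rightarrow> 't) \<Rightarrow> ('s \<Rightarrow> 't) \<Rightarrow> bool" where
  "is_tensor_product phiR phiS phiT iR iS \<longleftrightarrow>
     is_ring_hom phiT \<and> is_ring_hom iR \<and> is_ring_hom iS \<and>
     (\<forall>c. iR (phiR c) = phiT c) \<and> (\<forall>c. iS (phiS c) = phiT c) \<and>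
     (\<forall>t. \<exists>(n::nat) r s. t = (\<Sum>k<n. iR (r k) * iS (s k))) \<and>
     (\<forall>(n::nat) r s. lin_indep phiR n r \<and> (\<Sum>k<n. iR (r k) * iS (s k)) = 0 \<longrightarrow> (\<forall>k<n. s k = 0))"

definition is_ideal :: "'a::comm_ring_1 set \<Rightarrow> bool" where
  "is_ideal I \<longleftrightarrow> 0 \<in> I \<and> (\<forall>x\<in>I. \<forall>y\<in>I. x + y \<in> I) \<and> (\<forall>x\<in>I. \<forall>r. r * x \<in> I)"

definition ideal_gen :: "'a::comm_ring_1 set \<Rightarrow> 'a set" where
  "ideal_gen X = \<Inter>{I. is_ideal I \<and> X \<subseteq> I}"

definition ideal_add :: "'a::comm_ring_1 set \<Rightarrow> 'a set \<Rightarrow> 'a set" where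
  "ideal_add I J = {x + y |x y. x \<in> I \<and> y \<in> J}"

definition ideal_mult :: "'a::comm_ring_1 set \<Rightarrow> 'a set \<Rightarrow> 'a set" where
  "ideal_mult I J = ideal_gen {x * y |x y. x \<in> I \<and> y \<in> J}"

primrec ideal_pow :: "'a::comm_ring_1 set \<Rightarrow> nat \<Rightarrow> 'a set" where
  "ideal_pow I 0 = UNIV"
| "ideal_pow I (Suc n) = ideal_mult (ideal_pow I n) I"

definition extension :: "('a::comm_ring_1 \<Rightarrow> 'b::comm_ring_1) \<Rightarrow> 'a set \<Rightarrow> 'b set" where
  "extension f I = ideal_gen (f ` I)"

definition int_closure :: "'a::comm_ring_1 set \<Rightarrow> 'a set" where
  "int_closure K = {x. \<exists>n::nat. n \<ge> 1 \<and> (\<exists>a. (\<forall>i\<in>{1..n}. a i \<in> ideal_pow K i) \<and>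
                        x ^ n + (\<Sum>i=1..n. a i * x ^ (n - i)) = 0)}"

definition rat_pow :: "'a::comm_ring_1 set \<Rightarrow> rat \<Rightarrow> 'a set" where
  "rat_pow K w = (case quotient_of w of (p, q) \<Rightarrow>
      {x. x ^ nat q \<in> int_closure (ideal_pow K (nat p))})"

end

theory Submission
  imports Defs "Jordan_Normal_Form.Char_Poly"
    "HOL-Analysis.Continuum_Not_Denumerable"
    "HOL-Computational_Algebra.Fundamental_Theorem_Algebra"
    "HOL-Computational_Algebra.Polynomial_Factorial"
begin

text \<open>
  Rational powers are ideals and are multiplicative because \<open>x\<close> lies in the \<open>p/q\<close>-th power of \<open>K\<close> iff
  \<open>x X\<^sup>p\<close> is integral over the ring of polynomials whose coefficient of degree \<open>n\<close> lies in the power of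
  \<open>K\<close> with exponent \<open>n/q\<close>, rounded up. This gives the first inclusion.

  For the second one, let \<open>t\<close> lie outside the sum on the right. Slicing \<open>t\<close> with linear functionals
  yields \<open>r\<close> in \<open>R\<close> and \<open>s\<close> in \<open>S\<close> outside the respective rational powers. By the Nullstellensatz and
  Chevalley's extension theorem there are valuations \<open>v\<close>, \<open>v'\<close> of the fraction fields of \<open>R\<close> and \<open>S\<close>
  with residue field \<open>\<complex>\<close> such that \<open>v(r) < \<tau> v(I)\<close> and \<open>v'(s) < (w - \<tau>) v'(J)\<close>. These inequalities
  permit a total order on the product of the two value groups in which \<open>(v(r), v'(s))\<close> is smaller than
  both \<open>w v(I)\<close> and \<open>w v'(J)\<close>. As the residue fields are \<open>\<complex>\<close>, every nonzero element of \<open>T\<close> has a leading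
  term \<open>\<rho> \<otimes> \<sigma>\<close> for this order, and leading terms are multiplicative. The leading term of \<open>t\<close> is at most
  \<open>(v(r), v'(s))\<close>, so an equation of integral dependence for \<open>t\<close> over \<open>(IT + JT)\<^sup>w\<close> is impossible.

  The remaining equality is the same argument with one of the two ideals replaced by \<open>0\<close>. The bound
  \<open>w\<^sub>0 = 1\<close> serves only to make \<open>\<tau>\<close> and \<open>w - \<tau>\<close> positive.
\<close>

section \<open>Integral closure and rational powers\<close>

text \<open>Integral closures can be computed with discrete valuations, but their residue fields are
  in general function fields, and the part of \<open>T\<close> belonging to a pair of values is then
  a tensor product of large spaces. Over the residue field \<complex> each such part is a line
  spanned by one pure tensor, which is why leading terms are single tensors and multiply without
  cancellation. The price is a pair of value groups of unknown rank with no common scale, hence an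
  order on their product that is made to measure for \<open>r\<close> and \<open>s\<close>. Neither
  value groups nor the number v(I) ever appear: v(x) \<ge> v(y) is expressed by x / y lying in the
  valuation ring, and v(I) by quantifying over the elements of powers of \<open>I\<close>. The two
  slices are not independent. The functional that produces \<open>s\<close> vanishes on everything
  in \<open>R\<close> of value greater than v(r), so it is available only once the place of
  \<open>R\<close> has been fixed. This is what guarantees that \<open>t\<close> keeps a term of
  value at most (v(r), v'(s)).\<close>

lemma is_idealD:
  assumes "is_ideal K"
  shows "0 \<in> K" "x \<in> K \<Longrightarrow> y \<in> K \<Longrightarrow> x + y \<in> K" "x \<in> K \<Longrightarrow> r * x \<in> K"
    "x \<in> K \<Longrightarrow> x * r \<in> K"
  using assms by (auto simp: is_ideal_def mult.commute)

lemma is_ideal_sum: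
  assumes "is_ideal K" "\<And>i. i \<in> A \<Longrightarrow> f i \<in> K"
  shows "sum f A \<in> K"
  using assms(2) by (induction A rule: infinite_finite_induct) (auto simp: is_idealD[OF assms(1)])

lemma is_ideal_ideal_gen: "is_ideal (ideal_gen X)"
  by (auto simp: is_ideal_def ideal_gen_def)

lemma subset_ideal_gen: "X \<subseteq> ideal_gen X"
  by (auto simp: ideal_gen_def)

lemma ideal_gen_least: "is_ideal K \<Longrightarrow> X \<subseteq> K \<Longrightarrow> ideal_gen X \<subseteq> K"
  by (auto simp: ideal_gen_def)

lemma is_ideal_UNIV: "is_ideal UNIV"
  by (simp add: is_ideal_def)

lemma is_ideal_ideal_mult: "is_ideal (ideal_mult A B)"
  by (simp add: ideal_mult_def is_ideal_ideal_gen)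

lemma ideal_multI: "x \<in> A \<Longrightarrow> y \<in> B \<Longrightarrow> x * y \<in> ideal_mult A B"
  unfolding ideal_mult_def by (rule subsetD[OF subset_ideal_gen]) auto

lemma ideal_mult_least:
  "is_ideal K \<Longrightarrow> (\<And>x y. x \<in> A \<Longrightarrow> y \<in> B \<Longrightarrow> x * y \<in> K) \<Longrightarrow> ideal_mult A B \<subseteq> K"
  unfolding ideal_mult_def by (rule ideal_gen_least) auto

lemma is_ideal_colon: "is_ideal K \<Longrightarrow> is_ideal {x. x * y \<in> K}"
  by (auto simp: is_ideal_def algebra_simps)

lemma is_ideal_ideal_pow: "is_ideal (ideal_pow K n)"
  by (cases n) (auto simp: is_ideal_UNIV is_ideal_ideal_mult)

lemma ideal_pow_mult:
  assumes "x \<in> ideal_pow K m" "y \<in> ideal_pow K n"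
  shows "x * y \<in> ideal_pow K (m + n)"
  using assms(2)
proof (induction n arbitrary: y)
  case 0
  then show ?case using assms(1) is_idealD[OF is_ideal_ideal_pow] by simp
next
  case (Suc n)
  have "ideal_mult (ideal_pow K n) K \<subseteq> {z. z * x \<in> ideal_pow K (m + Suc n)}"
  proof (rule ideal_mult_least[OF is_ideal_colon[OF is_ideal_ideal_pow]])
    fix a b assume "a \<in> ideal_pow K n" "b \<in> K"
    then have "(x * a) * b \<in> ideal_pow K (m + Suc n)"
      using Suc.IH by (simp add: ideal_multI)
    then show "a * b \<in> {z. z * x \<in> ideal_pow K (m + Suc n)}" by (simp add: ac_simps)
  qed
  then show ?case using Suc.prems by (auto simp: mult.commute)
qed

lemma ideal_pow_antimono:
  assumes "m \<le> n" shows "ideal_pow K n \<subseteq> ideal_pow K m"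
  using assms
proof (induction n rule: dec_induct)
  case (step n)
  have "ideal_mult (ideal_pow K n) K \<subseteq> ideal_pow K n"
    by (rule ideal_mult_least) (auto simp: is_ideal_ideal_pow is_idealD(4)[OF is_ideal_ideal_pow])
  then show ?case using step by auto
qed simp

lemma ideal_pow_power: "x \<in> ideal_pow K m \<Longrightarrow> x ^ n \<in> ideal_pow K (m * n)"
proof (induction n)
  case (Suc n)
  then show ?case using ideal_pow_mult[of x K m "x ^ n" "m * n"] by simp
qed simp

text \<open>An induction principle that avoids unfolding powers into sums of products. It serves for
  images under homomorphisms, for powers of a sum of two ideals and for lower bounds on
  values.\<close>

lemma ideal_pow_subset:
  assumes "\<And>x y n. x \<in> D n \<Longrightarrow> y \<in> K \<Longrightarrow> x * y \<in> D (Suc n)"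
    and "\<And>n. is_ideal (D n)" and "1 \<in> D 0"
  shows "ideal_pow K n \<subseteq> D n"
proof (induction n)
  case 0
  then show ?case using is_idealD(3)[OF assms(2)[of 0] assms(3)] by auto
next
  case (Suc n)
  show ?case unfolding ideal_pow.simps
    by (rule ideal_mult_least) (use Suc assms in auto)
qed

lemma ideal_pow_ideal_pow: "ideal_pow (ideal_pow K m) n = ideal_pow K (m * n)"
proof
  show "ideal_pow (ideal_pow K m) n \<subseteq> ideal_pow K (m * n)"
  proof (rule ideal_pow_subset)
    fix x y n assume "x \<in> ideal_pow K (m * n)" "y \<in> ideal_pow K m"
    then show "x * y \<in> ideal_pow K (m * Suc n)"
      using ideal_pow_mult[of x K "m * n" y m] by (simp add: add.commute)
  qed (auto simp: is_ideal_ideal_pow)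
next
  \<comment> \<open>The converse of \<open>ideal_pow_mult\<close>. Powers are built by one factor at
    a time on the right, so regrouping them into blocks takes an induction of its own.\<close>
  have step: "ideal_pow K (k + m) \<subseteq> ideal_mult (ideal_pow K k) (ideal_pow K m)" for k
  proof (induction m)
    case 0
    then show ?case using ideal_multI[of _ "ideal_pow K k" 1 UNIV] by auto
  next
    case (Suc m)
    have "ideal_mult (ideal_pow K (k + m)) K \<subseteq> ideal_mult (ideal_pow K k) (ideal_pow K (Suc m))"
    proof (rule ideal_mult_least)
      fix x y assume x: "x \<in> ideal_pow K (k + m)" and y: "y \<in> K"
      have "ideal_mult (ideal_pow K k) (ideal_pow K m) \<subseteq>
          {z. z * y \<in> ideal_mult (ideal_pow K k) (ideal_pow K (Suc m))}"
      proof (rule ideal_mult_least[OF is_ideal_colon[OF is_ideal_ideal_mult]])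
        fix a b assume "a \<in> ideal_pow K k" "b \<in> ideal_pow K m"
        then show "a * b \<in> {z. z * y \<in> ideal_mult (ideal_pow K k) (ideal_pow K (Suc m))}"
          using y by (simp add: mult.assoc ideal_multI)
      qed
      then show "x * y \<in> ideal_mult (ideal_pow K k) (ideal_pow K (Suc m))"
        using Suc x by auto
    qed (simp add: is_ideal_ideal_mult)
    then show ?case by simp
  qed
  show "ideal_pow K (m * n) \<subseteq> ideal_pow (ideal_pow K m) n"
  proof (induction n)
    case (Suc n)
    have "ideal_mult (ideal_pow K (m * n)) (ideal_pow K m) \<subseteq> ideal_pow (ideal_pow K m) (Suc n)"
      by (rule ideal_mult_least) (use Suc in \<open>auto simp: is_ideal_ideal_pow is_ideal_ideal_mult ideal_multI\<close>)
    then show ?case using step[of "m * n"] by (simp add: add.commute)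
  qed simp
qed

section \<open>Integral dependence over a subring\<close>

definition is_subring :: "'a::comm_ring_1 set \<Rightarrow> bool" where
  "is_subring B \<longleftrightarrow> 1 \<in> B \<and> (\<forall>x\<in>B. \<forall>y\<in>B. x - y \<in> B \<and> x * y \<in> B)"

definition integral_over :: "'a::comm_ring_1 set \<Rightarrow> 'a \<Rightarrow> bool" where
  "integral_over B x \<longleftrightarrow> (\<exists>n\<ge>1. \<exists>c. (\<forall>i\<in>{1..n}. c i \<in> B) \<and>
     x ^ n + (\<Sum>i=1..n. c i * x ^ (n - i)) = 0)"

lemma is_subringD:
  assumes "is_subring B"
  shows "0 \<in> B" "1 \<in> B" "x \<in> B \<Longrightarrow> - x \<in> B" "x \<in> B \<Longrightarrow> y \<in> B \<Longrightarrow> x + y \<in> B"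
    "x \<in> B \<Longrightarrow> y \<in> B \<Longrightarrow> x - y \<in> B" "x \<in> B \<Longrightarrow> y \<in> B \<Longrightarrow> x * y \<in> B"
proof -
  show o: "1 \<in> B" and m: "x \<in> B \<Longrightarrow> y \<in> B \<Longrightarrow> x - y \<in> B"
    and "x \<in> B \<Longrightarrow> y \<in> B \<Longrightarrow> x * y \<in> B" for x y
    using assms by (auto simp: is_subring_def)
  show z: "0 \<in> B" using m[OF o o] by simp
  show n: "x \<in> B \<Longrightarrow> - x \<in> B" for x using m[OF z] by simp
  show "x \<in> B \<Longrightarrow> y \<in> B \<Longrightarrow> x + y \<in> B" using m[OF _ n] by fastforce
qed

lemma is_subring_sum:
  assumes "is_subring B" "\<And>i. i \<in> A \<Longrightarrow> f i \<in> B"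
  shows "sum f A \<in> B"
  using assms(2) by (induction A rule: infinite_finite_induct) (auto simp: is_subringD[OF assms(1)])

lemma is_subring_prod:
  assumes "is_subring B" "\<And>i. i \<in> A \<Longrightarrow> f i \<in> B"
  shows "prod f A \<in> B"
  using assms(2) by (induction A rule: infinite_finite_induct) (auto simp: is_subringD[OF assms(1)])

lemma is_subring_power: "is_subring B \<Longrightarrow> x \<in> B \<Longrightarrow> x ^ n \<in> B"
  by (induction n) (auto simp: is_subringD)

lemma is_subring_polys: "is_subring B \<Longrightarrow> is_subring {Q. \<forall>i. coeff Q i \<in> B}"
  unfolding is_subring_def[of "Collect _"]
  by (auto simp: coeff_mult is_subringD intro!: is_subring_sum)

lemma integral_over_poly:
  assumes "\<And>i. coeff Q i \<in> B" "degree Q \<ge> 1" "lead_coeff Q = 1" "poly Q x = 0"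
  shows "integral_over B x"
proof -
  let ?n = "degree Q"
  have "0 = (\<Sum>i\<le>?n. coeff Q i * x ^ i)" using assms(4) by (simp add: poly_altdef)
  also have "\<dots> = x ^ ?n + (\<Sum>i<?n. coeff Q i * x ^ i)"
    by (subst lessThan_Suc_atMost[symmetric]) (simp add: assms(3))
  also have "(\<Sum>i<?n. coeff Q i * x ^ i) = (\<Sum>i=1..?n. coeff Q (?n - i) * x ^ (?n - i))"
    by (rule sum.reindex_bij_witness[of _ "\<lambda>i. ?n - i" "\<lambda>i. ?n - i"]) auto
  finally show ?thesis using assms(1,2)
    unfolding integral_over_def by (intro exI[of _ ?n] conjI exI[of _ "\<lambda>i. coeff Q (?n - i)"]) auto
qed

text \<open>The determinant trick: the characteristic polynomial of multiplication by \<open>z\<close> on a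
  finite module containing \<open>1\<close> annihilates \<open>z\<close>.\<close>

lemma integral_over_if_finite_module:
  fixes z :: "'a::comm_ring_1" and N :: nat
  assumes B: "is_subring B" and k0: "k0 < N" "v k0 = 1"
    and zv: "\<And>k. k < N \<Longrightarrow> \<exists>b. (\<forall>l. b l \<in> B) \<and> z * v k = (\<Sum>l<N. b l * v l)"
  shows "integral_over B z"
proof -
  from zv obtain b where b: "\<And>k l. k < N \<Longrightarrow> b k l \<in> B"
      "\<And>k. k < N \<Longrightarrow> z * v k = (\<Sum>l<N. b k l * v l)"
    by metis
  define M where "M = mat N N (\<lambda>(k, l). b k l)"
  define C where "C = mat N N (\<lambda>(k, l). (if k = l then z else 0) - b k l)"
  have M: "M \<in> carrier_mat N N" and C: "C \<in> carrier_mat N N" by (auto simp: M_def C_def)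
  have detC: "poly (char_poly M) z = det C"
    unfolding char_poly_def
    by (rule poly_det_cong[OF C]) (use M in \<open>auto simp: char_poly_matrix_def M_def C_def\<close>)
  have Cv: "C *\<^sub>v vec N v = 0\<^sub>v N"
  proof (rule eq_vecI)
    fix k assume "k < dim_vec (0\<^sub>v N :: 'a vec)"
    then have k: "k < N" by simp
    have "(C *\<^sub>v vec N v) $ k = (\<Sum>l<N. ((if k = l then z else 0) - b k l) * v l)"
      using k by (auto simp: C_def scalar_prod_def lessThan_atLeast0)
    also have "\<dots> = (\<Sum>l<N. (if k = l then z * v l else 0)) - (\<Sum>l<N. b k l * v l)"
      unfolding sum_subtractf[symmetric] by (rule sum.cong) (auto simp: algebra_simps)
    also have "\<dots> = 0" using k b(2)[OF k] by simp
    finally show "(C *\<^sub>v vec N v) $ k = 0\<^sub>v N $ k" using k by simp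
  qed (use C in auto)
  have "(det C \<cdot>\<^sub>m 1\<^sub>m N) *\<^sub>v vec N v = adj_mat C *\<^sub>v (C *\<^sub>v vec N v)"
    using adj_mat[OF C] C by (simp flip: assoc_mult_mat_vec)
  then have "((det C \<cdot>\<^sub>m 1\<^sub>m N) *\<^sub>v vec N v) $ k0 = 0"
    using k0 adj_mat(1)[OF C] by (simp add: Cv)
  moreover have "((det C \<cdot>\<^sub>m 1\<^sub>m N) *\<^sub>v vec N v) $ k0 = det C"
    using k0 by (simp add: scalar_prod_def if_distrib if_distribR cong: if_cong)
  ultimately have root: "poly (char_poly M) z = 0" using detC by simp
  let ?P = "{Q. \<forall>i. coeff Q i \<in> B}"
  have P: "is_subring ?P" by (rule is_subring_polys[OF B])
  have "char_poly M \<in> ?P"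
    unfolding char_poly_def det_def'[OF char_poly_matrix_closed[OF M]]
  proof (rule is_subring_sum[OF P], rule is_subringD(6)[OF P])
    fix \<pi> assume "\<pi> \<in> {p. p permutes {0..<N}}"
    then have pi: "\<And>i. i < N \<Longrightarrow> \<pi> i < N" using permutes_in_image[of \<pi> "{0..<N}"] by auto
    show "signof \<pi> \<in> ?P"
      by (cases \<pi> rule: sign_cases)
        (use is_subringD(2)[OF P] is_subringD(3)[OF P is_subringD(2)[OF P]] in \<open>auto simp del: coeff_minus coeff_1 mem_Collect_eq\<close>)
    show "(\<Prod>i = 0..<N. char_poly_matrix M $$ (i, \<pi> i)) \<in> ?P"
    proof (rule is_subring_prod[OF P])
      fix i assume "i \<in> {0..<N}"
      then have i: "i < N" by simp
      have X: "[:0, 1:] \<in> ?P" using is_subringD[OF B] by (auto simp: coeff_pCons split: nat.split)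
      have Y: "[:- b i (\<pi> i):] \<in> ?P"
        using is_subringD[OF B] b(1)[OF i] by (auto simp: coeff_pCons split: nat.split)
      have "char_poly_matrix M $$ (i, \<pi> i) = [:0, 1:] * (if i = \<pi> i then 1 else 0) + [:- b i (\<pi> i):]"
        using M i pi[OF i] by (simp add: char_poly_matrix_def M_def)
      also have "\<dots> \<in> ?P"
        by (rule is_subringD(4)[OF P _ Y], rule is_subringD(6)[OF P X]) (use is_subringD[OF P] in auto)
      finally show "char_poly_matrix M $$ (i, \<pi> i) \<in> ?P" .
    qed
  qed
  then show ?thesis
    using degree_monic_char_poly[OF M] k0(1) root by (intro integral_over_poly[of "char_poly M"]) auto
qed

definition module_span :: "'a::comm_ring_1 set \<Rightarrow> 'a set \<Rightarrow> 'a set" where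
  "module_span B V = {\<Sum>v\<in>V. b v * v |b. \<forall>v. b v \<in> B}"

context
  fixes B :: "'a::comm_ring_1 set"
  assumes B: "is_subring B"
begin

lemma module_span_add:
  assumes "x \<in> module_span B V" "y \<in> module_span B V" shows "x + y \<in> module_span B V"
proof -
  from assms obtain b c where b: "\<forall>v. b v \<in> B" "\<forall>v. c v \<in> B"
    and eq: "x = (\<Sum>v\<in>V. b v * v)" "y = (\<Sum>v\<in>V. c v * v)"
    by (auto simp: module_span_def)
  have "x + y = (\<Sum>v\<in>V. (b v + c v) * v)" by (simp add: eq sum.distrib algebra_simps)
  then show ?thesis unfolding module_span_def using b is_subringD(4)[OF B]
    by (intro CollectI exI[of _ "\<lambda>v. b v + c v"]) auto
qed

lemma module_span_scale:
  assumes "x \<in> module_span B V" "c \<in> B" shows "c * x \<in> module_span B V"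
proof -
  from assms obtain b where b: "\<forall>v. b v \<in> B" and eq: "x = (\<Sum>v\<in>V. b v * v)"
    by (auto simp: module_span_def)
  have "c * x = (\<Sum>v\<in>V. (c * b v) * v)" by (simp add: eq sum_distrib_left algebra_simps)
  then show ?thesis unfolding module_span_def using b assms is_subringD(6)[OF B]
    by (intro CollectI exI[of _ "\<lambda>v. c * b v"]) auto
qed

lemma module_span_base:
  assumes "x \<in> V" "finite V" shows "x \<in> module_span B V"
proof -
  have "x = (\<Sum>v\<in>V. (if v = x then 1 else 0) * v)" using assms by (simp add: if_distribR if_distrib[of "\<lambda>a. a * _"] cong: if_cong)
  then show ?thesis unfolding module_span_def using is_subringD[OF B]
    by (intro CollectI exI[of _ "\<lambda>v. if v = x then 1 else 0"]) auto
qed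

lemma module_span_sum:
  assumes "\<And>i. i \<in> A \<Longrightarrow> f i \<in> module_span B V" shows "sum f A \<in> module_span B V"
proof -
  have "0 \<in> module_span B V" unfolding module_span_def using is_subringD(1)[OF B]
    by (intro CollectI exI[of _ "\<lambda>_. 0"]) auto
  then show ?thesis using assms
    by (induction A rule: infinite_finite_induct) (auto simp: module_span_add)
qed

lemma module_span_mult_closed:
  assumes "\<And>v. v \<in> V \<Longrightarrow> z * v \<in> module_span B V" "x \<in> module_span B V"
  shows "z * x \<in> module_span B V"
proof -
  from assms obtain b where b: "\<forall>v. b v \<in> B" and eq: "x = (\<Sum>v\<in>V. b v * v)"
    by (auto simp: module_span_def)
  have "z * x = (\<Sum>v\<in>V. b v * (z * v))" by (simp add: eq sum_distrib_left algebra_simps)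
  then show ?thesis using b assms(1) by (simp add: module_span_sum module_span_scale)
qed

lemma integral_over_if_module_span:
  assumes V: "finite V" "1 \<in> V" and z: "\<And>v. v \<in> V \<Longrightarrow> z * v \<in> module_span B V"
  shows "integral_over B z"
proof -
  from V(1) obtain f where f: "bij_betw f {..<card V} V"
    using ex_bij_betw_nat_finite lessThan_atLeast0 by metis
  then have "1 \<in> f ` {..<card V}" using V(2) by (simp add: bij_betw_def)
  then obtain k0 where "k0 < card V" "f k0 = 1" by auto
  then show ?thesis
  proof (rule integral_over_if_finite_module[OF B, where v = f])
    fix k assume "k < card V"
    then have "f k \<in> V" using f by (auto simp: bij_betw_def)
    from z[OF this] obtain b where "\<forall>v. b v \<in> B" "z * f k = (\<Sum>v\<in>V. b v * v)"
      by (auto simp: module_span_def)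
    then show "\<exists>b. (\<forall>l. b l \<in> B) \<and> z * f k = (\<Sum>l<card V. b l * f l)"
      by (intro exI[of _ "\<lambda>l. b (f l)"]) (auto simp: sum.reindex_bij_betw[OF f, of "\<lambda>v. b v * v"])
  qed
qed

text \<open>The products \<open>x ^ i * y ^ j\<close> with \<open>i < n\<close> and
  \<open>j < m\<close> span a module over \<open>B\<close> that contains \<open>1\<close>. The two
  equations rewrite the top powers, so the module is stable under \<open>x\<close> and
  \<open>y\<close>, hence under their sum and product.\<close>

lemma integral_over_closed:
  assumes x: "integral_over B x" and y: "integral_over B y"
  shows "integral_over B (x + y)" "integral_over B (x * y)"
proof -
  from x obtain n c where n: "n \<ge> 1" "\<forall>i\<in>{1..n}. c i \<in> B"
      and xn: "x ^ n + (\<Sum>i=1..n. c i * x ^ (n - i)) = 0"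
    by (auto simp: integral_over_def)
  from y obtain m d where m: "m \<ge> 1" "\<forall>i\<in>{1..m}. d i \<in> B"
      and ym: "y ^ m + (\<Sum>i=1..m. d i * y ^ (m - i)) = 0"
    by (auto simp: integral_over_def)
  define V where "V = (\<lambda>(i, j). x ^ i * y ^ j) ` ({..<n} \<times> {..<m})"
  have V: "finite V" by (simp add: V_def)
  have mem: "x ^ i * y ^ j \<in> module_span B V" if "i < n" "j < m" for i j
    by (rule module_span_base[OF _ V]) (use that in \<open>auto simp: V_def\<close>)
  have one: "1 \<in> V" unfolding V_def using n(1) m(1)
    by (intro image_eqI[of _ _ "(0, 0)"]) auto
  have xV: "x * v \<in> module_span B V" if "v \<in> V" for v
  proof -
    from that obtain i j where v: "v = x ^ i * y ^ j" "i < n" "j < m" by (auto simp: V_def)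
    show ?thesis
    proof (cases "Suc i < n")
      case True
      then show ?thesis using mem[of "Suc i" j] v by (simp add: ac_simps)
    next
      case False
      then have i: "Suc i = n" using v by simp
      have "x ^ n = (\<Sum>i=1..n. - c i * x ^ (n - i))"
        using xn by (simp add: sum_negf eq_neg_iff_add_eq_0)
      moreover have "x * v = x ^ n * y ^ j" using v i by (metis power_Suc mult.assoc)
      ultimately have "x * v = (\<Sum>i=1..n. - c i * (x ^ (n - i) * y ^ j))"
        by (simp add: sum_distrib_right mult.assoc)
      also have "\<dots> \<in> module_span B V"
        by (intro module_span_sum module_span_scale mem) (use n v(3) is_subringD(3)[OF B] in auto)
      finally show ?thesis .
    qed
  qed
  have yV: "y * v \<in> module_span B V" if "v \<in> V" for v
  proof -
    from that obtain i j where v: "v = x ^ i * y ^ j" "i < n" "j < m" by (auto simp: V_def)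
    show ?thesis
    proof (cases "Suc j < m")
      case True
      then show ?thesis using mem[of i "Suc j"] v by (simp add: ac_simps)
    next
      case False
      then have j: "Suc j = m" using v by simp
      have "y ^ m = (\<Sum>i=1..m. - d i * y ^ (m - i))"
        using ym by (simp add: sum_negf eq_neg_iff_add_eq_0)
      moreover have "y * v = x ^ i * y ^ m" using v j by (metis power_Suc mult.left_commute)
      ultimately have "y * v = (\<Sum>k=1..m. - d k * (x ^ i * y ^ (m - k)))"
        by (simp add: sum_distrib_left ac_simps)
      also have "\<dots> \<in> module_span B V"
        by (intro module_span_sum module_span_scale mem) (use m v(2) is_subringD(3)[OF B] in auto)
      finally show ?thesis .
    qed
  qed
  show "integral_over B (x + y)"
    by (rule integral_over_if_module_span[OF V one])
      (auto simp: distrib_right intro!: module_span_add xV yV)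
  show "integral_over B (x * y)"
    by (rule integral_over_if_module_span[OF V one])
      (auto simp: mult.assoc intro!: module_span_mult_closed[OF xV] yV)
qed

lemma integral_over_base: "x \<in> B \<Longrightarrow> integral_over B x"
  unfolding integral_over_def
  by (intro exI[of _ 1] conjI exI[of _ "\<lambda>_. - x"]) (auto simp: is_subringD(3)[OF B])

lemma integral_over_power: "integral_over B x \<Longrightarrow> integral_over B (x ^ n)"
  by (induction n) (auto simp: integral_over_closed integral_over_base is_subringD(2)[OF B])

end

text \<open>An equation for \<open>x ^ k\<close> is already an equation for \<open>x\<close> of
  degree \<open>k * n\<close>; \<open>d\<close> fills in zeros at the indices not divisible by
  \<open>k\<close>.\<close>

lemma integral_over_powerD:
  assumes B: "is_subring B" and k: "k > 0" and x: "integral_over B (x ^ k)"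
  shows "integral_over B x"
proof -
  from x obtain n c where n: "n \<ge> 1" "\<forall>i\<in>{1..n}. c i \<in> B"
      and eq: "(x ^ k) ^ n + (\<Sum>i=1..n. c i * (x ^ k) ^ (n - i)) = 0"
    by (auto simp: integral_over_def)
  define d where "d j = (if k dvd j then c (j div k) else 0)" for j
  have "(\<Sum>j=1..k * n. d j * x ^ (k * n - j)) = (\<Sum>j\<in>(*) k ` {1..n}. d j * x ^ (k * n - j))"
  proof (rule sum.mono_neutral_right)
    show "(*) k ` {1..n} \<subseteq> {1..k * n}" using k by auto
    show "\<forall>i\<in>{1..k * n} - (*) k ` {1..n}. d i * x ^ (k * n - i) = 0"
    proof
      fix i assume i: "i \<in> {1..k * n} - (*) k ` {1..n}"
      have "\<not> k dvd i"
      proof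
        assume "k dvd i"
        then obtain l where "i = k * l" by (auto elim: dvdE)
        then have "l \<in> {1..n}" using i k by (auto simp: Suc_le_eq)
        then show False using i \<open>i = k * l\<close> by auto
      qed
      then show "d i * x ^ (k * n - i) = 0" by (simp add: d_def)
    qed
  qed simp
  also have "\<dots> = (\<Sum>i=1..n. d (k * i) * x ^ (k * n - k * i))"
    using k by (subst sum.reindex) (auto simp: inj_on_def)
  also have "\<dots> = (\<Sum>i=1..n. c i * (x ^ k) ^ (n - i))"
    using k by (intro sum.cong) (auto simp: d_def power_mult[symmetric] diff_mult_distrib2)
  finally have "x ^ (k * n) + (\<Sum>j=1..k * n. d j * x ^ (k * n - j)) = 0"
    using eq by (simp add: power_mult)
  moreover have "d j \<in> B" if "j \<in> {1..k * n}" for j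
  proof (cases "k dvd j")
    case True
    then obtain l where "j = k * l" by (auto elim: dvdE)
    then have "l \<in> {1..n}" using that k by (auto simp: Suc_le_eq)
    then show ?thesis using n k \<open>j = k * l\<close> by (simp add: d_def)
  qed (simp add: d_def is_subringD(1)[OF B])
  ultimately show ?thesis unfolding integral_over_def using n k
    by (intro exI[of _ "k * n"] conjI exI[of _ d]) auto
qed

section \<open>Rational powers as graded pieces of an integral closure\<close>

text \<open>For \<open>q = 1\<close> this is the Rees ring of \<open>K\<close>. One ring for each
  denominator \<open>q\<close> puts all exponents with that denominator into a single integral
  closure, so that sums and products of elements of rational powers are handled by
  \<open>integral_over_closed\<close>.\<close>

definition rees :: "'a::comm_ring_1 set \<Rightarrow> nat \<Rightarrow> 'a poly set" where
  "rees K q = {Q. \<forall>n. coeff Q n \<in> ideal_pow K ((n + (q - 1)) div q)}"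

text \<open>Rounding up is subadditive, \<open>c n \<le> c i + c (n - i)\<close>, and a larger
  exponent gives a smaller ideal.\<close>

lemma is_subring_rees:
  assumes "q > 0" shows "is_subring (rees K q)"
proof -
  define c where "c n = (n + (q - 1)) div q" for n
  have c1: "n \<le> q * c n" for n
    using dividend_less_times_div[OF assms, of "n + (q - 1)"] by (simp add: c_def)
  have c2: "c n \<le> m" if "n \<le> q * m" for n m
  proof -
    have "n + (q - 1) < (m + 1) * q" using that assms by (simp add: algebra_simps)
    from less_mult_imp_div_less[OF this] show ?thesis by (simp add: c_def)
  qed
  have c3: "c n \<le> c i + c (n - i)" if "i \<le> n" for n i
    by (rule c2) (use c1[of i] c1[of "n - i"] that in \<open>simp add: distrib_left\<close>)
  have c0: "c 0 = 0" using assms by (simp add: c_def)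
  have sub: "x - y \<in> ideal_pow K n" if "x \<in> ideal_pow K n" "y \<in> ideal_pow K n" for x y n
    using is_idealD(2)[OF is_ideal_ideal_pow that(1) is_idealD(3)[OF is_ideal_ideal_pow that(2), of "-1"]]
    by simp
  have "coeff (P * Q) n \<in> ideal_pow K (c n)"
    if "\<And>n. coeff P n \<in> ideal_pow K (c n)" "\<And>n. coeff Q n \<in> ideal_pow K (c n)" for P Q n
    unfolding coeff_mult
    by (rule is_ideal_sum[OF is_ideal_ideal_pow])
      (simp add: subsetD[OF ideal_pow_antimono[OF c3] ideal_pow_mult[OF that]])
  moreover have "coeff 1 n \<in> ideal_pow K (c n)" for n
    by (cases "n = 0") (auto simp: c0 is_idealD(1)[OF is_ideal_ideal_pow])
  ultimately show ?thesis
    unfolding is_subring_def rees_def c_def[symmetric] by (auto simp: sub)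
qed

text \<open>Passing to the \<open>q\<close>-th power of the monomial makes its degree
  \<open>p * q\<close> divisible by \<open>q\<close>, so rounding has no effect in the degrees
  \<open>p * q * i\<close>. The coefficient of degree \<open>p * q * n\<close> in an equation for
  that power is an equation for \<open>x ^ q\<close>; conversely an equation for
  \<open>x ^ q\<close> is made homogeneous, and the \<open>q\<close>-th root is taken by
  \<open>integral_over_powerD\<close>.\<close>

lemma integral_over_rees_iff:
  assumes q: "q > 0"
  shows "integral_over (rees K q) (monom x p) \<longleftrightarrow> x ^ q \<in> int_closure (ideal_pow K p)"
proof
  assume "integral_over (rees K q) (monom x p)"
  then have "integral_over (rees K q) (monom (x ^ q) (p * q))"
    using integral_over_power[OF is_subring_rees[OF q], of K "monom x p" q]
    by (simp add: monom_power)
  then obtain n c where n: "n \<ge> 1" "\<forall>i\<in>{1..n}. c i \<in> rees K q"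
      and eq: "monom (x ^ q) (p * q) ^ n + (\<Sum>i=1..n. c i * monom (x ^ q) (p * q) ^ (n - i)) = 0"
    by (auto simp: integral_over_def)
  have "0 = coeff (monom (x ^ q) (p * q) ^ n + (\<Sum>i=1..n. c i * monom (x ^ q) (p * q) ^ (n - i))) (p * q * n)"
    unfolding eq by simp
  also have "\<dots> = (x ^ q) ^ n + (\<Sum>i=1..n. coeff (c i * monom ((x ^ q) ^ (n - i)) (p * q * (n - i))) (p * q * n))"
    by (simp add: monom_power coeff_sum)
  also have "(\<Sum>i=1..n. coeff (c i * monom ((x ^ q) ^ (n - i)) (p * q * (n - i))) (p * q * n))
      = (\<Sum>i=1..n. coeff (c i) (p * q * i) * (x ^ q) ^ (n - i))"
  proof (rule sum.cong)
    fix i assume i: "i \<in> {1..n}"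
    have "p * q * n - p * q * (n - i) = p * q * i"
      using i by (simp add: diff_mult_distrib2 flip: diff_mult_distrib2)
    then show "coeff (c i * monom ((x ^ q) ^ (n - i)) (p * q * (n - i))) (p * q * n)
        = coeff (c i) (p * q * i) * (x ^ q) ^ (n - i)"
      by (auto simp: coeff_monom_mult mult.commute[of "c i"] mult.commute[of "coeff _ _"])
  qed simp
  finally have e: "(x ^ q) ^ n + (\<Sum>i=1..n. coeff (c i) (p * q * i) * (x ^ q) ^ (n - i)) = 0" by simp
  have "coeff (c i) (p * q * i) \<in> ideal_pow (ideal_pow K p) i" if "i \<in> {1..n}" for i
  proof -
    have "p * q * i + (q - 1) = (q - 1) + (p * i) * q" by simp
    then have "(p * q * i + (q - 1)) div q = p * i" using q by (simp only: div_mult_self1) simp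
    then show ?thesis using n(2) that by (auto simp: rees_def ideal_pow_ideal_pow dest!: bspec spec[of _ "p * q * i"])
  qed
  with e n(1) show "x ^ q \<in> int_closure (ideal_pow K p)"
    unfolding int_closure_def by (intro CollectI exI[of _ n] conjI exI[of _ "\<lambda>i. coeff (c i) (p * q * i)"]) auto
next
  assume "x ^ q \<in> int_closure (ideal_pow K p)"
  then obtain n a where n: "n \<ge> 1" "\<forall>i\<in>{1..n}. a i \<in> ideal_pow (ideal_pow K p) i"
      and eq: "(x ^ q) ^ n + (\<Sum>i=1..n. a i * (x ^ q) ^ (n - i)) = 0"
    by (auto simp: int_closure_def)
  have "monom (x ^ q) (p * q) ^ n + (\<Sum>i=1..n. monom (a i) (p * q * i) * monom (x ^ q) (p * q) ^ (n - i))
      = monom ((x ^ q) ^ n) (p * q * n) + (\<Sum>i=1..n. monom (a i * (x ^ q) ^ (n - i)) (p * q * n))"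
    by (intro arg_cong2[of _ _ _ _ "(+)"] sum.cong)
      (auto simp: monom_power mult_monom simp flip: distrib_left)
  also have "\<dots> = monom ((x ^ q) ^ n + (\<Sum>i=1..n. a i * (x ^ q) ^ (n - i))) (p * q * n)"
    by (simp add: monom_sum flip: add_monom)
  finally have "monom (x ^ q) (p * q) ^ n + (\<Sum>i=1..n. monom (a i) (p * q * i) * monom (x ^ q) (p * q) ^ (n - i)) = 0"
    unfolding eq by simp
  moreover have "monom (a i) (p * q * i) \<in> rees K q" if "i \<in> {1..n}" for i
  proof -
    have "p * q * i + (q - 1) = (q - 1) + (p * i) * q" by simp
    then have "(p * q * i + (q - 1)) div q = p * i" using q by (simp only: div_mult_self1) simp
    then show ?thesis using n(2) that
      by (auto simp: rees_def ideal_pow_ideal_pow is_idealD(1)[OF is_ideal_ideal_pow])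
  qed
  ultimately have "integral_over (rees K q) (monom (x ^ q) (p * q))"
    unfolding integral_over_def using n(1)
    by (intro exI[of _ n] conjI exI[of _ "\<lambda>i. monom (a i) (p * q * i)"]) auto
  then have "integral_over (rees K q) (monom x p ^ q)" by (simp add: monom_power)
  then show "integral_over (rees K q) (monom x p)"
    by (rule integral_over_powerD[OF is_subring_rees[OF q] q])
qed

text \<open>In the Rees ring with \<open>q = 1\<close>, a monomial is integral exactly when its
  \<open>k\<close>-th power is.\<close>

lemma int_closure_power_iff:
  assumes "k > 0"
  shows "x ^ k \<in> int_closure (ideal_pow K (p * k)) \<longleftrightarrow> x \<in> int_closure (ideal_pow K p)"
proof -
  have "integral_over (rees K 1) (monom (x ^ k) (p * k)) \<longleftrightarrow> integral_over (rees K 1) (monom x p)"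
    using integral_over_power[OF is_subring_rees[of 1], of K "monom x p" k]
      integral_over_powerD[OF is_subring_rees[of 1] assms, of K "monom x p"]
    by (auto simp: monom_power)
  then show ?thesis by (simp add: integral_over_rees_iff)
qed

text \<open>\<open>rat_pow\<close> is defined through the reduced fraction. Any other one arises by
  multiplying numerator and denominator by some \<open>k\<close>, which
  \<open>int_closure_power_iff\<close> cancels.\<close>

lemma rat_pow_eq:
  assumes q: "q > 0"
  shows "rat_pow K (of_nat p / of_nat q) = {x. x ^ q \<in> int_closure (ideal_pow K p)}"
proof -
  obtain a b where ab: "quotient_of (of_nat p / of_nat q) = (a, b)" by force
  then have b: "b > 0" and cop: "coprime a b" and e: "of_nat p / of_nat q = (of_int a / of_int b :: rat)"
    using quotient_of_denom_pos quotient_of_coprime quotient_of_div by blast+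
  have "of_int a = (of_nat p / of_nat q :: rat) * of_int b" using b by (simp add: e)
  then have "of_int a \<ge> (0 :: rat)" using b by simp
  then have a: "a \<ge> 0" by simp
  have "of_nat p * of_int b = (of_int a * of_nat q :: rat)" using e b q by (simp add: field_simps)
  then have "int p * b = a * int q"
    by (metis (mono_tags, lifting) of_int_eq_iff of_int_mult of_int_of_nat_eq)
  then have e2: "p * nat b = nat a * q" using a b
    by (metis int_nat_eq nat_int nat_mult_distrib of_nat_0_le_iff order_less_imp_le)
  have "coprime (nat a) (nat b)" using cop a b by (simp add: coprime_int_iff[symmetric])
  moreover have "nat b dvd nat a * q" using e2 by (metis dvd_triv_right)
  ultimately have "nat b dvd q" by (simp add: coprime_commute coprime_dvd_mult_right_iff)
  then obtain k where k: "q = nat b * k" by (auto elim: dvdE)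
  then have p: "p = nat a * k" using e2 b by simp
  have k0: "k > 0" using q k by (cases k) auto
  have "rat_pow K (of_nat p / of_nat q) = {x. x ^ nat b \<in> int_closure (ideal_pow K (nat a))}"
    by (simp add: rat_pow_def ab)
  also have "\<dots> = {x. x ^ q \<in> int_closure (ideal_pow K p)}"
    using int_closure_power_iff[OF k0, of _ K "nat a"] by (simp add: p k power_mult)
  finally show ?thesis .
qed

lemma rat_pow_iff_integral:
  assumes "q > 0"
  shows "x \<in> rat_pow K (of_nat p / of_nat q) \<longleftrightarrow> integral_over (rees K q) (monom x p)"
  by (simp add: rat_pow_eq integral_over_rees_iff assms)

lemma nonneg_rat_fraction:
  assumes "w \<ge> (0::rat)" obtains p q where "q > 0" "w = of_nat p / of_nat q"
proof -
  obtain a b where ab: "quotient_of w = (a, b)" by force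
  then have b: "b > 0" and e: "w = of_int a / of_int b"
    using quotient_of_denom_pos quotient_of_div by blast+
  have "a \<ge> 0" using assms b by (simp add: e zero_le_divide_iff)
  then have "w = of_nat (nat a) / of_nat (nat b)" using b by (simp add: e)
  then show ?thesis using that[of "nat b" "nat a"] b by simp
qed

lemma nonneg_rats_common_denominator:
  assumes "v \<ge> (0::rat)" "w \<ge> (0::rat)"
  obtains a b q where "q > 0" "v = of_nat a / of_nat q" "w = of_nat b / of_nat q"
proof -
  obtain a q where 1: "q > 0" "v = of_nat a / of_nat q" by (rule nonneg_rat_fraction[OF assms(1)])
  obtain b r where 2: "r > 0" "w = of_nat b / of_nat r" by (rule nonneg_rat_fraction[OF assms(2)])
  show ?thesis
    by (rule that[of "q * r" "a * r" "b * q"]) (use 1 2 in \<open>auto simp: field_simps\<close>)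
qed

lemma is_ideal_rat_pow:
  assumes "w \<ge> 0" shows "is_ideal (rat_pow K w)"
proof -
  obtain p q where q: "q > 0" and w: "w = of_nat p / of_nat q" by (rule nonneg_rat_fraction[OF assms])
  note iff = rat_pow_iff_integral[OF q, of _ K p, folded w]
  have B: "is_subring (rees K q)" by (rule is_subring_rees[OF q])
  have "0 \<in> rat_pow K w"
    unfolding iff by (rule integral_over_base[OF B]) (simp add: is_subringD[OF B])
  moreover have "x + y \<in> rat_pow K w" if "x \<in> rat_pow K w" "y \<in> rat_pow K w" for x y
    using integral_over_closed(1)[OF B] that unfolding iff by (simp flip: add_monom)
  moreover have "r * x \<in> rat_pow K w" if "x \<in> rat_pow K w" for r x
  proof -
    have "integral_over (rees K q) (monom r 0)"
      by (rule integral_over_base[OF B])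
        (use q in \<open>auto simp: rees_def is_idealD(1)[OF is_ideal_ideal_pow]\<close>)
    then have "integral_over (rees K q) (monom r 0 * monom x p)"
      using that unfolding iff by (rule integral_over_closed(2)[OF B])
    then show ?thesis unfolding iff by (simp add: mult_monom)
  qed
  ultimately show ?thesis by (auto simp: is_ideal_def)
qed

lemma rat_pow_mult:
  assumes "v \<ge> 0" "w \<ge> 0" "x \<in> rat_pow K v" "y \<in> rat_pow K w"
  shows "x * y \<in> rat_pow K (v + w)"
proof -
  obtain a b q where q: "q > 0" "v = of_nat a / of_nat q" "w = of_nat b / of_nat q"
    by (rule nonneg_rats_common_denominator[OF assms(1,2)])
  have "integral_over (rees K q) (monom x a * monom y b)"
    using assms(3,4) by (intro integral_over_closed(2)[OF is_subring_rees[OF q(1)]])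
      (simp_all add: q rat_pow_iff_integral)
  then have "x * y \<in> rat_pow K (of_nat (a + b) / of_nat q)"
    unfolding rat_pow_iff_integral[OF q(1)] by (simp add: mult_monom)
  then show ?thesis by (simp add: q(2,3) add_divide_distrib)
qed

lemma is_ring_homD:
  assumes "is_ring_hom f"
  shows "f 0 = 0" "f 1 = 1" "f (x + y) = f x + f y" "f (x * y) = f x * f y" "f (- x) = - f x"
    "f (x - y) = f x - f y" "f (x ^ n) = f x ^ n" "f (sum g A) = (\<Sum>a\<in>A. f (g a))"
proof -
  show o: "f 1 = 1" and a: "f (x + y) = f x + f y" and m: "f (x * y) = f x * f y" for x y
    using assms by (auto simp: is_ring_hom_def)
  show z: "f 0 = 0" using a[of 0 0] by simp
  show n: "f (- x) = - f x" for x using a[of x "- x"] z by (simp add: eq_neg_iff_add_eq_0 add.commute)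
  show "f (x - y) = f x - f y" using a[of x "- y"] n by simp
  show "f (x ^ n) = f x ^ n" by (induction n) (auto simp: o m)
  show "f (sum g A) = (\<Sum>a\<in>A. f (g a))"
    by (induction A rule: infinite_finite_induct) (auto simp: z a)
qed

lemma ring_hom_ideal_pow:
  assumes f: "is_ring_hom f" and "f ` K \<subseteq> L"
  shows "f ` ideal_pow K n \<subseteq> ideal_pow L n"
proof -
  have "ideal_pow K n \<subseteq> {x. f x \<in> ideal_pow L n}"
    by (rule ideal_pow_subset)
      (use assms is_idealD[OF is_ideal_ideal_pow] in \<open>auto simp: is_ring_homD[OF f] is_ideal_def intro!: ideal_multI\<close>)
  then show ?thesis by auto
qed

lemma ring_hom_int_closure:
  assumes f: "is_ring_hom f" and "f ` K \<subseteq> L" "x \<in> int_closure K"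
  shows "f x \<in> int_closure L"
proof -
  from assms(3) obtain n a where n: "n \<ge> 1" "\<forall>i\<in>{1..n}. a i \<in> ideal_pow K i"
      and eq: "x ^ n + (\<Sum>i=1..n. a i * x ^ (n - i)) = 0"
    by (auto simp: int_closure_def)
  have "f x ^ n + (\<Sum>i=1..n. f (a i) * f x ^ (n - i)) = f (x ^ n + (\<Sum>i=1..n. a i * x ^ (n - i)))"
    by (simp add: is_ring_homD[OF f])
  also have "\<dots> = 0" unfolding eq by (rule is_ring_homD(1)[OF f])
  finally show ?thesis using n ring_hom_ideal_pow[OF assms(1,2)] unfolding int_closure_def
    by (intro CollectI exI[of _ n] conjI exI[of _ "\<lambda>i. f (a i)"]) auto
qed

lemma ring_hom_rat_pow:
  assumes f: "is_ring_hom f" and "f ` K \<subseteq> L" "x \<in> rat_pow K w"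
  shows "f x \<in> rat_pow L w"
proof -
  obtain p q where "quotient_of w = (p, q)" by force
  then show ?thesis
    using ring_hom_int_closure[OF f ring_hom_ideal_pow[OF assms(1,2)]] assms(3)
    by (simp add: rat_pow_def is_ring_homD(7)[OF f, symmetric])
qed

section \<open>Places with residue field \<open>\<complex>\<close>\<close>

lemma ring_hom_map_poly:
  assumes f: "is_ring_hom f"
  shows "map_poly f (p + q) = map_poly f p + map_poly f q"
    and "map_poly f (p * q) = map_poly f p * map_poly f q"
  by (rule poly_eqI; simp add: coeff_map_poly is_ring_homD[OF f] coeff_mult)+

locale C_algebra =
  fixes phi :: "complex \<Rightarrow> 'a::comm_ring_1"
  assumes hom: "is_ring_hom phi"
begin

lemmas phi_simps = is_ring_homD[OF hom]

sublocale vs: vector_space "\<lambda>c x. phi c * x"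
  by unfold_locales (auto simp: phi_simps algebra_simps)

text \<open>A space of countable dimension is a countable union of finite-dimensional ones, so one
  of these contains infinitely many members of any injective family indexed by \<complex>.\<close>

lemma span_range_finite:
  assumes "x \<in> vs.span (range e)" shows "\<exists>n::nat. x \<in> vs.span (e ` {..<n})"
  using assms
proof (induction rule: vs.span_induct_alt)
  case base
  show ?case by (auto intro: vs.span_zero)
next
  case (step c x y)
  then obtain n k where n: "y \<in> vs.span (e ` {..<n})" and k: "x = e k" by auto
  have "y \<in> vs.span (e ` {..<max n (Suc k)})"
    using n vs.span_mono[of "e ` {..<n}" "e ` {..<max n (Suc k)}"] by fastforce
  moreover have "x \<in> vs.span (e ` {..<max n (Suc k)})"
    unfolding k by (rule vs.span_base) auto
  ultimately show ?case by (blast intro: vs.span_add vs.span_scale)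
qed

text \<open>Ideals relative to a subset \<open>A\<close>, because the rings of interest, such as
  \<open>R[L / y]\<close>, are subrings of a fraction field and not types.\<close>

definition rel_ideal :: "'a set \<Rightarrow> 'a set \<Rightarrow> bool" where
  "rel_ideal A m \<longleftrightarrow> m \<subseteq> A \<and> 0 \<in> m \<and> (\<forall>x\<in>m. \<forall>y\<in>m. x + y \<in> m) \<and> (\<forall>a\<in>A. \<forall>x\<in>m. a * x \<in> m)"

lemma ex_maximal_rel_ideal:
  assumes A: "is_subring A" and a: "rel_ideal A a" "1 \<notin> a"
  obtains m where "a \<subseteq> m" "rel_ideal A m" "1 \<notin> m"
    "\<And>x. x \<in> A \<Longrightarrow> x \<notin> m \<Longrightarrow> \<exists>b\<in>A. x * b - 1 \<in> m"
proof -
  define F where "F = {m. a \<subseteq> m \<and> rel_ideal A m \<and> 1 \<notin> m}"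
  have "\<exists>M\<in>F. \<forall>X\<in>F. M \<subseteq> X \<longrightarrow> X = M"
  proof (rule subset_Zorn_nonempty)
    show "F \<noteq> {}" using a by (auto simp: F_def)
    fix C assume C: "C \<noteq> {}" "subset.chain F C"
    then have CF: "C \<subseteq> F" and lin: "\<And>X Y. X \<in> C \<Longrightarrow> Y \<in> C \<Longrightarrow> X \<subseteq> Y \<or> Y \<subseteq> X"
      by (auto simp: subset.chain_def)
    have "x + y \<in> \<Union>C" if xy: "x \<in> \<Union>C" "y \<in> \<Union>C" for x y
    proof -
      from xy obtain X Y where XY: "X \<in> C" "Y \<in> C" "x \<in> X" "y \<in> Y" by auto
      then obtain Z where "Z \<in> C" "x \<in> Z" "y \<in> Z" using lin[OF XY(1,2)] by blast
      moreover have "rel_ideal A Z" using \<open>Z \<in> C\<close> CF by (auto simp: F_def)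
      ultimately show ?thesis by (auto simp: rel_ideal_def)
    qed
    moreover have CD: "a \<subseteq> X" "X \<subseteq> A" "0 \<in> X" "1 \<notin> X" "\<And>b x. b \<in> A \<Longrightarrow> x \<in> X \<Longrightarrow> b * x \<in> X"
      if "X \<in> C" for X
      using subsetD[OF CF that] by (auto simp: F_def rel_ideal_def)
    moreover obtain X0 where "X0 \<in> C" using C(1) by blast
    then have "0 \<in> \<Union>C" "a \<subseteq> \<Union>C" using CD by blast+
    moreover have "\<Union>C \<subseteq> A" "1 \<notin> \<Union>C" using CD by blast+
    moreover have "b * x \<in> \<Union>C" if "b \<in> A" "x \<in> \<Union>C" for b x using that CD by blast
    ultimately show "\<Union>C \<in> F" by (simp add: F_def rel_ideal_def)
  qed
  then obtain m where m: "m \<in> F" and mx: "\<And>X. X \<in> F \<Longrightarrow> m \<subseteq> X \<Longrightarrow> X = m" by blast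
  have mi: "rel_ideal A m" "1 \<notin> m" "a \<subseteq> m" using m by (auto simp: F_def)
  have mneg: "- x \<in> m" if "x \<in> m" for x
  proof -
    have "(- 1) * x \<in> m" using mi(1) that is_subringD(3)[OF A is_subringD(2)[OF A]]
      unfolding rel_ideal_def by blast
    then show ?thesis by simp
  qed
  show ?thesis
  proof (rule that[OF mi(3,1,2)])
    fix x assume x: "x \<in> A" "x \<notin> m"
    define m' where "m' = {y + x * b |y b. y \<in> m \<and> b \<in> A}"
    have mm': "m \<subseteq> m'"
    proof
      fix y assume "y \<in> m"
      then have "y = y + x * 0 \<and> y \<in> m \<and> 0 \<in> A" using is_subringD(1)[OF A] by simp
      then show "y \<in> m'" unfolding m'_def by blast
    qed
    have "x = 0 + x * 1 \<and> 0 \<in> m \<and> 1 \<in> A"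
      using mi(1) is_subringD(2)[OF A] by (auto simp: rel_ideal_def)
    then have "x \<in> m'" unfolding m'_def by blast
    have "rel_ideal A m'"
      unfolding rel_ideal_def
    proof (intro conjI ballI)
      show "m' \<subseteq> A" using mi(1) x(1) is_subringD[OF A] by (auto simp: m'_def rel_ideal_def)
      show "0 \<in> m'" using mm' mi(1) by (auto simp: rel_ideal_def)
    next
      fix u v assume "u \<in> m'" "v \<in> m'"
      then obtain y b z c where "u = y + x * b" "y \<in> m" "b \<in> A" "v = z + x * c" "z \<in> m" "c \<in> A"
        by (auto simp: m'_def)
      then have "u + v = (y + z) + x * (b + c) \<and> y + z \<in> m \<and> b + c \<in> A"
        using mi(1) is_subringD[OF A] by (auto simp: rel_ideal_def algebra_simps)
      then show "u + v \<in> m'" unfolding m'_def by blast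
    next
      fix d u assume "d \<in> A" "u \<in> m'"
      then obtain y b where "u = y + x * b" "y \<in> m" "b \<in> A" by (auto simp: m'_def)
      then have "d * u = d * y + x * (d * b) \<and> d * y \<in> m \<and> d * b \<in> A"
        using mi(1) is_subringD[OF A] \<open>d \<in> A\<close> by (auto simp: rel_ideal_def algebra_simps)
      then show "d * u \<in> m'" unfolding m'_def by blast
    qed
    then have "1 \<in> m'" using mx[of m'] mm' \<open>x \<in> m'\<close> x(2) mi(3) by (auto simp: F_def)
    then obtain y b where yb: "1 = y + x * b" "y \<in> m" "b \<in> A" by (auto simp: m'_def)
    then have "x * b - 1 = - y" by (simp add: algebra_simps)
    then show "\<exists>b\<in>A. x * b - 1 \<in> m" using yb mneg by metis
  qed
qed

text \<open>A maximal ideal \<open>m\<close> of an algebra of countable dimension has residue field \<open>\<complex>\<close>: otherwise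
  the uncountably many inverses of \<open>x - c\<close> modulo \<open>m\<close> would be linearly independent.\<close>

lemma residue_field_complex:
  assumes A: "is_subring A" "range phi \<subseteq> A" "A \<subseteq> vs.span (range (e :: nat \<Rightarrow> 'a))"
    and m: "rel_ideal A m" "1 \<notin> m" "\<And>x. x \<in> A \<Longrightarrow> x \<notin> m \<Longrightarrow> \<exists>b\<in>A. x * b - 1 \<in> m"
    and x: "x \<in> A"
  shows "\<exists>c. x - phi c \<in> m"
proof (rule ccontr)
  assume neg: "\<not> ?thesis"
  have phA: "phi c \<in> A" for c using A(2) by auto
  note As = is_subringD[OF A(1)] phA
  have madd: "u + v \<in> m" if "u \<in> m" "v \<in> m" for u v using m(1) that by (auto simp: rel_ideal_def)
  have mmul: "a * u \<in> m" "u * a \<in> m" if "a \<in> A" "u \<in> m" for u a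
    using m(1) that by (auto simp: rel_ideal_def mult.commute)
  have msub: "u - v \<in> m" if "u \<in> m" "v \<in> m" for u v
  proof -
    have "- v \<in> m" using mmul(1)[OF As(3)[OF As(2)] that(2)] by simp
    then show ?thesis using madd[OF that(1)] by fastforce
  qed
  have mphi: "u \<in> m" if "phi c * u \<in> m" "c \<noteq> 0" for c u
  proof -
    have "phi (inverse c) * (phi c * u) = u"
      using that(2) by (simp add: mult.assoc[symmetric] phi_simps(4)[symmetric] phi_simps(2))
    then show ?thesis using mmul(1)[OF phA that(1)] by metis
  qed
  have xc: "x - phi c \<in> A" for c using x As by simp
  then have "\<forall>c. \<exists>b\<in>A. (x - phi c) * b - 1 \<in> m" using m(3) neg by blast
  then obtain b where bA: "\<And>c. b c \<in> A" and b: "\<And>c. (x - phi c) * b c - 1 \<in> m" by metis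
  \<comment> \<open>Distinct constants have distinct inverses, so a linear relation among values of
    \<open>b\<close> is a relation indexed by constants.\<close>
  have inj: "c = d" if bb: "b c = b d" for c d
  proof (rule ccontr)
    assume "c \<noteq> d"
    have "((x - phi c) * b c - 1) - ((x - phi d) * b d - 1) = phi (d - c) * b c"
      by (simp add: bb phi_simps algebra_simps)
    then have "phi (d - c) * b c \<in> m" using msub[OF b b] by metis
    then have "b c \<in> m" by (rule mphi) (use \<open>c \<noteq> d\<close> in auto)
    from msub[OF mmul(1)[OF xc[of c] this] b[of c]] show False using m(2) by simp
  qed
  have "\<exists>n. infinite {c. b c \<in> vs.span (e ` {..<n})}"
  proof (rule ccontr)
    assume "\<not> ?thesis"
    then have "countable (\<Union>n. {c. b c \<in> vs.span (e ` {..<n})})"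
      by (intro countable_UN[OF countableI_type countable_finite]) auto
    moreover have "(\<Union>n. {c. b c \<in> vs.span (e ` {..<n})}) = UNIV"
      using span_range_finite[OF subsetD[OF A(3) bA]] by auto
    ultimately show False using uncountable_UNIV_complex by simp
  qed
  then obtain n where n: "infinite {c. b c \<in> vs.span (e ` {..<n})}" by blast
  obtain D where D: "finite D" "card D = Suc n" "D \<subseteq> {c. b c \<in> vs.span (e ` {..<n})}"
    using infinite_arbitrarily_large[OF n, of "Suc n"] by auto
  have injD: "inj_on b D" using inj by (auto simp: inj_on_def)
  have "vs.dependent (b ` D)"
  proof (rule ccontr)
    assume "\<not> ?thesis"
    then have "card (b ` D) \<le> card (e ` {..<n})"
      using vs.independent_span_bound[of "e ` {..<n}" "b ` D"] D(3) by auto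
    also have "\<dots> \<le> n" using card_image_le[of "{..<n}" e] by simp
    finally show False using card_image[OF injD] D(2) by simp
  qed
  then obtain u0 c0 where u0: "(\<Sum>v\<in>b ` D. phi (u0 v) * v) = 0" and c0: "c0 \<in> D" "u0 (b c0) \<noteq> 0"
    using vs.dependent_finite[of "b ` D"] D(1) by auto
  define u where "u c = u0 (b c)" for c
  have u: "(\<Sum>c\<in>D. phi (u c) * b c) = 0" using u0 by (simp add: sum.reindex[OF injD] u_def)
  define ev where "ev p = poly (map_poly phi p) x" for p
  have ev: "ev (p * q) = ev p * ev q" "ev (p + q) = ev p + ev q" for p q
    by (simp_all add: ev_def ring_hom_map_poly[OF hom])
  have ev1: "ev [:- d, 1:] = x - phi d" "ev [:c:] = phi c" "ev 1 = 1" "ev 0 = 0" for d c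
  proof -
    have "map_poly phi [:a, b:] = [:phi a, phi b:]" for a b
      by (rule poly_eqI) (simp add: coeff_map_poly phi_simps coeff_pCons split: nat.split)
    from this[of "- d" 1] this[of c 0] this[of 1 0]
    show "ev [:- d, 1:] = x - phi d" "ev [:c:] = phi c" "ev 1 = 1" "ev 0 = 0"
      by (simp_all add: ev_def phi_simps one_pCons)
  qed
  have evp: "ev (\<Prod>d\<in>E. [:- d, 1:]) = (\<Prod>d\<in>E. x - phi d)" for E
    by (induction E rule: infinite_finite_induct) (auto simp: ev1 ev simp del: mult_pCons_left)
  have evs: "ev (\<Sum>c\<in>E. f c) = (\<Sum>c\<in>E. ev (f c))" for E f
    by (induction E rule: infinite_finite_induct) (auto simp: ev1 ev)
  have evA: "ev p \<in> A" for p
    unfolding ev_def poly_altdef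
    by (intro is_subring_sum[OF A(1)] is_subringD(6)[OF A(1)] is_subring_power[OF A(1)] x)
      (simp add: coeff_map_poly phi_simps phA)
  \<comment> \<open>The relation among the inverses with denominators cleared: modulo
    \<open>m\<close>, the value of \<open>Q\<close> at \<open>x\<close> is that relation times the
    product of all \<open>x - d\<close>.\<close>
  define Q where "Q = (\<Sum>c\<in>D. [:u c:] * (\<Prod>d\<in>D - {c}. [:- d, 1:]))"
  have prodA: "(\<Prod>d\<in>E. x - phi d) \<in> A" for E by (intro is_subring_prod[OF A(1)] xc)
  have "ev Q - (\<Sum>c\<in>D. phi (u c) * b c) * (\<Prod>d\<in>D. x - phi d)
      = (\<Sum>c\<in>D. - phi (u c) * (\<Prod>d\<in>D - {c}. x - phi d) * ((x - phi c) * b c - 1))"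
    unfolding Q_def evs ev ev1 evp sum_distrib_right sum_subtractf[symmetric]
  proof (rule sum.cong[OF refl])
    fix c assume "c \<in> D"
    then have e: "(\<Prod>d\<in>D. x - phi d) = (x - phi c) * (\<Prod>d\<in>D - {c}. x - phi d)"
      using D(1) by (simp add: prod.remove)
    show "phi (u c) * (\<Prod>d\<in>D - {c}. x - phi d) - phi (u c) * b c * (\<Prod>d\<in>D. x - phi d)
      = - phi (u c) * (\<Prod>d\<in>D - {c}. x - phi d) * ((x - phi c) * b c - 1)"
      unfolding e by (simp add: algebra_simps del: vs.scale_scale)
  qed
  also have "\<dots> \<in> m"
  proof -
    have S: "sum f E \<in> m" if "\<And>c. f c \<in> m" for f :: "complex \<Rightarrow> 'a" and E
      using that m(1) by (induction E rule: infinite_finite_induct) (auto simp: rel_ideal_def)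
    show ?thesis by (rule S, rule mmul(1)[OF _ b]) (intro As prodA)
  qed
  finally have evQ: "ev Q \<in> m" using u by simp
  \<comment> \<open>At \<open>c0\<close> only the summand of \<open>c0\<close> survives, and its
    coefficient in the relation is nonzero.\<close>
  have "poly Q c0 = (\<Sum>c\<in>D. u c * (\<Prod>d\<in>D - {c}. c0 - d))"
    by (simp add: Q_def poly_sum poly_prod)
  also have "\<dots> = (\<Sum>c\<in>D. if c = c0 then u c0 * (\<Prod>d\<in>D - {c0}. c0 - d) else 0)"
    using D(1) c0 by (intro sum.cong) (auto simp: prod_zero_iff)
  also have "\<dots> \<noteq> 0" using D(1) c0 by (simp add: u_def)
  finally have Q0: "Q \<noteq> 0" by auto
  \<comment> \<open>Over \<complex> a polynomial splits into linear factors, and every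
    \<open>x - z\<close> is invertible modulo \<open>m\<close>.\<close>
  have "ev p \<notin> m" if "p \<noteq> 0" for p
    using that
  proof (induction "degree p" arbitrary: p)
    case 0
    then obtain c where "p = [:c:]" "c \<noteq> 0" by (metis degree_eq_zeroE pCons_0_0)
    then show ?case using mphi[of c 1] m(2) by (auto simp: ev1)
  next
    case (Suc k)
    then have "\<not> constant (poly p)" by (simp add: constant_degree)
    then obtain z where "poly p z = 0" using fundamental_theorem_of_algebra by blast
    then obtain p' where p': "p = [:- z, 1:] * p'" by (auto simp: poly_eq_0_iff_dvd elim: dvdE)
    have p'0: "p' \<noteq> 0" using Suc.prems p' by auto
    then have "degree p = Suc (degree p')" unfolding p' by (subst degree_mult_eq) auto
    then have IH: "ev p' \<notin> m" using Suc.hyps p'0 by simp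
    show ?case
    proof
      assume "ev p \<in> m"
      then have "(x - phi z) * ev p' \<in> m" unfolding p' ev ev1 .
      from msub[OF mmul(1)[OF bA[of z] this] mmul(1)[OF evA[of p'] b[of z]]]
      have "b z * ((x - phi z) * ev p') - ev p' * ((x - phi z) * b z - 1) \<in> m" .
      moreover have "b z * ((x - phi z) * ev p') - ev p' * ((x - phi z) * b z - 1) = ev p'"
        by (simp add: algebra_simps)
      ultimately show False using IH by simp
    qed
  qed
  then show False using evQ Q0 by blast
qed

end

section \<open>Chevalley's extension theorem for homomorphisms to \<complex>\<close>

text \<open>The graph of a homomorphism of \<complex>-algebras from a subring to \<complex>. A graph
  carries its domain with it and extension becomes inclusion, as suits Zorn's lemma. The last clause
  amounts to single-valuedness, since differences stay in the graph.\<close>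

definition place_graph :: "(complex \<Rightarrow> 'a::comm_ring_1) \<Rightarrow> ('a \<times> complex) set \<Rightarrow> bool" where
  "place_graph phi \<Gamma> \<longleftrightarrow> (\<forall>c. (phi c, c) \<in> \<Gamma>) \<and>
     (\<forall>a c b d. (a, c) \<in> \<Gamma> \<longrightarrow> (b, d) \<in> \<Gamma> \<longrightarrow> (a + b, c + d) \<in> \<Gamma> \<and> (a * b, c * d) \<in> \<Gamma>) \<and>
     (\<forall>c. (0, c) \<in> \<Gamma> \<longrightarrow> c = 0)"

text \<open>The Nullstellensatz in the form needed here: each \<open>x\<close> in \<open>A\<close>
  is sent to the constant \<open>c\<close> with \<open>x - phi c\<close> in a maximal ideal
  containing \<open>a\<close>. That constant is unique because the maximal ideal contains no nonzero
  constant.\<close>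

lemma (in C_algebra) ex_place_graph:
  assumes A: "is_subring A" "range phi \<subseteq> A" "A \<subseteq> vs.span (range (e :: nat \<Rightarrow> 'a))"
    and a: "rel_ideal A a" "1 \<notin> a"
  obtains \<Gamma> where "place_graph phi \<Gamma>" "A \<subseteq> Domain \<Gamma>" "\<And>x. x \<in> a \<Longrightarrow> (x, 0) \<in> \<Gamma>"
proof -
  obtain m where m: "a \<subseteq> m" "rel_ideal A m" "1 \<notin> m"
    "\<And>x. x \<in> A \<Longrightarrow> x \<notin> m \<Longrightarrow> \<exists>b\<in>A. x * b - 1 \<in> m"
    using ex_maximal_rel_ideal[OF A(1) a] by metis
  note As = is_subringD[OF A(1)]
  have phA: "phi c \<in> A" for c using A(2) by auto
  define \<Gamma> where "\<Gamma> = {(x, c). x \<in> A \<and> x - phi c \<in> m}"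
  have "place_graph phi \<Gamma>"
    unfolding place_graph_def
  proof (intro conjI allI impI)
    show "(phi c, c) \<in> \<Gamma>" for c using m(2) phA by (auto simp: \<Gamma>_def rel_ideal_def)
  next
    fix x c y d assume xy: "(x, c) \<in> \<Gamma>" "(y, d) \<in> \<Gamma>"
    have "(x + y) - phi (c + d) = (x - phi c) + (y - phi d)" by (simp add: phi_simps)
    also have "\<dots> \<in> m" using xy m(2) by (auto simp: \<Gamma>_def rel_ideal_def)
    finally show "(x + y, c + d) \<in> \<Gamma>" using xy As(4) by (simp add: \<Gamma>_def)
    have "x * y - phi (c * d) = y * (x - phi c) + phi c * (y - phi d)"
      by (simp add: phi_simps algebra_simps)
    also have "\<dots> \<in> m" using xy m(2) phA by (auto simp: \<Gamma>_def rel_ideal_def)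
    finally show "(x * y, c * d) \<in> \<Gamma>" using xy As(6) by (simp add: \<Gamma>_def)
  next
    fix c assume "(0, c) \<in> \<Gamma>"
    then have c: "- phi c \<in> m" by (simp add: \<Gamma>_def)
    show "c = 0"
    proof (rule ccontr)
      assume "c \<noteq> 0"
      then have "phi (- inverse c) * - phi c = 1" by (simp add: phi_simps(4)[symmetric] phi_simps)
      moreover have "phi (- inverse c) * - phi c \<in> m"
        using c m(2) phA unfolding rel_ideal_def by blast
      ultimately show False using m(3) by simp
    qed
  qed
  moreover have "A \<subseteq> Domain \<Gamma>"
    using residue_field_complex[OF A m(2-4)] by (auto simp: \<Gamma>_def)
  moreover have "(x, 0) \<in> \<Gamma>" if "x \<in> a" for x
    using that m(1,2) by (auto simp: \<Gamma>_def phi_simps rel_ideal_def)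
  ultimately show ?thesis by (rule that)
qed

text \<open>A nonzero member of least degree divides all the others, and it has a root because
  excluding \<open>1\<close> excludes nonzero constants.\<close>

lemma complex_poly_ideal_common_root:
  fixes N :: "complex poly set"
  assumes add: "\<And>p q. p \<in> N \<Longrightarrow> q \<in> N \<Longrightarrow> p + q \<in> N"
    and mult: "\<And>p q. p \<in> N \<Longrightarrow> q * p \<in> N" and one: "1 \<notin> N"
  shows "\<exists>z. \<forall>p\<in>N. poly p z = 0"
proof (cases "N \<subseteq> {0}")
  case False
  then obtain p1 where "p1 \<in> N \<and> p1 \<noteq> 0" by blast
  then obtain p where p: "p \<in> N" "p \<noteq> 0"
    and min: "\<And>r. r \<in> N \<and> r \<noteq> 0 \<Longrightarrow> degree p \<le> degree r"
    using ex_has_least_nat[of "\<lambda>p. p \<in> N \<and> p \<noteq> 0" p1 degree] by blast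
  have "degree p \<noteq> 0"
  proof
    assume "degree p = 0"
    then obtain c where "p = [:c:]" "c \<noteq> 0" using p(2) by (metis degree_eq_zeroE pCons_0_0)
    then have "[:inverse c:] * p = 1" by (simp add: one_pCons)
    then show False using mult[OF p(1), of "[:inverse c:]"] one by simp
  qed
  then have "\<not> constant (poly p)" by (simp add: constant_degree)
  then obtain z where z: "poly p z = 0" using fundamental_theorem_of_algebra by blast
  have "poly r z = 0" if r: "r \<in> N" for r
  proof -
    have "r mod p = r + (- (r div p)) * p" by (simp add: minus_div_mult_eq_mod[symmetric])
    then have "r mod p \<in> N" using add[OF r mult[OF p(1), of "- (r div p)"]] by (simp only:)
    then have "r mod p = 0"
      using min[of "r mod p"] degree_mod_less[OF p(2), of r] by fastforce
    then have "p dvd r" by (simp add: dvd_eq_mod_eq_0)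
    then show ?thesis using z by (auto elim: dvdE)
  qed
  then show ?thesis by blast
next
  case True
  then show ?thesis by (intro exI[of _ 0]) auto
qed

context
  fixes phi :: "complex \<Rightarrow> 'k::field" and \<Gamma> :: "('k \<times> complex) set"
  assumes hom: "is_ring_hom phi" and pg: "place_graph phi \<Gamma>"
begin

lemma place_graphD:
  shows "(phi c, c) \<in> \<Gamma>"
    "(a, c) \<in> \<Gamma> \<Longrightarrow> (b, d) \<in> \<Gamma> \<Longrightarrow> (a + b, c + d) \<in> \<Gamma>"
    "(a, c) \<in> \<Gamma> \<Longrightarrow> (b, d) \<in> \<Gamma> \<Longrightarrow> (a * b, c * d) \<in> \<Gamma>"
    "(0, c) \<in> \<Gamma> \<Longrightarrow> c = 0"
  using pg by (auto simp: place_graph_def)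

lemma place_graph_zero_one: "(0, 0) \<in> \<Gamma>" "(1, 1) \<in> \<Gamma>"
  using place_graphD(1)[of 0] place_graphD(1)[of 1] by (simp_all add: is_ring_homD[OF hom])

lemma place_graph_diff:
  assumes "(a, c) \<in> \<Gamma>" "(b, d) \<in> \<Gamma>" shows "(a - b, c - d) \<in> \<Gamma>"
  using place_graphD(2)[OF assms(1) place_graphD(3)[OF place_graphD(1)[of "-1"] assms(2)]]
  by (simp add: is_ring_homD[OF hom])

lemma place_graph_functional: "(a, c) \<in> \<Gamma> \<Longrightarrow> (a, d) \<in> \<Gamma> \<Longrightarrow> c = d"
  using place_graph_diff[of a c a d] place_graphD(4) by force

lemma place_graph_sum:
  "(\<And>i. i \<in> A \<Longrightarrow> (f i, g i) \<in> \<Gamma>) \<Longrightarrow> (sum f A, sum g A) \<in> \<Gamma>"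
  by (induction A rule: infinite_finite_induct) (auto simp: place_graph_zero_one place_graphD(2))

lemma place_graph_power: "(a, c) \<in> \<Gamma> \<Longrightarrow> (a ^ n, c ^ n) \<in> \<Gamma>"
  by (induction n) (auto simp: place_graph_zero_one place_graphD(3))

text \<open>The extension sends \<open>poly q x\<close> to \<open>poly p z\<close>, where
  \<open>p\<close> is the reduction of \<open>q\<close>. The hypothesis \<open>root\<close> is
  precisely what makes this independent of \<open>q\<close>.\<close>

lemma place_graph_poly_ext:
  assumes root: "\<And>p q. (\<forall>i. (coeff q i, coeff p i) \<in> \<Gamma>) \<Longrightarrow> poly q x = 0 \<Longrightarrow> poly p z = 0"
  shows "\<exists>\<Gamma>'. \<Gamma> \<subseteq> \<Gamma>' \<and> place_graph phi \<Gamma>' \<and> (x, z) \<in> \<Gamma>'"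
proof (intro exI conjI)
  let ?G = "{(poly q x, poly p z) |q p. \<forall>i. (coeff q i, coeff p i) \<in> \<Gamma>}"
  show sub: "\<Gamma> \<subseteq> ?G"
  proof safe
    fix a c assume "(a, c) \<in> \<Gamma>"
    then show "\<exists>q p. (a, c) = (poly q x, poly p z) \<and> (\<forall>i. (coeff q i, coeff p i) \<in> \<Gamma>)"
      by (intro exI[of _ "[:a:]"] exI[of _ "[:c:]"])
        (auto simp: coeff_pCons place_graph_zero_one split: nat.split)
  qed
  show "(x, z) \<in> ?G"
    by (intro CollectI exI[of _ "[:0, 1:]"])
      (auto simp: coeff_pCons place_graph_zero_one split: nat.split)
  show "place_graph phi ?G"
    unfolding place_graph_def
  proof (intro conjI allI impI)
    show "(phi c, c) \<in> ?G" for c using sub place_graphD(1) by blast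
  next
    fix a c b d assume "(a, c) \<in> ?G" "(b, d) \<in> ?G"
    then obtain q p q' p' where
      h: "\<forall>i. (coeff q i, coeff p i) \<in> \<Gamma>" "a = poly q x" "c = poly p z"
        "\<forall>i. (coeff q' i, coeff p' i) \<in> \<Gamma>" "b = poly q' x" "d = poly p' z"
      by blast
    show "(a + b, c + d) \<in> ?G"
      by (intro CollectI exI[of _ "q + q'"] exI[of _ "p + p'"])
        (use h in \<open>auto simp: place_graphD(2)\<close>)
    show "(a * b, c * d) \<in> ?G"
      by (intro CollectI exI[of _ "q * q'"] exI[of _ "p * p'"])
        (use h in \<open>auto simp: coeff_mult intro!: place_graph_sum place_graphD(3)\<close>)
  next
    fix c assume "(0, c) \<in> ?G"
    then obtain q p where "\<forall>i. (coeff q i, coeff p i) \<in> \<Gamma>" "poly q x = 0" "c = poly p z"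
      by auto
    then show "c = 0" using root by simp
  qed
qed

text \<open>The obstruction to giving \<open>x\<close> a value: a homomorphism that extends the
  graph to \<open>x\<close> would turn the relation into \<open>1 = 0\<close>. The degree bound
  \<open>n\<close> drives the descent below.\<close>

definition unit_relation :: "nat \<Rightarrow> 'k \<Rightarrow> bool" where
  "unit_relation n x \<longleftrightarrow> (\<exists>b. (b 0, 1) \<in> \<Gamma> \<and> (\<forall>i\<ge>1. (b i, 0) \<in> \<Gamma>) \<and> (\<Sum>i\<le>n. b i * x ^ i) = 0)"

lemma unit_relation_mono:
  assumes "unit_relation m x" "m \<le> n" shows "unit_relation n x"
proof -
  from assms(1) obtain b where b: "(b 0, 1) \<in> \<Gamma>" "\<forall>i\<ge>1. (b i, 0) \<in> \<Gamma>" "(\<Sum>i\<le>m. b i * x ^ i) = 0"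
    by (auto simp: unit_relation_def)
  have "(\<Sum>i\<le>n. (if i \<le> m then b i else 0) * x ^ i) = (\<Sum>i\<le>m. b i * x ^ i)"
    using assms(2) by (intro sum.mono_neutral_cong_right) auto
  then show ?thesis using b place_graph_zero_one unfolding unit_relation_def
    by (intro exI[of _ "\<lambda>i. if i \<le> m then b i else 0"]) auto
qed

text \<open>Polynomials over the domain that vanish at \<open>x\<close> reduce to an ideal
  \<open>N\<close> of polynomials over \<complex>. A common root of a proper \<open>N\<close> is an
  admissible value for \<open>x\<close>, and \<open>1 \<in> N\<close> is a unit relation.\<close>

lemma ex_unit_relation_or_ext:
  "(\<exists>n. unit_relation n x) \<or> (\<exists>\<Gamma>' z. \<Gamma> \<subseteq> \<Gamma>' \<and> place_graph phi \<Gamma>' \<and> (x, z) \<in> \<Gamma>')"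
proof -
  define N where "N = {p. \<exists>q. (\<forall>i. (coeff q i, coeff p i) \<in> \<Gamma>) \<and> poly q x = 0}"
  show ?thesis
  proof (cases "1 \<in> N")
    case True
    then obtain q where q: "\<And>i. (coeff q i, coeff 1 i) \<in> \<Gamma>" "poly q x = 0" by (auto simp: N_def)
    have "unit_relation (degree q) x"
      unfolding unit_relation_def
    proof (intro exI[of _ "coeff q"] conjI allI impI)
      show "(coeff q 0, 1) \<in> \<Gamma>" using q(1)[of 0] by simp
      show "(coeff q i, 0) \<in> \<Gamma>" if "i \<ge> 1" for i using q(1)[of i] that by simp
      show "(\<Sum>i\<le>degree q. coeff q i * x ^ i) = 0" using q(2) by (simp add: poly_altdef)
    qed
    then show ?thesis by blast
  next
    case False
    have "\<exists>z. \<forall>p\<in>N. poly p z = 0"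
    proof (rule complex_poly_ideal_common_root[OF _ _ False])
      fix p q assume "p \<in> N" "q \<in> N"
      then obtain p' q' where h: "\<forall>i. (coeff p' i, coeff p i) \<in> \<Gamma>" "poly p' x = 0"
        "\<forall>i. (coeff q' i, coeff q i) \<in> \<Gamma>" "poly q' x = 0" by (auto simp: N_def)
      then show "p + q \<in> N" unfolding N_def
        by (intro CollectI exI[of _ "p' + q'"]) (auto simp: place_graphD(2))
    next
      fix p q assume "p \<in> N"
      then obtain p' where h: "\<forall>i. (coeff p' i, coeff p i) \<in> \<Gamma>" "poly p' x = 0" by (auto simp: N_def)
      then show "q * p \<in> N" unfolding N_def
        by (intro CollectI exI[of _ "map_poly phi q * p'"])
          (auto simp: coeff_mult coeff_map_poly is_ring_homD[OF hom] place_graphD(1)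
            intro!: place_graph_sum place_graphD(3))
    qed
    then obtain z where z: "\<forall>p\<in>N. poly p z = 0" by blast
    have "\<exists>\<Gamma>'. \<Gamma> \<subseteq> \<Gamma>' \<and> place_graph phi \<Gamma>' \<and> (x, z) \<in> \<Gamma>'"
      by (rule place_graph_poly_ext) (use z in \<open>auto simp: N_def\<close>)
    then show ?thesis by blast
  qed
qed

context
  assumes max: "\<And>\<Gamma>'. place_graph phi \<Gamma>' \<Longrightarrow> \<Gamma> \<subseteq> \<Gamma>' \<Longrightarrow> \<Gamma>' = \<Gamma>"
begin

text \<open>Otherwise localising at the powers of \<open>b\<close> would enlarge the graph.\<close>

lemma maximal_place_graph_inverse:
  assumes b: "(b, c) \<in> \<Gamma>" "c \<noteq> 0" shows "(inverse b, inverse c) \<in> \<Gamma>"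
proof -
  have b0: "b \<noteq> 0" using b place_graphD(4) by auto
  let ?G = "{(x / b ^ n, d / c ^ n) |x d n. (x, d) \<in> \<Gamma>}"
  have sub: "\<Gamma> \<subseteq> ?G"
  proof safe
    fix x d assume "(x, d) \<in> \<Gamma>"
    then show "\<exists>x' d' n. (x, d) = (x' / b ^ n, d' / c ^ n) \<and> (x', d') \<in> \<Gamma>"
      by (intro exI[of _ x] exI[of _ d] exI[of _ 0]) simp
  qed
  have "place_graph phi ?G"
    unfolding place_graph_def
  proof (intro conjI allI impI)
    show "(phi c, c) \<in> ?G" for c using sub place_graphD(1) by blast
  next
    fix u v u' v' assume "(u, v) \<in> ?G" "(u', v') \<in> ?G"
    then obtain x d n x' d' n' where h: "u = x / b ^ n" "v = d / c ^ n" "(x, d) \<in> \<Gamma>"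
      "u' = x' / b ^ n'" "v' = d' / c ^ n'" "(x', d') \<in> \<Gamma>" by blast
    have "u + u' = (x * b ^ n' + x' * b ^ n) / b ^ (n + n')"
      "v + v' = (d * c ^ n' + d' * c ^ n) / c ^ (n + n')"
      unfolding h(1,2,4,5) using b0 b(2) by (simp_all add: field_simps power_add)
    moreover have "(x * b ^ n' + x' * b ^ n, d * c ^ n' + d' * c ^ n) \<in> \<Gamma>"
      using h b by (intro place_graphD place_graph_power)
    ultimately show "(u + u', v + v') \<in> ?G" by blast
    have "u * u' = (x * x') / b ^ (n + n')" "v * v' = (d * d') / c ^ (n + n')"
      using h b0 b(2) by (simp_all add: power_add)
    moreover have "(x * x', d * d') \<in> \<Gamma>" using h by (intro place_graphD)
    ultimately show "(u * u', v * v') \<in> ?G" by blast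
  next
    fix d assume "(0, d) \<in> ?G"
    then obtain x d' n where h: "0 = x / b ^ n" "d = d' / c ^ n" "(x, d') \<in> \<Gamma>" by auto
    then have "x = 0" using b0 by simp
    then show "d = 0" using h place_graphD(4) by auto
  qed
  then have "?G = \<Gamma>" using max sub by blast
  moreover have "(inverse b, inverse c) = (1 / b ^ 1, 1 / c ^ 1)" by (simp add: field_simps)
  then have "(inverse b, inverse c) \<in> ?G" using place_graph_zero_one(2) by blast
  ultimately show ?thesis by simp
qed

text \<open>Multiplied by \<open>x ^ Suc n\<close> and divided by the unit \<open>d 0\<close>, the
  relation for \<open>y\<close> becomes a monic equation for \<open>x\<close> whose lower
  coefficients have residue \<open>0\<close>. Subtracting \<open>b (Suc n)\<close> times this
  equation removes the top term of the relation for \<open>x\<close>; the residues of the other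
  coefficients stay the same because \<open>b (Suc n)\<close> has residue \<open>0\<close>.\<close>

lemma unit_relation_step:
  assumes x: "unit_relation (Suc n) x" and y: "unit_relation (Suc n) y" and xy: "x * y = 1"
  shows "unit_relation n x"
proof -
  from x obtain b where b: "(b 0, 1) \<in> \<Gamma>" "\<And>i. i \<ge> 1 \<Longrightarrow> (b i, 0) \<in> \<Gamma>"
      "(\<Sum>i\<le>Suc n. b i * x ^ i) = 0"
    by (auto simp: unit_relation_def)
  from y obtain d where d: "(d 0, 1) \<in> \<Gamma>" "\<And>i. i \<ge> 1 \<Longrightarrow> (d i, 0) \<in> \<Gamma>"
      "(\<Sum>i\<le>Suc n. d i * y ^ i) = 0"
    by (auto simp: unit_relation_def)
  have d0: "d 0 \<noteq> 0" using d(1) place_graphD(4) by fastforce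
  have di: "(inverse (d 0), 1) \<in> \<Gamma>" using maximal_place_graph_inverse[OF d(1)] by simp
  define e where "e j = d (Suc n - j) / d 0" for j
  have e: "(e j, of_bool (j = Suc n)) \<in> \<Gamma>" if "j \<le> Suc n" for j
    using place_graphD(3)[OF d(1) di] place_graphD(3)[OF d(2)[of "Suc n - j"] di] that
    by (auto simp: e_def field_simps)
  have "(\<Sum>j\<le>Suc n. e j * x ^ j) = (\<Sum>i\<le>Suc n. d i / d 0 * x ^ (Suc n - i))"
    by (rule sum.reindex_bij_witness[of _ "\<lambda>j. Suc n - j" "\<lambda>j. Suc n - j"]) (auto simp: e_def)
  also have "\<dots> = (\<Sum>i\<le>Suc n. x ^ Suc n / d 0 * (d i * y ^ i))"
  proof (rule sum.cong[OF refl])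
    fix i assume "i \<in> {..Suc n}"
    then have "x ^ Suc n * y ^ i = x ^ (Suc n - i) * (x * y) ^ i"
      by (simp add: power_mult_distrib power_add[symmetric] mult.assoc[symmetric] del: power_Suc)
    then show "d i / d 0 * x ^ (Suc n - i) = x ^ Suc n / d 0 * (d i * y ^ i)"
      using xy d0 by (simp add: field_simps del: power_Suc)
  qed
  also have "\<dots> = 0" unfolding sum_distrib_left[symmetric] d(3) by simp
  finally have e0: "(\<Sum>j\<le>Suc n. e j * x ^ j) = 0" .
  define b' where "b' j = (if j \<le> Suc n then b j - b (Suc n) * e j else 0)" for j
  have "(\<Sum>j\<le>Suc n. b' j * x ^ j) = (\<Sum>j\<le>Suc n. b j * x ^ j) - b (Suc n) * (\<Sum>j\<le>Suc n. e j * x ^ j)"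
    unfolding sum_distrib_left sum_subtractf[symmetric]
    by (intro sum.cong) (auto simp: b'_def algebra_simps simp del: power_Suc)
  then have "(\<Sum>j\<le>Suc n. b' j * x ^ j) = 0" using b(3) e0 by (simp del: sum.atMost_Suc)
  moreover have "b' (Suc n) = 0" using d0 by (simp add: b'_def e_def)
  ultimately have "(\<Sum>j\<le>n. b' j * x ^ j) = 0" by simp
  moreover have "(b' 0, 1) \<in> \<Gamma>"
    using place_graph_diff[OF b(1) place_graphD(3)[OF b(2)[of "Suc n"] e[of 0]]] by (simp add: b'_def)
  moreover have "(b' i, 0) \<in> \<Gamma>" if "i \<ge> 1" for i
    using place_graph_diff[OF b(2)[OF that] place_graphD(3)[OF b(2)[of "Suc n"] e[of i]]]
    by (simp add: b'_def place_graph_zero_one)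
  ultimately show ?thesis unfolding unit_relation_def by blast
qed

text \<open>With a common degree bound each relation shortens the other, down to degree
  \<open>0\<close>, where a relation says that \<open>0\<close> has residue
  \<open>1\<close>.\<close>

lemma not_unit_relation_both: "unit_relation n x \<Longrightarrow> unit_relation n y \<Longrightarrow> x * y = 1 \<Longrightarrow> False"
proof (induction n)
  case 0
  then show ?case using place_graphD(4)[of 1] by (auto simp: unit_relation_def)
next
  case (Suc n)
  then show ?case using unit_relation_step[of n x y] unit_relation_step[of n y x]
    by (simp add: mult.commute)
qed

lemma maximal_place_graph_total: "x \<in> Domain \<Gamma> \<or> inverse x \<in> Domain \<Gamma>"
proof (cases "x = 0")
  case True
  then show ?thesis using place_graph_zero_one by auto
next
  case False
  show ?thesis
  proof (rule ccontr)
    assume neg: "\<not> ?thesis"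
    have ur: "\<exists>n. unit_relation n u" if "u \<notin> Domain \<Gamma>" for u
      using ex_unit_relation_or_ext[of u] max that by blast
    from neg ur obtain m n where mn: "unit_relation m x" "unit_relation n (inverse x)" by blast
    have "unit_relation (max m n) x" "unit_relation (max m n) (inverse x)"
      by (rule unit_relation_mono[OF mn(1)] unit_relation_mono[OF mn(2)]; simp)+
    then show False using not_unit_relation_both[of "max m n" x "inverse x"] False by simp
  qed
qed

end
end

lemma ex_maximal_place_graph:
  assumes "place_graph phi \<Gamma>0"
  obtains \<Gamma> where "\<Gamma>0 \<subseteq> \<Gamma>" "place_graph phi \<Gamma>"
    "\<And>\<Gamma>'. place_graph phi \<Gamma>' \<Longrightarrow> \<Gamma> \<subseteq> \<Gamma>' \<Longrightarrow> \<Gamma>' = \<Gamma>"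
proof -
  define F where "F = {\<Gamma>. \<Gamma>0 \<subseteq> \<Gamma> \<and> place_graph phi \<Gamma>}"
  have "\<exists>M\<in>F. \<forall>X\<in>F. M \<subseteq> X \<longrightarrow> X = M"
  proof (rule subset_Zorn_nonempty)
    show "F \<noteq> {}" using assms by (auto simp: F_def)
    fix C assume C: "C \<noteq> {}" "subset.chain F C"
    then have CF: "\<And>X. X \<in> C \<Longrightarrow> \<Gamma>0 \<subseteq> X \<and> place_graph phi X"
      by (auto simp: subset.chain_def F_def)
    have lin: "X \<subseteq> Y \<or> Y \<subseteq> X" if "X \<in> C" "Y \<in> C" for X Y
      using C(2) that unfolding subset.chain_def by blast
    obtain X0 where X0: "X0 \<in> C" using C(1) by blast
    have "place_graph phi (\<Union>C)"
      unfolding place_graph_def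
    proof (intro conjI allI impI)
      show "(phi c, c) \<in> \<Union>C" for c using CF[OF X0] X0 by (auto simp: place_graph_def)
    next
      fix a c b d assume "(a, c) \<in> \<Union>C" "(b, d) \<in> \<Union>C"
      then obtain X Y where XY: "X \<in> C" "Y \<in> C" "(a, c) \<in> X" "(b, d) \<in> Y" by auto
      then obtain Z where Z: "Z \<in> C" "(a, c) \<in> Z" "(b, d) \<in> Z" using lin[OF XY(1,2)] by blast
      then have "(a + b, c + d) \<in> Z" "(a * b, c * d) \<in> Z" using CF[OF Z(1)] by (auto simp: place_graph_def)
      then show "(a + b, c + d) \<in> \<Union>C" "(a * b, c * d) \<in> \<Union>C" using Z(1) by auto
    next
      fix c assume "(0, c) \<in> \<Union>C"
      then show "c = 0" using CF by (auto simp: place_graph_def)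
    qed
    moreover have "\<Gamma>0 \<subseteq> \<Union>C" using CF[OF X0] X0 by auto
    ultimately show "\<Union>C \<in> F" by (simp add: F_def)
  qed
  then obtain \<Gamma> where G: "\<Gamma> \<in> F" and mx: "\<And>X. X \<in> F \<Longrightarrow> \<Gamma> \<subseteq> X \<Longrightarrow> X = \<Gamma>" by blast
  show ?thesis
  proof (rule that[of \<Gamma>])
    show "\<Gamma>0 \<subseteq> \<Gamma>" "place_graph phi \<Gamma>" using G by (auto simp: F_def)
    show "\<Gamma>' = \<Gamma>" if "place_graph phi \<Gamma>'" "\<Gamma> \<subseteq> \<Gamma>'" for \<Gamma>'
      using mx[OF _ that(2)] that G by (auto simp: F_def)
  qed
qed

text \<open>A valuation ring \<open>V\<close> with maximal ideal \<open>M\<close> and residue field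
  \<complex>. Its valuation v is never constructed: for nonzero \<open>y\<close>, v(x) \<ge> v(y) is
  written \<open>x / y \<in> V\<close>, and v(x) > v(y) is written
  \<open>x / y \<in> M\<close>.\<close>

locale place =
  fixes phi :: "complex \<Rightarrow> 'k::field" and V M :: "'k set"
  assumes hom: "is_ring_hom phi"
    and V_subring: "is_subring V"
    and M_V: "M \<subseteq> V" and one_M: "1 \<notin> M"
    and M_add: "x \<in> M \<Longrightarrow> y \<in> M \<Longrightarrow> x + y \<in> M"
    and M_mult: "x \<in> V \<Longrightarrow> y \<in> M \<Longrightarrow> x * y \<in> M"
    and inverse_M: "x \<notin> V \<Longrightarrow> inverse x \<in> M"
    and inverse_V: "x \<in> V \<Longrightarrow> x \<notin> M \<Longrightarrow> inverse x \<in> V"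
    and residue: "x \<in> V \<Longrightarrow> \<exists>c. x - phi c \<in> M"
    and phi_V: "phi c \<in> V"

lemma place_of_place_graph:
  fixes phi :: "complex \<Rightarrow> 'k::field"
  assumes hom: "is_ring_hom phi" and pg: "place_graph phi \<Gamma>0"
  obtains V M where "place phi V M" "Domain \<Gamma>0 \<subseteq> V" "\<And>x. (x, 0) \<in> \<Gamma>0 \<Longrightarrow> x \<in> M"
proof -
  obtain \<Gamma> where sub: "\<Gamma>0 \<subseteq> \<Gamma>" and G: "place_graph phi \<Gamma>"
    and mx: "\<And>\<Gamma>'. place_graph phi \<Gamma>' \<Longrightarrow> \<Gamma> \<subseteq> \<Gamma>' \<Longrightarrow> \<Gamma>' = \<Gamma>"
    using ex_maximal_place_graph[OF pg] by metis
  note D = place_graphD[OF hom G] place_graph_zero_one[OF hom G] place_graph_diff[OF hom G]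
  have inv: "(inverse b, inverse c) \<in> \<Gamma>" if "(b, c) \<in> \<Gamma>" "c \<noteq> 0" for b c
    by (rule maximal_place_graph_inverse[OF hom G _ that]) (rule mx)
  have tot: "x \<in> Domain \<Gamma> \<or> inverse x \<in> Domain \<Gamma>" for x
    by (rule maximal_place_graph_total[OF hom G]) (rule mx)
  note fnl = place_graph_functional[OF hom G]
  have "place phi (Domain \<Gamma>) {x. (x, 0) \<in> \<Gamma>}"
  proof
    show "is_ring_hom phi" by (rule hom)
    show "is_subring (Domain \<Gamma>)"
      unfolding is_subring_def using D(3) D(6) D(7) by (auto simp: Domain_iff) blast+
    show "{x. (x, 0) \<in> \<Gamma>} \<subseteq> Domain \<Gamma>" by auto
    show "1 \<notin> {x. (x, 0) \<in> \<Gamma>}" using D(6) fnl[of 1 0 1] by auto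
  next
    fix x y assume "x \<in> {x. (x, 0) \<in> \<Gamma>}" "y \<in> {x. (x, 0) \<in> \<Gamma>}"
    then show "x + y \<in> {x. (x, 0) \<in> \<Gamma>}" using D(2)[of x 0 y 0] by simp
  next
    fix x y assume "x \<in> Domain \<Gamma>" "y \<in> {x. (x, 0) \<in> \<Gamma>}"
    then obtain c where "(x, c) \<in> \<Gamma>" "(y, 0) \<in> \<Gamma>" by auto
    then show "x * y \<in> {x. (x, 0) \<in> \<Gamma>}" using D(3)[of x c y 0] by simp
  next
    fix x assume x: "x \<notin> Domain \<Gamma>"
    then obtain c where c: "(inverse x, c) \<in> \<Gamma>" using tot[of x] by auto
    have "c = 0"
    proof (rule ccontr)
      assume "c \<noteq> 0"
      then have "(x, inverse c) \<in> \<Gamma>" using inv[OF c] by simp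
      then show False using x by auto
    qed
    then show "inverse x \<in> {x. (x, 0) \<in> \<Gamma>}" using c by simp
  next
    fix x assume "x \<in> Domain \<Gamma>" "x \<notin> {x. (x, 0) \<in> \<Gamma>}"
    then obtain c where c: "(x, c) \<in> \<Gamma>" "c \<noteq> 0" by auto
    then show "inverse x \<in> Domain \<Gamma>" using inv[OF c] by blast
  next
    fix x assume "x \<in> Domain \<Gamma>"
    then obtain c where "(x, c) \<in> \<Gamma>" by auto
    then have "(x - phi c, 0) \<in> \<Gamma>" using D(7)[of x c "phi c" c] D(1) by simp
    then show "\<exists>c. x - phi c \<in> {x. (x, 0) \<in> \<Gamma>}" by blast
  next
    show "phi c \<in> Domain \<Gamma>" for c using D(1) by blast
  qed
  then show ?thesis by (rule that) (use sub in auto)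
qed

section \<open>The valuative criterion for integral closures\<close>

lemma is_ring_hom_to_fract: "is_ring_hom to_fract"
  by (simp add: is_ring_hom_def)

lemmas to_fract_power = is_ring_homD(7)[OF is_ring_hom_to_fract]

lemma (in C_algebra) span_mult_closed:
  assumes S: "\<And>x y. x \<in> S \<Longrightarrow> y \<in> S \<Longrightarrow> x * y \<in> S"
    and x: "x \<in> vs.span S" and y: "y \<in> vs.span S"
  shows "x * y \<in> vs.span S"
  using x
proof (induction rule: vs.span_induct_alt)
  case base
  then show ?case by (simp add: vs.span_zero)
next
  case (step c u v)
  have "u * y \<in> vs.span S"
    using y
  proof (induction rule: vs.span_induct_alt)
    case base
    then show ?case by (simp add: vs.span_zero)
  next
    case (step d a b)
    have "u * (phi d * a + b) = phi d * (u * a) + u * b" by (simp add: algebra_simps)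
    then show ?case using step S[OF \<open>u \<in> S\<close>]
      by (simp add: vs.span_add vs.span_scale vs.span_base)
  qed
  moreover have "(phi c * u + v) * y = phi c * (u * y) + v * y" by (simp add: algebra_simps)
  ultimately show ?case using step by (simp add: vs.span_add vs.span_scale)
qed

text \<open>There are countably many monomials in finitely many generators, and their span is closed
  under multiplication.\<close>

lemma fg_C_algebra_countable_span:
  fixes phi :: "complex \<Rightarrow> 'a::comm_ring_1"
  assumes "fg_C_algebra phi"
  obtains S where "countable S" "module.span (\<lambda>c x. phi c * x) S = UNIV"
proof -
  from assms obtain G where hom: "is_ring_hom phi" and G: "finite G" "alg_gen phi G = UNIV"
    by (auto simp: fg_C_algebra_def)
  interpret C_algebra phi by unfold_locales (rule hom)
  define S where "S = prod_list ` lists G"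
  have S: "x * y \<in> S" if "x \<in> S" "y \<in> S" for x y
  proof -
    from that obtain xs ys where "xs \<in> lists G" "x = prod_list xs" "ys \<in> lists G" "y = prod_list ys"
      by (auto simp: S_def)
    then show ?thesis unfolding S_def by (intro image_eqI[of _ _ "xs @ ys"]) auto
  qed
  have one: "1 \<in> S" unfolding S_def by (intro image_eqI[of _ _ "[]"]) auto
  have "alg_gen phi G \<subseteq> vs.span S"
    unfolding alg_gen_def
  proof (rule Inter_lower, intro CollectI conjI ballI)
    show "range phi \<subseteq> vs.span S"
      using vs.span_scale[OF vs.span_base[OF one]] by fastforce
    have "G \<subseteq> S" unfolding S_def
    proof
      fix g assume "g \<in> G"
      then show "g \<in> prod_list ` lists G" by (intro image_eqI[of _ _ "[g]"]) auto
    qed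
    then show "G \<subseteq> vs.span S" using vs.span_superset by blast
  qed (auto intro: vs.span_add span_mult_closed S)
  then have "vs.span S = UNIV" using G(2) by auto
  moreover have "countable S" unfolding S_def using G(1)
    by (intro countable_image countable_lists countable_finite)
  ultimately show ?thesis using that by blast
qed

text \<open>If \<open>y\<close> is not integral over \<open>L\<close>, then the ideal generated by \<open>L / y\<close> in \<open>R[L / y]\<close> is proper,
  and any place of the fraction field centred at a maximal ideal above it separates \<open>y\<close> from \<open>L\<close>.\<close>

lemma valuative_criterion:
  fixes phi :: "complex \<Rightarrow> 'r::idom" and L :: "'r set"
  assumes fg: "fg_C_algebra phi" and y: "y \<notin> int_closure L"
  obtains V M where "place (\<lambda>c. to_fract (phi c)) V M" "range to_fract \<subseteq> V"
    "\<And>g. g \<in> L \<Longrightarrow> to_fract g / to_fract y \<in> M"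
proof -
  have hom: "is_ring_hom phi" using fg by (simp add: fg_C_algebra_def)
  define ph where "ph c = to_fract (phi c)" for c
  have homK: "is_ring_hom ph" unfolding is_ring_hom_def ph_def by (simp add: is_ring_homD[OF hom])
  interpret R: C_algebra phi by unfold_locales (rule hom)
  interpret K: C_algebra ph by unfold_locales (rule homK)
  have "0 \<in> int_closure L" unfolding int_closure_def
    by (intro CollectI exI[of _ 1] conjI exI[of _ "\<lambda>_. 0"])
      (auto simp: is_idealD(1)[OF is_ideal_ideal_mult])
  then have y0: "y \<noteq> 0" using y by auto
  define Y where "Y = to_fract y"
  have Y0: "Y \<noteq> 0" using y0 by (simp add: Y_def)
  define ev where "ev Q = poly (fract_poly Q) (1 / Y)" for Q
  have ev: "ev (P + Q) = ev P + ev Q" "ev (P - Q) = ev P - ev Q" "ev (P * Q) = ev P * ev Q"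
    "ev [:r:] = to_fract r" "ev 0 = 0" "ev 1 = 1" "ev (monom r 1) = to_fract r / Y" for P Q r
  proof -
    have "fract_poly [:a, b:] = [:to_fract a, to_fract b:]" for a b :: 'r
      by (rule poly_eqI) (simp add: coeff_map_poly coeff_pCons split: nat.split)
    from this[of r 0] this[of 0 r] show "ev [:r:] = to_fract r" "ev (monom r 1) = to_fract r / Y"
      by (simp_all add: ev_def monom_altdef)
  qed (simp_all add: ev_def)
  \<comment> \<open>The Rees ring of \<open>L\<close>. Its image \<open>A\<close> under evaluation
    at \<open>1 / y\<close> is \<open>R[L / y]\<close>, and the polynomials without constant term
    give the ideal \<open>a\<close> generated by \<open>L / y\<close>.\<close>
  define D where "D = {Q. \<forall>i. coeff Q i \<in> ideal_pow L i}"
  have D0: "[:r:] \<in> D" for r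
    by (auto simp: D_def coeff_pCons is_idealD(1)[OF is_ideal_ideal_mult] split: nat.split)
  have Lneg: "- a \<in> ideal_pow L i" if "a \<in> ideal_pow L i" for a i
    using is_idealD(3)[OF is_ideal_ideal_pow that, of "-1"] by simp
  have Dadd: "P + Q \<in> D" if "P \<in> D" "Q \<in> D" for P Q
    using that by (auto simp: D_def is_idealD(2)[OF is_ideal_ideal_pow])
  have Ddiff: "P - Q \<in> D" if "P \<in> D" "Q \<in> D" for P Q
  proof -
    have "- Q \<in> D" using that Lneg by (auto simp: D_def)
    then show ?thesis using Dadd[OF that(1)] by fastforce
  qed
  have Dmult: "P * Q \<in> D" if "P \<in> D" "Q \<in> D" for P Q
  proof -
    have "coeff P i * coeff Q (n - i) \<in> ideal_pow L n" if "i \<le> n" for n i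
      using ideal_pow_mult[of "coeff P i" L i "coeff Q (n - i)" "n - i"] \<open>P \<in> D\<close> \<open>Q \<in> D\<close> that
      by (simp add: D_def)
    then show ?thesis by (auto simp: D_def coeff_mult intro!: is_ideal_sum[OF is_ideal_ideal_pow])
  qed
  define A where "A = ev ` D"
  define a where "a = ev ` {Q \<in> D. coeff Q 0 = 0}"
  have A: "is_subring A"
    unfolding is_subring_def
  proof (intro conjI ballI)
    show "1 \<in> A" unfolding A_def using D0[of 1] ev(4)[of 1] by (metis image_eqI to_fract_1)
  next
    fix u v assume "u \<in> A" "v \<in> A"
    then obtain P Q where PQ: "P \<in> D" "Q \<in> D" "u = ev P" "v = ev Q" by (auto simp: A_def)
    show "u - v \<in> A" using Ddiff[OF PQ(1,2)] ev(2)[of P Q] PQ(3,4) unfolding A_def by (metis image_eqI)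
    show "u * v \<in> A" using Dmult[OF PQ(1,2)] ev(3)[of P Q] PQ(3,4) unfolding A_def by (metis image_eqI)
  qed
  have RA: "to_fract r \<in> A" for r using D0[of r] ev(4)[of r] unfolding A_def by (metis image_eqI)
  have a: "K.rel_ideal A a"
    unfolding K.rel_ideal_def
  proof (intro conjI ballI)
    show "a \<subseteq> A" by (auto simp: a_def A_def)
    show "0 \<in> a" unfolding a_def using D0[of 0] ev(5) by (intro image_eqI[of _ _ 0]) auto
  next
    fix u v assume "u \<in> a" "v \<in> a"
    then obtain P Q where PQ: "P \<in> D" "Q \<in> D" "coeff P 0 = 0" "coeff Q 0 = 0" "u = ev P" "v = ev Q"
      by (auto simp: a_def)
    then show "u + v \<in> a" unfolding a_def
      by (intro image_eqI[of _ _ "P + Q"]) (auto simp: ev Dadd)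
  next
    fix u v assume "u \<in> A" "v \<in> a"
    then obtain P Q where PQ: "P \<in> D" "Q \<in> D" "coeff Q 0 = 0" "u = ev P" "v = ev Q"
      by (auto simp: a_def A_def)
    then show "u * v \<in> a" unfolding a_def
      by (intro image_eqI[of _ _ "P * Q"]) (auto simp: ev Dmult coeff_mult)
  qed
  have evsum: "ev Q = (\<Sum>i\<le>degree Q. to_fract (coeff Q i) * (1 / Y) ^ i)" for Q
    unfolding ev_def poly_altdef by (simp add: degree_map_poly coeff_map_poly)
  \<comment> \<open>Multiplying an expression of \<open>1\<close> of degree \<open>n\<close> by
    \<open>y ^ n\<close> gives an equation of integral dependence whose \<open>i\<close>-th
    coefficient lies in the \<open>i\<close>-th power of \<open>L\<close>.\<close>
  have "1 \<notin> a"
  proof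
    assume "1 \<in> a"
    then obtain Q where Q: "Q \<in> D" "coeff Q 0 = 0" "ev Q = 1" by (auto simp: a_def)
    let ?n = "degree Q"
    have "to_fract (y ^ ?n) = Y ^ ?n * ev Q" using Q(3) by (simp add: Y_def to_fract_power)
    also have "\<dots> = (\<Sum>i\<le>?n. to_fract (coeff Q i) * Y ^ (?n - i))"
      unfolding evsum sum_distrib_left
      by (intro sum.cong) (auto simp: Y0 power_diff field_simps)
    also have "\<dots> = to_fract (\<Sum>i\<le>?n. coeff Q i * y ^ (?n - i))" by (simp add: Y_def to_fract_power)
    finally have "y ^ ?n = (\<Sum>i\<le>?n. coeff Q i * y ^ (?n - i))" by (simp only: to_fract_eq_iff)
    also have "\<dots> = (\<Sum>i=1..?n. coeff Q i * y ^ (?n - i))"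
      using Q(2) by (intro sum.mono_neutral_right) (auto simp: Suc_le_eq)
    finally have e: "y ^ ?n + (\<Sum>i=1..?n. - coeff Q i * y ^ (?n - i)) = 0"
      by (simp add: sum_negf)
    then have "?n \<ge> 1" by (cases "?n") auto
    then have "y \<in> int_closure L"
      unfolding int_closure_def using e Q(1) Lneg
      by (intro CollectI exI[of _ ?n] conjI exI[of _ "\<lambda>i. - coeff Q i"]) (auto simp: D_def)
    then show False using y by simp
  qed
  obtain S where S: "countable S" "R.vs.span S = UNIV"
    using fg_C_algebra_countable_span[OF fg] .
  \<comment> \<open>\<open>A\<close> may need infinitely many generators as an algebra, but only a
    countable spanning set is required for its residue fields to be \<complex>.\<close>
  define S' where "S' = (\<lambda>(s, n). to_fract s * (1 / Y) ^ n) ` (S \<times> (UNIV :: nat set))"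
  have S': "to_fract r * (1 / Y) ^ n \<in> K.vs.span S'" for r n
  proof -
    have "r \<in> R.vs.span S" by (simp add: S(2))
    then show ?thesis
    proof (induction rule: R.vs.span_induct_alt)
      case base
      then show ?case by (simp add: K.vs.span_zero)
    next
      case (step c u v)
      have "to_fract (phi c * u + v) * (1 / Y) ^ n
          = ph c * (to_fract u * (1 / Y) ^ n) + to_fract v * (1 / Y) ^ n"
        by (simp add: ph_def algebra_simps)
      moreover have "to_fract u * (1 / Y) ^ n \<in> S'" using step(1) by (auto simp: S'_def)
      ultimately show ?case using step(2)
        by (simp only: K.vs.span_add K.vs.span_scale K.vs.span_base)
    qed
  qed
  have "countable S'" unfolding S'_def using S(1) by (intro countable_image countable_SIGMA) auto
  moreover have "S' \<noteq> {}"
  proof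
    assume "S' = {}"
    then have "to_fract 1 * (1 / Y) ^ 0 \<in> {0 :: 'r fract}" using S'[of 1 0] by simp
    then show False by simp
  qed
  ultimately have rng: "range (from_nat_into S') = S'" by (rule range_from_nat_into[rotated])
  have "A \<subseteq> K.vs.span (range (from_nat_into S'))"
    unfolding rng A_def evsum by (auto intro!: K.vs.span_sum S')
  moreover have "range ph \<subseteq> A" using RA by (auto simp: ph_def)
  ultimately obtain \<Gamma> where G: "place_graph ph \<Gamma>" "A \<subseteq> Domain \<Gamma>" "\<And>x. x \<in> a \<Longrightarrow> (x, 0) \<in> \<Gamma>"
    using K.ex_place_graph[OF A _ _ a \<open>1 \<notin> a\<close>] by metis
  obtain V M where VM: "place ph V M" "Domain \<Gamma> \<subseteq> V" "\<And>x. (x, 0) \<in> \<Gamma> \<Longrightarrow> x \<in> M"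
    using place_of_place_graph[OF homK G(1)] by metis
  show ?thesis
  proof (rule that)
    show "place (\<lambda>c. to_fract (phi c)) V M" using VM(1) by (simp add: ph_def[abs_def])
    show "range to_fract \<subseteq> V" using RA G(2) VM(2) by auto
    fix g assume g: "g \<in> L"
    have "ev (monom g 1) \<in> a"
      unfolding a_def
      using g ideal_multI[of 1 UNIV g L] by (auto simp: D_def is_idealD(1)[OF is_ideal_ideal_pow] intro!: imageI)
    then show "to_fract g / to_fract y \<in> M" using G(3) VM(3) unfolding ev(7) Y_def by simp
  qed
qed

section \<open>Linear algebra in the tensor product\<close>

context C_algebra
begin

definition linear_functional :: "('a \<Rightarrow> complex) \<Rightarrow> bool" where
  "linear_functional l \<longleftrightarrow> (\<forall>x y. l (x + y) = l x + l y) \<and> (\<forall>c x. l (phi c * x) = c * l x)"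

lemma linear_functionalD:
  assumes "linear_functional l"
  shows "l (x + y) = l x + l y" "l (phi c * x) = c * l x" "l 0 = 0"
    "l (sum f A) = (\<Sum>a\<in>A. l (f a))" "l (x - y) = l x - l y"
proof -
  show a: "l (x + y) = l x + l y" and m: "l (phi c * x) = c * l x" for x y c
    using assms by (auto simp: linear_functional_def)
  show z: "l 0 = 0" using a[of 0 0] by simp
  show "l (sum f A) = (\<Sum>a\<in>A. l (f a))"
    by (induction A rule: infinite_finite_induct) (auto simp: z a)
  show "l (x - y) = l x - l y" using a[of "x - y" y] by (simp add: algebra_simps)
qed

lemma ex_separating_functional:
  assumes W: "vs.subspace W" and x: "x \<notin> W"
  obtains l where "linear_functional l" "\<And>w. w \<in> W \<Longrightarrow> l w = 0" "l x = 1"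
proof -
  interpret cc: vector_space "(*) :: complex \<Rightarrow> complex \<Rightarrow> complex"
    by unfold_locales (auto simp: algebra_simps)
  interpret vp: vector_space_pair "\<lambda>c x. phi c * x" "(*) :: complex \<Rightarrow> complex \<Rightarrow> complex" ..
  obtain B where B: "B \<subseteq> W" "vs.independent B" "W \<subseteq> vs.span B"
    using vs.maximal_independent_subset[of W] by blast
  have spB: "vs.span B = W" using B vs.span_minimal[OF B(1) W] by blast
  then have "vs.independent (insert x B)" using B(2) x by (intro vs.independent_insertI) auto
  from vp.linear_independent_extend[OF this, of "\<lambda>v. if v = x then 1 else 0"]
  obtain l where l: "Vector_Spaces.linear (\<lambda>c x. phi c * x) (*) l"
    "\<forall>v\<in>insert x B. l v = (if v = x then 1 else 0)" by blast
  interpret l: Vector_Spaces.linear "\<lambda>c x. phi c * x" "(*)" l by (rule l(1))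
  have lf: "linear_functional l" by (simp add: linear_functional_def l.add l.scale)
  have "l w = 0" if "w \<in> W" for w
    using that unfolding spB[symmetric]
  proof (induction rule: vs.span_induct_alt)
    case base
    then show ?case by (rule linear_functionalD(3)[OF lf])
  next
    case (step c b y)
    then have "b \<noteq> x" using B(1) x by auto
    then show ?case using step l(2) by (simp add: linear_functionalD[OF lf])
  qed
  then show ?thesis using that[OF lf] l(2) by auto
qed

lemma subspace_ideal: "is_ideal W \<Longrightarrow> vs.subspace W"
  by (auto simp: vs.subspace_def is_ideal_def)

text \<open>Independence in a form that follows the construction of a list from its tail. As a
  property of lists it also rules out repetitions, as \<open>lin_indep\<close> demands.\<close>

fun indep_list :: "'a list \<Rightarrow> bool" where
  "indep_list [] = True"
| "indep_list (x # xs) = (x \<notin> vs.span (set xs) \<and> indep_list xs)"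

lemma lin_indep_indep_list: "indep_list xs \<Longrightarrow> lin_indep phi (length xs) ((!) xs)"
proof (induction xs)
  case Nil
  then show ?case by (simp add: lin_indep_def)
next
  case (Cons x xs)
  show ?case
    unfolding lin_indep_def
  proof (intro allI impI)
    fix c k assume s: "(\<Sum>k<length (x # xs). phi (c k) * (x # xs) ! k) = 0" and k: "k < length (x # xs)"
    then have s': "phi (c 0) * x + (\<Sum>k<length xs. phi (c (Suc k)) * xs ! k) = 0"
      by (simp add: sum.lessThan_Suc_shift del: sum.lessThan_Suc)
    have c0: "c 0 = 0"
    proof (rule ccontr)
      assume "c 0 \<noteq> 0"
      have "(\<Sum>k<length xs. phi (c (Suc k)) * xs ! k) = - (phi (c 0) * x)"
        using s' by (simp add: eq_neg_iff_add_eq_0 add.commute)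
      then have "x = phi (- inverse (c 0)) * (\<Sum>k<length xs. phi (c (Suc k)) * xs ! k)"
        using \<open>c 0 \<noteq> 0\<close> by simp
      also have "\<dots> \<in> vs.span (set xs)"
        by (intro vs.span_scale vs.span_sum vs.span_base) auto
      finally show False using Cons.prems by simp
    qed
    then have "(\<Sum>k<length xs. phi (c (Suc k)) * xs ! k) = 0" using s' by (simp add: phi_simps)
    then have "\<forall>k<length xs. c (Suc k) = 0"
      using Cons by (auto simp: lin_indep_def dest!: spec[of _ "\<lambda>k. c (Suc k)"])
    then show "c k = 0" using c0 k by (cases k) auto
  qed
qed

end

lemma is_ideal_ideal_add:
  assumes "is_ideal A" "is_ideal B" shows "is_ideal (ideal_add A B)"
  unfolding is_ideal_def
proof (intro conjI ballI allI)
  have "(0::'a) = 0 + 0" by simp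
  then show "0 \<in> ideal_add A B" using assms is_idealD(1) unfolding ideal_add_def by blast
next
  fix x y assume "x \<in> ideal_add A B" "y \<in> ideal_add A B"
  then obtain a b c d where h: "x = a + b" "y = c + d" "a \<in> A" "b \<in> B" "c \<in> A" "d \<in> B"
    by (auto simp: ideal_add_def)
  have "x + y = (a + c) + (b + d)" by (simp add: h algebra_simps)
  moreover have "a + c \<in> A" "b + d \<in> B" using h assms by (auto simp: is_idealD)
  ultimately show "x + y \<in> ideal_add A B" unfolding ideal_add_def by blast
next
  fix x r assume "x \<in> ideal_add A B"
  then obtain a b where h: "x = a + b" "a \<in> A" "b \<in> B" by (auto simp: ideal_add_def)
  have "r * x = r * a + r * b" by (simp add: h algebra_simps)
  moreover have "r * a \<in> A" "r * b \<in> B" using h assms by (auto simp: is_idealD)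
  ultimately show "r * x \<in> ideal_add A B" unfolding ideal_add_def by blast
qed

lemma ideal_add_supset:
  assumes "is_ideal A" "is_ideal B" shows "A \<subseteq> ideal_add A B" "B \<subseteq> ideal_add A B"
proof -
  have "x \<in> ideal_add A B" if "x \<in> A" for x
    using that is_idealD(1)[OF assms(2)] unfolding ideal_add_def by (intro CollectI exI[of _ x] exI[of _ 0]) auto
  then show "A \<subseteq> ideal_add A B" ..
  have "x \<in> ideal_add A B" if "x \<in> B" for x
    using that is_idealD(1)[OF assms(1)] unfolding ideal_add_def by (intro CollectI exI[of _ 0] exI[of _ x]) auto
  then show "B \<subseteq> ideal_add A B" ..
qed

lemma ideal_add_least:
  "is_ideal K \<Longrightarrow> A \<subseteq> K \<Longrightarrow> B \<subseteq> K \<Longrightarrow> ideal_add A B \<subseteq> K"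
  by (auto simp: ideal_add_def is_ideal_def)

lemma is_ideal_extension: "is_ideal (extension f A)"
  by (simp add: extension_def is_ideal_ideal_gen)

lemma extension_base: "x \<in> A \<Longrightarrow> f x \<in> extension f A"
  unfolding extension_def by (rule subsetD[OF subset_ideal_gen]) auto

section \<open>Tensors represented by lists of pairs\<close>

definition pair_sum :: "('r \<Rightarrow> 's \<Rightarrow> 'z::comm_monoid_add) \<Rightarrow> ('r \<times> 's) list \<Rightarrow> 'z" where
  "pair_sum f xs = (\<Sum>(r, s)\<leftarrow>xs. f r s)"

lemma pair_sum_simps [simp]:
  "pair_sum f [] = 0" "pair_sum f ((r, s) # xs) = f r s + pair_sum f xs"
  "pair_sum f (xs @ ys) = pair_sum f xs + pair_sum f ys"
  by (simp_all add: pair_sum_def)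

locale tensor =
  fixes phiR :: "complex \<Rightarrow> 'r::idom" and phiS :: "complex \<Rightarrow> 's::idom"
    and phiT :: "complex \<Rightarrow> 't::comm_ring_1" and iR :: "'r \<Rightarrow> 't" and iS :: "'s \<Rightarrow> 't"
  assumes fgR: "fg_C_algebra phiR" and fgS: "fg_C_algebra phiS"
    and tp: "is_tensor_product phiR phiS phiT iR iS"
begin

sublocale R: C_algebra phiR
  using fgR by unfold_locales (simp add: fg_C_algebra_def)

sublocale S: C_algebra phiS
  using fgS by unfold_locales (simp add: fg_C_algebra_def)

lemma homs: "is_ring_hom iR" "is_ring_hom iS"
  using tp by (auto simp: is_tensor_product_def)

lemmas iR_simps = is_ring_homD[OF homs(1)]
lemmas iS_simps = is_ring_homD[OF homs(2)]

lemma iR_phi: "iR (phiR c) = phiT c" and iS_phi: "iS (phiS c) = phiT c"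
  using tp by (auto simp: is_tensor_product_def)

definition tsum :: "('r \<times> 's) list \<Rightarrow> 't" where
  "tsum = pair_sum (\<lambda>r s. iR r * iS s)"

text \<open>The value of \<open>l \<otimes> l'\<close>, defined on lists since the tensor product is
  given by surjectivity and injectivity conditions and not by a universal property. Until
  \<open>bval_eq_0\<close> is available, every rewriting of a list has to record that these values
  are preserved.\<close>

definition bval :: "('r \<Rightarrow> complex) \<Rightarrow> ('s \<Rightarrow> complex) \<Rightarrow> ('r \<times> 's) list \<Rightarrow> complex" where
  "bval l l' = pair_sum (\<lambda>r s. l r * l' s)"

lemma tsum_simps [simp]:
  "tsum [] = 0" "tsum ((r, s) # xs) = iR r * iS s + tsum xs" "tsum (xs @ ys) = tsum xs + tsum ys"
  by (simp_all add: tsum_def)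

lemma bval_simps [simp]:
  "bval l l' [] = 0" "bval l l' ((r, s) # xs) = l r * l' s + bval l l' xs"
  "bval l l' (xs @ ys) = bval l l' xs + bval l l' ys"
  by (simp_all add: bval_def)

lemma ex_tsum: "\<exists>xs. t = tsum xs"
proof -
  obtain n :: nat and r s where t: "t = (\<Sum>k<n. iR (r k) * iS (s k))"
    using tp unfolding is_tensor_product_def by blast
  have "(\<Sum>k<n. iR (r k) * iS (s k)) = tsum (map (\<lambda>k. (r k, s k)) [0..<n])"
    by (induction n) (auto simp: add.commute)
  then show ?thesis using t by blast
qed

text \<open>If \<open>r\<close> is \<open>w\<close> plus a combination of the first entries of
  \<open>xs\<close>, bilinearity moves the coefficients of the combination to the second entries.
  The first entries do not change, so the list becomes shorter by one and independence of its first
  entries is kept.\<close>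

lemma absorb:
  assumes W: "R.vs.subspace W" and "r \<in> R.vs.span (W \<union> fst ` set xs)"
  shows "\<exists>w ys. w \<in> W \<and> map fst ys = map fst xs \<and> tsum ((r, s) # xs) = iR w * iS s + tsum ys \<and>
    (\<forall>l l'. R.linear_functional l \<longrightarrow> S.linear_functional l' \<longrightarrow>
      bval l l' ((r, s) # xs) = l w * l' s + bval l l' ys)"
  using assms(2)
proof (induction xs arbitrary: r)
  case Nil
  then have "r \<in> W" using R.vs.span_minimal[OF subset_refl W] by auto
  then show ?case by (intro exI[of _ r] exI[of _ "[]"]) auto
next
  case (Cons x xs)
  obtain r1 s1 where x: "x = (r1, s1)" by force
  from Cons.prems obtain k where "r - phiR k * r1 \<in> R.vs.span (W \<union> fst ` set xs)"
    by (auto simp: x R.vs.span_breakdown_eq)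
  from Cons.IH[OF this] obtain w ys where IH: "w \<in> W" "map fst ys = map fst xs"
    "tsum ((r - phiR k * r1, s) # xs) = iR w * iS s + tsum ys"
    "\<And>l l'. R.linear_functional l \<Longrightarrow> S.linear_functional l' \<Longrightarrow>
      bval l l' ((r - phiR k * r1, s) # xs) = l w * l' s + bval l l' ys" by blast
  have "tsum ((r, s) # x # xs)
      = tsum ((r - phiR k * r1, s) # xs) + iR r1 * iS (s1 + phiS k * s)"
    by (simp add: x iR_simps iS_simps iR_phi iS_phi algebra_simps)
  moreover have "bval l l' ((r, s) # x # xs)
      = bval l l' ((r - phiR k * r1, s) # xs) + l r1 * l' (s1 + phiS k * s)"
    if "R.linear_functional l" "S.linear_functional l'" for l l'
    by (simp only: x bval_simps R.linear_functionalD(2,5)[OF that(1)] S.linear_functionalD(1,2)[OF that(2)])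
      (simp add: algebra_simps)
  ultimately show ?case using IH
    by (intro exI[of _ w] exI[of _ "(r1, s1 + phiS k * s) # ys"]) (simp add: x algebra_simps)
qed

text \<open>Over a field, \<open>W \<otimes> S + R \<otimes> W'\<close> is the common kernel of the
  forms \<open>l \<otimes> l'\<close> with \<open>l\<close> and \<open>l'\<close> vanishing on
  \<open>W\<close> and \<open>W'\<close>. Read contrapositively, this supplies the functionals that
  slice an element outside the sum.\<close>

lemma tsum_mem_extensions:
  assumes W: "R.vs.subspace W" and W': "S.vs.subspace W'"
    and "\<And>l l'. R.linear_functional l \<Longrightarrow> S.linear_functional l' \<Longrightarrow> (\<And>w. w \<in> W \<Longrightarrow> l w = 0) \<Longrightarrow>
      (\<And>w. w \<in> W' \<Longrightarrow> l' w = 0) \<Longrightarrow> bval l l' xs = 0"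
  shows "tsum xs \<in> ideal_add (extension iR W) (extension iS W')"
  using assms(3)
proof (induction "length xs" arbitrary: xs)
  let ?E = "ideal_add (extension iR W) (extension iS W')"
  note E = is_ideal_ideal_add[OF is_ideal_extension is_ideal_extension, of iR W iS W']
  have sup: "extension iR W \<subseteq> ?E" "extension iS W' \<subseteq> ?E"
    by (intro ideal_add_supset is_ideal_extension)+
  {
    case 0
    then show ?case using is_idealD(1)[OF E] by simp
  next
    case (Suc n)
    then obtain r s xs' where xs: "xs = (r, s) # xs'" "length xs' = n"
      by (metis length_Suc_conv surj_pair)
    show ?case
    proof (cases "r \<in> R.vs.span (W \<union> fst ` set xs')")
      case True
      from absorb[OF W True, of s] obtain w ys where ys: "w \<in> W" "map fst ys = map fst xs'"
        "tsum ((r, s) # xs') = iR w * iS s + tsum ys"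
        "\<And>l l'. R.linear_functional l \<Longrightarrow> S.linear_functional l' \<Longrightarrow>
          bval l l' ((r, s) # xs') = l w * l' s + bval l l' ys" by blast
      have "length ys = n" using ys(2) xs(2) by (metis length_map)
      then have "tsum ys \<in> ?E"
      proof (rule Suc.hyps(1)[OF sym])
        fix l l' assume l: "R.linear_functional l" "S.linear_functional l'"
          and k: "\<And>w. w \<in> W \<Longrightarrow> l w = 0" "\<And>w. w \<in> W' \<Longrightarrow> l' w = 0"
        show "bval l l' ys = 0"
          using Suc.prems[OF l k] ys(4)[OF l] k(1)[OF ys(1)] by (simp add: xs(1))
      qed
      moreover have "iR w * iS s \<in> ?E"
        using is_idealD(4)[OF E subsetD[OF sup(1) extension_base[OF ys(1)]]] .
      ultimately show ?thesis using ys(3) is_idealD(2)[OF E] by (simp add: xs(1))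
    next
      case False
      \<comment> \<open>\<open>l0\<close> isolates the head of the list, as it kills
        \<open>W\<close> and the other first entries. Hence every \<open>l'\<close> that vanishes on
        \<open>W'\<close> also vanishes at \<open>s\<close>, and so
        \<open>s \<in> W'\<close>.\<close>
      obtain l0 where l0: "R.linear_functional l0"
        "\<And>w. w \<in> R.vs.span (W \<union> fst ` set xs') \<Longrightarrow> l0 w = 0" "l0 r = 1"
        using R.ex_separating_functional[OF R.vs.subspace_span False] by metis
      have z: "bval l0 l' xs' = 0" for l'
      proof -
        have "bval l0 l' zs = 0" if "set zs \<subseteq> set xs'" for zs
          using that
        proof (induction zs)
          case (Cons z zs)
          have "fst z \<in> R.vs.span (W \<union> fst ` set xs')"
            using Cons.prems by (intro R.vs.span_base) auto
          then show ?case using Cons l0(2) by (cases z) auto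
        qed simp
        then show ?thesis by blast
      qed
      have s: "s \<in> W'"
      proof (rule ccontr)
        assume "s \<notin> W'"
        then obtain l' where l': "S.linear_functional l'" "\<And>w. w \<in> W' \<Longrightarrow> l' w = 0" "l' s = 1"
          using S.ex_separating_functional[OF W'] by metis
        have "bval l0 l' xs = 0"
          by (rule Suc.prems[OF l0(1) l'(1) _ l'(2)]) (auto intro: l0(2) R.vs.span_base)
        then show False using l0(3) l'(3) z by (simp add: xs(1))
      qed
      have "tsum xs' \<in> ?E"
      proof (rule Suc.hyps(1))
        show "n = length xs'" by (simp add: xs(2))
        fix l l' assume l: "R.linear_functional l" "S.linear_functional l'"
          and k: "\<And>w. w \<in> W \<Longrightarrow> l w = 0" "\<And>w. w \<in> W' \<Longrightarrow> l' w = 0"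
        show "bval l l' xs' = 0" using Suc.prems[OF l k] k(2)[OF s] by (simp add: xs(1))
      qed
      moreover have "iR r * iS s \<in> ?E"
        using is_idealD(3)[OF E subsetD[OF sup(2) extension_base[OF s]]] .
      ultimately show ?thesis using is_idealD(2)[OF E] by (simp add: xs(1))
    qed
  }
qed

lemma ex_indep_rep:
  "\<exists>ys. tsum ys = tsum xs \<and> R.indep_list (map fst ys) \<and>
    (\<forall>l l'. R.linear_functional l \<longrightarrow> S.linear_functional l' \<longrightarrow> bval l l' ys = bval l l' xs)"
proof (induction xs)
  case Nil
  then show ?case by (intro exI[of _ "[]"]) auto
next
  case (Cons x xs)
  obtain r s where x: "x = (r, s)" by force
  from Cons obtain ys where ys: "tsum ys = tsum xs" "R.indep_list (map fst ys)"
    "\<And>l l'. R.linear_functional l \<Longrightarrow> S.linear_functional l' \<Longrightarrow> bval l l' ys = bval l l' xs" by blast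
  show ?case
  proof (cases "r \<in> R.vs.span (fst ` set ys)")
    case True
    then have "r \<in> R.vs.span ({0} \<union> fst ` set ys)" by (simp add: R.vs.span_insert_0)
    from absorb[OF R.vs.subspace_single_0 this, of s] obtain zs where zs:
      "map fst zs = map fst ys" "tsum ((r, s) # ys) = tsum zs"
      "\<And>l l'. R.linear_functional l \<Longrightarrow> S.linear_functional l' \<Longrightarrow>
        bval l l' ((r, s) # ys) = bval l l' zs"
      by (auto simp: iR_simps R.linear_functionalD)
    show ?thesis
    proof (intro exI[of _ zs] conjI allI impI)
      show "tsum zs = tsum (x # xs)" using zs(2) ys(1) by (simp add: x)
      show "R.indep_list (map fst zs)" unfolding zs(1) by (rule ys(2))
      show "bval l l' zs = bval l l' (x # xs)"
        if "R.linear_functional l" "S.linear_functional l'" for l l'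
        using zs(3)[OF that] ys(3)[OF that] by (simp add: x)
    qed
  next
    case False
    then show ?thesis using ys by (intro exI[of _ "(r, s) # ys"]) (auto simp: x)
  qed
qed

text \<open>Once the first entries are independent, the injectivity clause of
  \<open>is_tensor_product\<close> makes all second entries zero.\<close>

lemma bval_eq_0:
  assumes xs: "tsum xs = 0" and l: "R.linear_functional l" and l': "S.linear_functional l'"
  shows "bval l l' xs = 0"
proof -
  obtain ys where ys: "tsum ys = 0" "R.indep_list (map fst ys)" "bval l l' ys = bval l l' xs"
    using ex_indep_rep[of xs] xs l l' by auto
  have li: "lin_indep phiR (length ys) ((!) (map fst ys))"
    using R.lin_indep_indep_list[OF ys(2)] by simp
  have e: "(\<Sum>k<length ys. iR (map fst ys ! k) * iS (map snd ys ! k)) = tsum ys"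
    unfolding tsum_def pair_sum_def
    by (simp add: sum_list_sum_nth lessThan_atLeast0 case_prod_beta)
  have inj: "s k = 0"
    if "lin_indep phiR n r" "(\<Sum>k<n. iR (r k) * iS (s k)) = 0" "k < n" for n :: nat and r s k
    using tp that unfolding is_tensor_product_def by blast
  have 0: "map snd ys ! k = 0" if "k < length ys" for k
    by (rule inj[OF li _ that]) (simp only: e ys(1))
  have "\<forall>z\<in>set ys. snd z = 0"
  proof
    fix z assume "z \<in> set ys"
    then obtain k where "k < length ys" "z = ys ! k" by (auto simp: in_set_conv_nth)
    then show "snd z = 0" using 0[of k] by simp
  qed
  then have "bval l l' ys = 0"
    by (induction ys) (auto simp: S.linear_functionalD[OF l'])
  then show ?thesis using ys(3) by simp
qed

end

section \<open>Ordering the value group of two places\<close>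

context place
begin

lemmas V_simps = is_subringD[OF V_subring]

lemma M_in_V: "x \<in> M \<Longrightarrow> x \<in> V"
  using M_V by auto

lemma M_mult': "x \<in> M \<Longrightarrow> y \<in> V \<Longrightarrow> x * y \<in> M"
  using M_mult[of y x] by (simp add: mult.commute)

lemma zero_M: "0 \<in> M"
proof (rule ccontr)
  assume "0 \<notin> M"
  obtain c where "0 - phi c \<in> M" using residue[OF V_simps(1)] by auto
  then have "0 * (0 - phi c) \<in> M" by (intro M_mult V_simps)
  then show False using \<open>0 \<notin> M\<close> by simp
qed

lemma M_power: "x \<in> M \<Longrightarrow> n > 0 \<Longrightarrow> x ^ n \<in> M"
proof (induction n)
  case (Suc n)
  then show ?case using M_mult'[of x "x ^ n"] is_subring_power[OF V_subring M_in_V[of x]] by simp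
qed simp

lemma inverse_notin_M: "x \<notin> M \<Longrightarrow> inverse x \<in> V"
  using inverse_M inverse_V M_in_V by blast

definition U :: "'k set" where "U = V - M"

lemma U_nonzero: "x \<in> U \<Longrightarrow> x \<noteq> 0"
  using zero_M by (auto simp: U_def)

lemma U_mult: "x \<in> U \<Longrightarrow> y \<in> U \<Longrightarrow> x * y \<in> U"
proof -
  assume xy: "x \<in> U" "y \<in> U"
  have "y \<in> M" if "x * y \<in> M"
    using M_mult[OF inverse_V that, of x] xy U_nonzero[OF xy(1)]
    by (auto simp: U_def mult.assoc[symmetric])
  then show ?thesis using xy V_simps by (auto simp: U_def)
qed

lemma U_one: "1 \<in> U"
  using one_M V_simps by (simp add: U_def)

lemma U_inverse: "x \<in> U \<Longrightarrow> inverse x \<in> U"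
proof -
  assume x: "x \<in> U"
  have "inverse x \<notin> M"
  proof
    assume "inverse x \<in> M"
    then have "x * inverse x \<in> M" using x by (intro M_mult) (auto simp: U_def)
    then show False using U_nonzero[OF x] one_M by simp
  qed
  then show ?thesis using x inverse_V by (auto simp: U_def)
qed

text \<open>The value group is torsion free, since positive values have positive multiples and
  negative values negative ones.\<close>

lemma U_power_D: assumes "x ^ n \<in> U" "n > 0" shows "x \<in> U"
proof -
  have x0: "x \<noteq> 0" using U_nonzero[OF assms(1)] assms(2) by (auto simp: power_0_left)
  have "x \<notin> M" using M_power[of x n] assms by (auto simp: U_def)
  moreover have "x \<in> V"
  proof (rule ccontr)
    assume "x \<notin> V"
    then have "inverse x ^ n \<in> M" using M_power inverse_M assms(2) by blast
    then have "x ^ n * inverse x ^ n \<in> M" using assms(1) by (intro M_mult) (auto simp: U_def)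
    then show False using one_M x0 by (simp add: power_mult_distrib[symmetric])
  qed
  ultimately show ?thesis by (simp add: U_def)
qed

lemma phi_U: "c \<noteq> 0 \<Longrightarrow> phi c \<in> U"
proof -
  assume c: "c \<noteq> 0"
  have "phi c \<notin> M"
  proof
    assume "phi c \<in> M"
    then have "phi (inverse c) * phi c \<in> M" using phi_V by (intro M_mult)
    then show False using c one_M by (simp add: is_ring_homD(4)[OF hom, symmetric] is_ring_homD(2)[OF hom])
  qed
  then show ?thesis using phi_V by (simp add: U_def)
qed

text \<open>In terms of the valuation \<open>v\<close>: if \<open>P v(g) \<le> k v(\<rho>)\<close> and \<open>m v(\<rho>) < p v(g)\<close>, then \<open>m P < p k\<close>.\<close>

lemma exponent_bound:
  assumes nz: "g \<noteq> 0" "\<rho> \<noteq> 0" and \<rho>: "\<rho> \<in> V" and 1: "\<rho> ^ k / g ^ P \<in> V" and 2: "g ^ p / \<rho> ^ m \<in> M"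
    and P: "P > 0"
  shows "m * P < p * k"
proof (rule ccontr)
  assume neg: "\<not> ?thesis"
  have "(\<rho> ^ k / g ^ P) ^ p * (g ^ p / \<rho> ^ m) ^ P \<in> M"
    using 1 2 P by (intro M_mult M_power is_subring_power[OF V_subring])
  also have "(\<rho> ^ k / g ^ P) ^ p * (g ^ p / \<rho> ^ m) ^ P = \<rho> ^ (p * k) / \<rho> ^ (m * P)"
    using nz by (simp add: power_divide power_mult[symmetric] mult.commute)
  finally have "\<rho> ^ (m * P - p * k) * (\<rho> ^ (p * k) / \<rho> ^ (m * P)) \<in> M"
    using \<rho> by (intro M_mult is_subring_power[OF V_subring])
  moreover have "\<rho> ^ (m * P - p * k) * (\<rho> ^ (p * k) / \<rho> ^ (m * P)) = 1"
    using nz neg by (simp add: power_add[symmetric])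
  ultimately have "1 \<in> M" by (simp only:)
  then show False using one_M by simp
qed

end

text \<open>A compatible total order on the value group \<open>\<Gamma> \<times> \<Gamma>'\<close> of two places, given by its set \<open>N\<close> of
  strictly positive elements (Levi's theorem that orders of torsion-free abelian groups extend
  to total orders). Elements of \<open>\<Gamma> \<times> \<Gamma>'\<close> are represented by pairs of nonzero field elements.\<close>

locale two_places = A: place phi V M + B: place phi' V' M'
  for phi :: "complex \<Rightarrow> 'k::field" and V M and phi' :: "complex \<Rightarrow> 'l::field" and V' M'
begin

definition pre_order :: "('k \<times> 'l) set \<Rightarrow> bool" where
  "pre_order N \<longleftrightarrow> (\<forall>a b. (a, b) \<in> N \<longrightarrow> a \<noteq> 0 \<and> b \<noteq> 0) \<and>
     (\<forall>a b c d. (a, b) \<in> N \<longrightarrow> (c, d) \<in> N \<longrightarrow> (a * c, b * d) \<in> N) \<and>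
     (\<forall>a b u u'. (a, b) \<in> N \<longrightarrow> u \<in> A.U \<longrightarrow> u' \<in> B.U \<longrightarrow> (u * a, u' * b) \<in> N) \<and>
     N \<inter> A.U \<times> B.U = {}"

lemma pre_orderD:
  assumes "pre_order N"
  shows "(a, b) \<in> N \<Longrightarrow> a \<noteq> 0" "(a, b) \<in> N \<Longrightarrow> b \<noteq> 0"
    "(a, b) \<in> N \<Longrightarrow> (c, d) \<in> N \<Longrightarrow> (a * c, b * d) \<in> N"
    "(a, b) \<in> N \<Longrightarrow> u \<in> A.U \<Longrightarrow> u' \<in> B.U \<Longrightarrow> (u * a, u' * b) \<in> N"
    "(a, b) \<in> N \<Longrightarrow> a \<in> A.U \<Longrightarrow> b \<in> B.U \<Longrightarrow> False"
  using assms unfolding pre_order_def by blast+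

lemma pre_order_power:
  assumes "pre_order N" "(a, b) \<in> N" "n > 0" shows "(a ^ n, b ^ n) \<in> N"
  using assms(3)
proof (induction n)
  case (Suc n)
  then show ?case using assms(2) pre_orderD(3)[OF assms(1,2), of "a ^ n" "b ^ n"] by (cases "n = 0") auto
qed simp

text \<open>The step in Levi's theorem. Let z be the class of \<open>(a, b)\<close>. The cone
  \<open>N'\<close> generated by \<open>N\<close> and z is larger than \<open>N\<close>, so by
  maximality it contains the neutral class. Either this puts a positive power of the inverse of z
  into \<open>N\<close>, or a positive power of z is neutral, which torsion-freeness
  excludes.\<close>

lemma maximal_pre_order_step:
  assumes N: "pre_order N" and max: "\<And>N'. pre_order N' \<Longrightarrow> N \<subseteq> N' \<Longrightarrow> N' = N"
    and z: "a \<noteq> 0" "b \<noteq> 0" "(a, b) \<notin> N" "\<not> (a \<in> A.U \<and> b \<in> B.U)"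
  shows "\<exists>k>0. (inverse a ^ k, inverse b ^ k) \<in> N"
proof (rule ccontr)
  assume neg: "\<not> ?thesis"
  define Q where "Q = N \<union> A.U \<times> B.U"
  have Q: "(u * v, u' * v') \<in> Q" if "(u, u') \<in> Q" "(v, v') \<in> Q" for u u' v v'
  proof -
    from that consider "(u, u') \<in> N" "(v, v') \<in> N" | "(u, u') \<in> N" "v \<in> A.U" "v' \<in> B.U"
      | "u \<in> A.U" "u' \<in> B.U" "(v, v') \<in> N" | "u \<in> A.U" "u' \<in> B.U" "v \<in> A.U" "v' \<in> B.U"
      by (auto simp: Q_def)
    then show ?thesis
    proof cases
      case 1
      then show ?thesis using pre_orderD(3)[OF N] by (simp add: Q_def)
    next
      case 2
      then have "(v * u, v' * u') \<in> N" using pre_orderD(4)[OF N] by blast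
      then show ?thesis by (simp add: Q_def mult.commute)
    next
      case 3
      then show ?thesis using pre_orderD(4)[OF N] by (simp add: Q_def)
    next
      case 4
      then show ?thesis by (simp add: Q_def A.U_mult B.U_mult)
    qed
  qed
  have Qnz: "u \<noteq> 0 \<and> u' \<noteq> 0" if "(u, u') \<in> Q" for u u'
    using that pre_orderD(1,2)[OF N, of u u'] A.U_nonzero[of u] B.U_nonzero[of u'] by (auto simp: Q_def)
  define N' where "N' = N \<union> {(u * a ^ k, u' * b ^ k) |u u' k. k > 0 \<and> (u, u') \<in> Q}"
  have QN: "(u * v, u' * v') \<in> N" if "(u, u') \<in> Q" "(v, v') \<in> N" for u u' v v'
    using that pre_orderD(3,4)[OF N] by (auto simp: Q_def)
  have N'Q: "\<exists>k u u'. x = u * a ^ k \<and> y = u' * b ^ k \<and> (u, u') \<in> Q \<and> (k > 0 \<or> (u, u') \<in> N)"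
    if "(x, y) \<in> N'" for x y
  proof (cases "(x, y) \<in> N")
    case True
    then show ?thesis by (intro exI[of _ 0] exI[of _ x] exI[of _ y]) (auto simp: Q_def)
  next
    case False
    then show ?thesis using that by (auto simp: N'_def)
  qed
  have QN': "(u * a ^ k, u' * b ^ k) \<in> N'" if "(u, u') \<in> Q" "k > 0 \<or> (u, u') \<in> N" for u u' k
  proof (cases "k > 0")
    case True
    then show ?thesis using that(1) unfolding N'_def by blast
  next
    case False
    then show ?thesis using that by (simp add: N'_def)
  qed
  have UU: "x \<in> A.U \<and> y \<in> B.U \<Longrightarrow> False" if xy: "(x, y) \<in> N'" for x y
  proof -
    assume U: "x \<in> A.U \<and> y \<in> B.U"
    obtain k u u' where h: "x = u * a ^ k" "y = u' * b ^ k" "(u, u') \<in> Q" "k > 0 \<or> (u, u') \<in> N"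
      using N'Q[OF xy] by blast
    show False
    proof (cases "k > 0")
      case False
      then show ?thesis using h U pre_orderD(5)[OF N] by auto
    next
      case k: True
      show ?thesis
      proof (cases "(u, u') \<in> N")
        case True
        have "inverse a ^ k = inverse x * u" "inverse b ^ k = inverse y * u'"
          using h z Qnz[OF h(3)] by (simp_all add: power_inverse)
        moreover have "(inverse x * u, inverse y * u') \<in> N"
          using pre_orderD(4)[OF N True] U A.U_inverse B.U_inverse by blast
        ultimately have "(inverse a ^ k, inverse b ^ k) \<in> N" by simp
        then show False using neg k by blast
      next
        case False
        then have uU: "u \<in> A.U" "u' \<in> B.U" using h(3) by (auto simp: Q_def)
        have "a ^ k = inverse u * x" "b ^ k = inverse u' * y"
          using h Qnz[OF h(3)] by simp_all
        then have "a ^ k \<in> A.U" "b ^ k \<in> B.U"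
          using U uU A.U_inverse A.U_mult B.U_inverse B.U_mult by auto
        then show False using z(4) A.U_power_D[OF _ k] B.U_power_D[OF _ k] by blast
      qed
    qed
  qed
  have "pre_order N'"
    unfolding pre_order_def
  proof (intro conjI allI impI)
    fix x y assume "(x, y) \<in> N'"
    from N'Q[OF this] Qnz z(1,2) show "x \<noteq> 0" "y \<noteq> 0" by auto
  next
    fix x y x' y' assume "(x, y) \<in> N'" "(x', y') \<in> N'"
    then obtain k u u' l v v' where h: "x = u * a ^ k" "y = u' * b ^ k" "(u, u') \<in> Q" "k > 0 \<or> (u, u') \<in> N"
      "x' = v * a ^ l" "y' = v' * b ^ l" "(v, v') \<in> Q" "l > 0 \<or> (v, v') \<in> N"
      using N'Q by meson
    have "k + l > 0 \<or> (u * v, u' * v') \<in> N" using h QN by auto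
    from QN'[OF Q[OF h(3,7)] this] show "(x * x', y * y') \<in> N'"
      by (simp add: h power_add ac_simps)
  next
    fix x y v v' assume "(x, y) \<in> N'" and v: "v \<in> A.U" "v' \<in> B.U"
    then obtain k u u' where h: "x = u * a ^ k" "y = u' * b ^ k" "(u, u') \<in> Q" "k > 0 \<or> (u, u') \<in> N"
      using N'Q by meson
    have vQ: "(v, v') \<in> Q" using v by (simp add: Q_def)
    have "k > 0 \<or> (v * u, v' * u') \<in> N" using h(4) QN[OF vQ] by auto
    from QN'[OF Q[OF vQ h(3)] this] show "(v * x, v' * y) \<in> N'"
      by (simp add: h ac_simps)
  next
    show "N' \<inter> A.U \<times> B.U = {}" using UU by auto
  qed
  then have "N' = N" by (rule max) (auto simp: N'_def)
  moreover have "(1 * a ^ 1, 1 * b ^ 1) \<in> N'"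
    by (rule QN') (auto simp: Q_def A.U_one B.U_one)
  ultimately show False using z(3) by simp
qed

lemma ex_total_order:
  assumes N0: "pre_order N0"
  obtains N where "N0 \<subseteq> N" "pre_order N"
    "\<And>a b. a \<noteq> 0 \<Longrightarrow> b \<noteq> 0 \<Longrightarrow> (a, b) \<in> N \<or> (inverse a, inverse b) \<in> N \<or> (a \<in> A.U \<and> b \<in> B.U)"
proof -
  define F where "F = {N. N0 \<subseteq> N \<and> pre_order N}"
  have "\<exists>M\<in>F. \<forall>X\<in>F. M \<subseteq> X \<longrightarrow> X = M"
  proof (rule subset_Zorn_nonempty)
    show "F \<noteq> {}" using N0 by (auto simp: F_def)
    fix C assume C: "C \<noteq> {}" "subset.chain F C"
    then have CF: "\<And>X. X \<in> C \<Longrightarrow> N0 \<subseteq> X \<and> pre_order X"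
      by (auto simp: subset.chain_def F_def)
    have lin: "X \<subseteq> Y \<or> Y \<subseteq> X" if "X \<in> C" "Y \<in> C" for X Y
      using C(2) that unfolding subset.chain_def by blast
    obtain X0 where X0: "X0 \<in> C" using C(1) by blast
    have "pre_order (\<Union>C)"
      unfolding pre_order_def
    proof (intro conjI allI impI)
      fix a b assume "(a, b) \<in> \<Union>C"
      then obtain X where "X \<in> C" "(a, b) \<in> X" by auto
      then show "a \<noteq> 0" "b \<noteq> 0" using CF pre_orderD(1,2) by blast+
    next
      fix a b c d assume "(a, b) \<in> \<Union>C" "(c, d) \<in> \<Union>C"
      then obtain X Y where XY: "X \<in> C" "Y \<in> C" "(a, b) \<in> X" "(c, d) \<in> Y" by auto
      then obtain Z where Z: "Z \<in> C" "(a, b) \<in> Z" "(c, d) \<in> Z" using lin[OF XY(1,2)] by blast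
      then have "(a * c, b * d) \<in> Z" using CF[OF Z(1)] pre_orderD(3) by blast
      then show "(a * c, b * d) \<in> \<Union>C" using Z(1) by auto
    next
      fix a b u u' assume "(a, b) \<in> \<Union>C" and u: "u \<in> A.U" "u' \<in> B.U"
      then obtain X where X: "X \<in> C" "(a, b) \<in> X" by auto
      then have "(u * a, u' * b) \<in> X" using CF[OF X(1)] u pre_orderD(4) by blast
      then show "(u * a, u' * b) \<in> \<Union>C" using X(1) by auto
    next
      show "\<Union>C \<inter> A.U \<times> B.U = {}" using CF pre_orderD(5) by blast
    qed
    moreover have "N0 \<subseteq> \<Union>C" using CF[OF X0] X0 by auto
    ultimately show "\<Union>C \<in> F" by (simp add: F_def)
  qed
  then obtain N where N: "N \<in> F" and mx: "\<And>X. X \<in> F \<Longrightarrow> N \<subseteq> X \<Longrightarrow> X = N" by blast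
  have po: "pre_order N" and N0N: "N0 \<subseteq> N" using N by (auto simp: F_def)
  have max: "N' = N" if "pre_order N'" "N \<subseteq> N'" for N'
    using mx[OF _ that(2)] that N0N by (auto simp: F_def)
  show ?thesis
  proof (rule that[OF N0N po], rule ccontr)
    fix a b assume ab: "a \<noteq> 0" "b \<noteq> 0"
      and neg: "\<not> ((a, b) \<in> N \<or> (inverse a, inverse b) \<in> N \<or> (a \<in> A.U \<and> b \<in> B.U))"
    have "\<not> (inverse a \<in> A.U \<and> inverse b \<in> B.U)"
      using neg A.U_inverse[of "inverse a"] B.U_inverse[of "inverse b"] by auto
    \<comment> \<open>Were neither the class nor its inverse positive, the step applied to both
      would make a power of each positive, and suitable powers of these multiply to
      \<open>1\<close>.\<close>
    then obtain k where k: "k > 0" "(a ^ k, b ^ k) \<in> N"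
      using maximal_pre_order_step[OF po max, of "inverse a" "inverse b"] ab neg by auto
    obtain l where l: "l > 0" "(inverse a ^ l, inverse b ^ l) \<in> N"
      using maximal_pre_order_step[OF po max, of a b] ab neg by auto
    have "((a ^ k) ^ l * (inverse a ^ l) ^ k, (b ^ k) ^ l * (inverse b ^ l) ^ k) \<in> N"
      by (intro pre_orderD(3)[OF po] pre_order_power[OF po] k l)
    moreover have "(a ^ k) ^ l * (inverse a ^ l) ^ k = 1" "(b ^ k) ^ l * (inverse b ^ l) ^ k = 1"
      using ab by (simp_all add: power_mult[symmetric] mult.commute[of l k] power_mult_distrib[symmetric])
    ultimately show False using pre_orderD(5)[OF po] A.U_one B.U_one by metis
  qed
qed

end

section \<open>Leading terms\<close>

locale alg_place = alg: C_algebra phi + pl: place "\<lambda>c. to_fract (phi c)" V M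
  for phi :: "complex \<Rightarrow> 'r::idom" and V M +
  assumes R_V: "to_fract r \<in> V"
begin

text \<open>The elements of value greater than v(r), together with \<open>0\<close>. A functional
  that vanishes on this subspace detects only elements of value at most v(r).\<close>

definition above :: "'r \<Rightarrow> 'r set" where
  "above r = {x. to_fract x / to_fract r \<in> M}"

lemma subspace_above: "alg.vs.subspace (above r)"
  unfolding alg.vs.subspace_def above_def
  using pl.zero_M pl.M_add pl.M_mult[OF R_V] 
  by (auto simp: add_divide_distrib times_divide_eq_right[symmetric] simp del: times_divide_eq_right)

lemma not_above: "r \<noteq> 0 \<Longrightarrow> r \<notin> above r"
  using pl.one_M by (simp add: above_def)

lemma notin_above: "x \<notin> above r \<Longrightarrow> to_fract r / to_fract x \<in> V"
  using pl.inverse_notin_M[of "to_fract x / to_fract r"] by (simp add: above_def)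

text \<open>Subtracting suitable multiples of elements of \<open>E\<close> with the same value raises the value, until
  it differs from the values of all elements of \<open>E\<close>.\<close>

lemma ex_reduced:
  assumes "finite E" "0 \<notin> E"
  shows "\<exists>x'. x - x' \<in> alg.vs.span E \<and> (x' = 0 \<or> (\<forall>e\<in>E. to_fract x' / to_fract e \<notin> pl.U))"
proof (induction "card {e \<in> E. to_fract e / to_fract x \<in> V}" arbitrary: x rule: less_induct)
  case less
  show ?case
  proof (cases "x = 0 \<or> (\<forall>e\<in>E. to_fract x / to_fract e \<notin> pl.U)")
    case True
    then show ?thesis by (intro exI[of _ x]) (auto simp: alg.vs.span_zero)
  next
    case False
    then obtain e where x0: "x \<noteq> 0" and e: "e \<in> E" "to_fract x / to_fract e \<in> pl.U" by blast
    have e0: "e \<noteq> 0" using e assms by auto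
    obtain c where c: "to_fract x / to_fract e - to_fract (phi c) \<in> M"
      using pl.residue[of "to_fract x / to_fract e"] e(2) by (auto simp: pl.U_def)
    define y where "y = x - phi c * e"
    have y: "to_fract y / to_fract e \<in> M" using c e0 by (simp add: y_def diff_divide_distrib)
    have xy: "x - y \<in> alg.vs.span E"
      unfolding y_def using alg.vs.span_scale[OF alg.vs.span_base[OF e(1)]] by simp
    show ?thesis
    proof (cases "y = 0")
      case True
      then show ?thesis using xy by (intro exI[of _ 0]) auto
    next
      case y0: False
      have ex: "to_fract e / to_fract x \<in> V"
        using pl.U_inverse[OF e(2)] by (simp add: pl.U_def)
      \<comment> \<open>The induction counts the members of \<open>E\<close> with value at least
        that of the current element. Since \<open>y\<close> has larger value than \<open>e\<close>,
        which has the value of \<open>x\<close>, the count loses \<open>e\<close> and gains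
        nothing.\<close>
      have "{d \<in> E. to_fract d / to_fract y \<in> V} \<subset> {d \<in> E. to_fract d / to_fract x \<in> V}"
      proof
        show "{d \<in> E. to_fract d / to_fract y \<in> V} \<subseteq> {d \<in> E. to_fract d / to_fract x \<in> V}"
        proof safe
          fix d assume "to_fract d / to_fract y \<in> V"
          then have "to_fract d / to_fract y * (to_fract y / to_fract e * (to_fract e / to_fract x)) \<in> V"
            using pl.M_in_V[OF y] ex by (intro pl.V_simps)
          then show "to_fract d / to_fract x \<in> V" using y0 e0 by simp
        qed
        have "to_fract e / to_fract y \<notin> V"
        proof
          assume "to_fract e / to_fract y \<in> V"
          then have "to_fract e / to_fract y * (to_fract y / to_fract e) \<in> M" using y by (rule pl.M_mult)
          then show False using y0 e0 pl.one_M by simp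
        qed
        then show "{d \<in> E. to_fract d / to_fract y \<in> V} \<noteq> {d \<in> E. to_fract d / to_fract x \<in> V}"
          using e(1) ex by blast
      qed
      then have "card {d \<in> E. to_fract d / to_fract y \<in> V} < card {d \<in> E. to_fract d / to_fract x \<in> V}"
        using assms(1) by (intro psubset_card_mono) auto
      from less[OF this] obtain x' where x': "y - x' \<in> alg.vs.span E"
        "x' = 0 \<or> (\<forall>e\<in>E. to_fract x' / to_fract e \<notin> pl.U)" by blast
      have "x - x' = (x - y) + (y - x')" by simp
      then have "x - x' \<in> alg.vs.span E" using alg.vs.span_add[OF xy x'(1)] by simp
      then show ?thesis using x'(2) by blast
    qed
  qed
qed

text \<open>Built in the manner of Gram and Schmidt, with \<open>ex_reduced\<close> in the role of
  the projection. Pairwise distinct values are what makes the minimal pair in \<open>ex_lead\<close>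
  unique.\<close>

lemma ex_orthogonal:
  assumes "finite X"
  shows "\<exists>E. finite E \<and> 0 \<notin> E \<and> X \<subseteq> alg.vs.span E \<and>
    (\<forall>e\<in>E. \<forall>e'\<in>E. to_fract e / to_fract e' \<in> pl.U \<longrightarrow> e = e')"
  using assms
proof (induction X rule: finite_induct)
  case empty
  then show ?case by (intro exI[of _ "{}"]) auto
next
  case (insert x X)
  then obtain E where E: "finite E" "0 \<notin> E" "X \<subseteq> alg.vs.span E"
    "\<And>e e'. e \<in> E \<Longrightarrow> e' \<in> E \<Longrightarrow> to_fract e / to_fract e' \<in> pl.U \<Longrightarrow> e = e'" by blast
  obtain x' where x': "x - x' \<in> alg.vs.span E" "x' = 0 \<or> (\<forall>e\<in>E. to_fract x' / to_fract e \<notin> pl.U)"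
    using ex_reduced[OF E(1,2), of x] by blast
  show ?case
  proof (cases "x' = 0")
    case True
    then show ?thesis using E x'(1) by (intro exI[of _ E]) auto
  next
    case False
    then have 1: "to_fract x' / to_fract e \<notin> pl.U" if "e \<in> E" for e using x'(2) that by blast
    have 2: "to_fract e / to_fract x' \<notin> pl.U" if "e \<in> E" for e
      using 1[OF that] pl.U_inverse[of "to_fract e / to_fract x'"] by auto
    have sub: "alg.vs.span E \<subseteq> alg.vs.span (insert x' E)" by (rule alg.vs.span_mono) auto
    have "x = (x - x') + x'" by simp
    moreover have "(x - x') + x' \<in> alg.vs.span (insert x' E)"
      by (rule alg.vs.span_add[OF subsetD[OF sub x'(1)] alg.vs.span_base]) simp
    ultimately have "x \<in> alg.vs.span (insert x' E)" by simp
    then show ?thesis using E False sub 1 2 by (intro exI[of _ "insert x' E"]) auto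
  qed
qed

end

section \<open>Spans of pure tensors\<close>

locale tensor_places = tensor phiR phiS phiT iR iS + A: alg_place phiR V M + B: alg_place phiS V' M'
  for phiR :: "complex \<Rightarrow> 'r::idom" and phiS :: "complex \<Rightarrow> 's::idom"
    and phiT :: "complex \<Rightarrow> 't::comm_ring_1" and iR iS V M V' M'
begin

sublocale tw: two_places "\<lambda>c. to_fract (phiR c)" V M "\<lambda>c. to_fract (phiS c)" V' M' ..

text \<open>Sums are enough, because scalars move into \<open>r\<close> and the predicates in use
  are stable under nonzero scalars. Estimates on \<open>T\<close> thus reduce to pure tensors
  without fixing a representation.\<close>

inductive_set tsp :: "('r \<Rightarrow> 's \<Rightarrow> bool) \<Rightarrow> 't set" for Q where
  tsp_0: "0 \<in> tsp Q"
| tsp_step: "Q r s \<Longrightarrow> y \<in> tsp Q \<Longrightarrow> iR r * iS s + y \<in> tsp Q"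

lemma tsp_single: "Q r s \<Longrightarrow> iR r * iS s \<in> tsp Q"
  using tsp_step[OF _ tsp_0] by fastforce

lemma tsp_add: "x \<in> tsp Q \<Longrightarrow> y \<in> tsp Q \<Longrightarrow> x + y \<in> tsp Q"
  by (induction rule: tsp.induct) (auto simp: add.assoc intro: tsp_step)

lemma tsp_sum: "(\<And>i. i \<in> X \<Longrightarrow> f i \<in> tsp Q) \<Longrightarrow> sum f X \<in> tsp Q"
  by (induction X rule: infinite_finite_induct) (auto intro: tsp_0 tsp_add)

lemma tsp_mono:
  assumes "x \<in> tsp Q" "\<And>r s. Q r s \<Longrightarrow> Q' r s" shows "x \<in> tsp Q'"
  using assms(1) by (induction rule: tsp.induct) (auto intro: tsp_0 tsp_step assms(2))

lemma tsp_nonzero: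
  assumes "x \<in> tsp Q" shows "x \<in> tsp (\<lambda>r s. Q r s \<and> r \<noteq> 0 \<and> s \<noteq> 0)"
  using assms
proof (induction rule: tsp.induct)
  case (tsp_step r s y)
  then show ?case
    by (cases "r = 0 \<or> s = 0") (auto simp: iR_simps iS_simps intro: tsp.tsp_step)
qed (rule tsp_0)

lemma tsp_mult:
  assumes "x \<in> tsp Q" "y \<in> tsp Q'"
    and QQ: "\<And>r s r' s'. Q r s \<Longrightarrow> Q' r' s' \<Longrightarrow> Q'' (r * r') (s * s')"
  shows "x * y \<in> tsp Q''"
  using assms(1)
proof (induction rule: tsp.induct)
  case (tsp_step r s x)
  have "iR r * iS s * y \<in> tsp Q''"
    using assms(2)
  proof (induction rule: tsp.induct)
    case (tsp_step r' s' y)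
    have "iR r * iS s * (iR r' * iS s' + y) = iR (r * r') * iS (s * s') + iR r * iS s * y"
      by (simp add: iR_simps iS_simps algebra_simps)
    then show ?case using tsp.tsp_step[OF QQ[OF \<open>Q r s\<close> tsp_step(1)] tsp_step(3)] by simp
  qed (simp add: tsp_0)
  then show ?case using tsp_add tsp_step(3) by (simp add: distrib_right)
qed (simp add: tsp_0)

lemma tsp_True: "t \<in> tsp (\<lambda>_ _. True)"
proof -
  obtain xs where "t = tsum xs" using ex_tsum by blast
  moreover have "tsum xs \<in> tsp (\<lambda>_ _. True)"
    by (induction xs) (auto intro: tsp_0 tsp_step)
  ultimately show ?thesis by simp
qed

lemma tsp_tsum: "x \<in> tsp Q \<Longrightarrow> \<exists>xs. x = tsum xs \<and> (\<forall>(r, s)\<in>set xs. Q r s)"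
proof (induction rule: tsp.induct)
  case tsp_0
  then show ?case by (intro exI[of _ "[]"]) auto
next
  case (tsp_step r s y)
  then obtain xs where "y = tsum xs" "\<forall>(r, s)\<in>set xs. Q r s" by blast
  then show ?case using tsp_step(1) by (intro exI[of _ "(r, s) # xs"]) auto
qed

lemma is_ideal_tsp:
  assumes "\<And>r s r' s'. Q r s \<Longrightarrow> Q (r' * r) (s' * s)"
  shows "is_ideal (tsp Q)"
  unfolding is_ideal_def
  by (auto intro: tsp_0 tsp_add tsp_mult[OF tsp_True] assms)

text \<open>The binomial expansion of the power of a sum, in the direction that bounds values from
  below.\<close>

lemma ideal_pow_tsp:
  assumes "is_ideal I" "is_ideal J"
  shows "ideal_pow (ideal_add (extension iR I) (extension iS J)) n
    \<subseteq> tsp (\<lambda>x y. \<exists>a b. x \<in> ideal_pow I a \<and> y \<in> ideal_pow J b \<and> a + b = n)"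
proof (rule ideal_pow_subset)
  let ?D = "\<lambda>n. tsp (\<lambda>x y. \<exists>a b. x \<in> ideal_pow I a \<and> y \<in> ideal_pow J b \<and> a + b = n)"
  show "is_ideal (?D n)" for n
  proof (rule is_ideal_tsp)
    fix r s r' s' assume "\<exists>a b. r \<in> ideal_pow I a \<and> s \<in> ideal_pow J b \<and> a + b = n"
    then obtain a b where "r \<in> ideal_pow I a" "s \<in> ideal_pow J b" "a + b = n" by blast
    then show "\<exists>a b. r' * r \<in> ideal_pow I a \<and> s' * s \<in> ideal_pow J b \<and> a + b = n"
      by (intro exI[of _ a] exI[of _ b]) (simp add: is_idealD(3)[OF is_ideal_ideal_pow])
  qed
  have "iR 1 * iS 1 \<in> ?D 0" by (rule tsp_single) (auto intro!: exI[of _ 0])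
  then show "1 \<in> ?D 0" by (simp add: iR_simps iS_simps)
  fix x y n assume x: "x \<in> ?D n" and y: "y \<in> ideal_add (extension iR I) (extension iS J)"
  let ?C = "tsp (\<lambda>x y. x \<in> I \<or> y \<in> J)"
  have C: "is_ideal ?C"
    by (rule is_ideal_tsp) (auto simp: is_idealD(3)[OF assms(1)] is_idealD(3)[OF assms(2)])
  have "iR r \<in> ?C" if "r \<in> I" for r
    using tsp_single[of "\<lambda>x y. x \<in> I \<or> y \<in> J" r 1] that by (simp add: iS_simps)
  moreover have "iS s \<in> ?C" if "s \<in> J" for s
    using tsp_single[of "\<lambda>x y. x \<in> I \<or> y \<in> J" 1 s] that by (simp add: iR_simps)
  ultimately have "iR ` I \<subseteq> ?C" "iS ` J \<subseteq> ?C" by auto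
  then have "extension iR I \<subseteq> ?C" "extension iS J \<subseteq> ?C"
    unfolding extension_def by (simp_all add: ideal_gen_least[OF C])
  then have "y \<in> ?C" using y ideal_add_least[OF C] by blast
  then show "x * y \<in> ?D (Suc n)"
  proof (rule tsp_mult[OF x])
    fix r s r' s' assume "\<exists>a b. r \<in> ideal_pow I a \<and> s \<in> ideal_pow J b \<and> a + b = n" "r' \<in> I \<or> s' \<in> J"
    then obtain a b where h: "r \<in> ideal_pow I a" "s \<in> ideal_pow J b" "a + b = n" "r' \<in> I \<or> s' \<in> J" by blast
    show "\<exists>a b. r * r' \<in> ideal_pow I a \<and> s * s' \<in> ideal_pow J b \<and> a + b = Suc n"
    proof (cases "r' \<in> I")
      case True
      then have "r * r' \<in> ideal_pow I (Suc a)" using h by (simp add: ideal_multI)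
      moreover have "s * s' \<in> ideal_pow J b" by (rule is_idealD(4)[OF is_ideal_ideal_pow h(2)])
      ultimately show ?thesis using h(3) by (metis add_Suc)
    next
      case False
      then have "s * s' \<in> ideal_pow J (Suc b)" using h by (simp add: ideal_multI)
      moreover have "r * r' \<in> ideal_pow I a" by (rule is_idealD(4)[OF is_ideal_ideal_pow h(1)])
      ultimately show ?thesis using h(3) by (metis add_Suc_right)
    qed
  qed
qed

end

section \<open>The filtration of \<open>T\<close> by an ordered pair of values\<close>

text \<open>\<open>N\<close> is the strictly positive cone of a total order on the product of the
  value groups; \<open>positive\<close> says that this order refines the componentwise one.\<close>

locale ordered_tensor = tensor_places +
  fixes N
  assumes po: "tw.pre_order N"
    and total: "a \<noteq> 0 \<Longrightarrow> b \<noteq> 0 \<Longrightarrow>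
      (a, b) \<in> N \<or> (inverse a, inverse b) \<in> N \<or> (a \<in> A.pl.U \<and> b \<in> B.pl.U)"
    and positive: "a \<in> V \<Longrightarrow> b \<in> V' \<Longrightarrow> a \<noteq> 0 \<Longrightarrow> b \<noteq> 0 \<Longrightarrow>
      \<not> (a \<in> A.pl.U \<and> b \<in> B.pl.U) \<Longrightarrow> (a, b) \<in> N"
begin

lemmas poD = tw.pre_orderD[OF po]

definition NU where "NU = N \<union> A.pl.U \<times> B.pl.U"

lemma N_NU: "z \<in> N \<Longrightarrow> z \<in> NU"
  by (simp add: NU_def)

lemma NU_mult_N: "(a, b) \<in> NU \<Longrightarrow> (c, d) \<in> N \<Longrightarrow> (a * c, b * d) \<in> N"
  using poD(3,4) by (auto simp: NU_def)

lemma N_mult_NU: "(a, b) \<in> N \<Longrightarrow> (c, d) \<in> NU \<Longrightarrow> (a * c, b * d) \<in> N"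
  using NU_mult_N[of c d a b] by (simp add: mult.commute)

lemma NU_mult: "(a, b) \<in> NU \<Longrightarrow> (c, d) \<in> NU \<Longrightarrow> (a * c, b * d) \<in> NU"
  using NU_mult_N[of a b c d] N_mult_NU[of a b c d] A.pl.U_mult[of a c] B.pl.U_mult[of b d]
  by (auto simp: NU_def)

lemma NU_one: "(1, 1) \<in> NU"
  using A.pl.U_one B.pl.U_one by (simp add: NU_def)

lemma NU_power: "(a, b) \<in> NU \<Longrightarrow> (a ^ n, b ^ n) \<in> NU"
  by (induction n) (auto simp: NU_one NU_mult)

lemma N_one: "(1, 1) \<notin> N"
  using poD(5) A.pl.U_one B.pl.U_one by blast

lemma V_NU: "a \<in> V \<Longrightarrow> b \<in> V' \<Longrightarrow> a \<noteq> 0 \<Longrightarrow> b \<noteq> 0 \<Longrightarrow> (a, b) \<in> NU"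
  using positive by (auto simp: NU_def)

lemma N_root:
  assumes "(a ^ k, b ^ k) \<in> N" "k > 0" shows "(a, b) \<in> N"
proof -
  have nz: "a \<noteq> 0" "b \<noteq> 0"
    using poD(1,2)[OF assms(1)] assms(2) by (auto simp: power_0_left)
  have "\<not> ((inverse a, inverse b) \<in> N \<or> (a \<in> A.pl.U \<and> b \<in> B.pl.U))"
  proof
    assume "(inverse a, inverse b) \<in> N \<or> (a \<in> A.pl.U \<and> b \<in> B.pl.U)"
    then have "(inverse a, inverse b) \<in> NU"
      using A.pl.U_inverse[of a] B.pl.U_inverse[of b] by (auto simp: NU_def)
    then have "(inverse a ^ k * a ^ k, inverse b ^ k * b ^ k) \<in> N"
      using NU_mult_N[OF NU_power assms(1)] by blast
    then show False using nz N_one by (simp add: power_mult_distrib[symmetric])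
  qed
  then show ?thesis using total[OF nz] by blast
qed

text \<open>The part of \<open>T\<close> strictly beyond the value of the pure tensor of \<rho> and
  \<sigma>. It only asks for some representation by large tensors; that no cancellation brings the
  tensor itself into it is \<open>lead_plus_gt_nonzero\<close>.\<close>

definition gt where
  "gt \<rho> \<sigma> = tsp (\<lambda>r s. r \<noteq> 0 \<and> s \<noteq> 0 \<and> (to_fract r / to_fract \<rho>, to_fract s / to_fract \<sigma>) \<in> N)"

definition ge where
  "ge \<rho> \<sigma> = tsp (\<lambda>r s. r \<noteq> 0 \<and> s \<noteq> 0 \<and> (to_fract r / to_fract \<rho>, to_fract s / to_fract \<sigma>) \<in> NU)"

lemma gt_ge: "x \<in> gt \<rho> \<sigma> \<Longrightarrow> x \<in> ge \<rho> \<sigma>"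
  unfolding gt_def ge_def by (erule tsp_mono) (auto simp: N_NU)

lemma gt_add: "x \<in> gt \<rho> \<sigma> \<Longrightarrow> y \<in> gt \<rho> \<sigma> \<Longrightarrow> x + y \<in> gt \<rho> \<sigma>"
  unfolding gt_def by (rule tsp_add)

lemma gt_sum: "(\<And>i. i \<in> X \<Longrightarrow> f i \<in> gt \<rho> \<sigma>) \<Longrightarrow> sum f X \<in> gt \<rho> \<sigma>"
  unfolding gt_def by (rule tsp_sum)

lemma ge_mult_gt: "x \<in> ge \<rho> \<sigma> \<Longrightarrow> y \<in> gt \<rho>' \<sigma>' \<Longrightarrow> x * y \<in> gt (\<rho> * \<rho>') (\<sigma> * \<sigma>')"
  unfolding gt_def ge_def by (erule tsp_mult, assumption) (auto dest: NU_mult_N)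

lemma gt_mult_ge: "x \<in> gt \<rho> \<sigma> \<Longrightarrow> y \<in> ge \<rho>' \<sigma>' \<Longrightarrow> x * y \<in> gt (\<rho> * \<rho>') (\<sigma> * \<sigma>')"
  using ge_mult_gt[of y \<rho>' \<sigma>' x \<rho> \<sigma>] by (simp add: mult.commute)

lemma lead_ge: "\<rho> \<noteq> 0 \<Longrightarrow> \<sigma> \<noteq> 0 \<Longrightarrow> iR \<rho> * iS \<sigma> \<in> ge \<rho> \<sigma>"
  unfolding ge_def by (rule tsp_single) (simp add: NU_one)

text \<open>Choose \<open>l\<close> and \<open>l'\<close> with value \<open>1\<close> at \<rho> and
  \<sigma> that vanish on all elements of larger value. A tensor beyond the leading one must exceed
  it in at least one component, because \<open>N\<close> refines the componentwise order, so
  \<open>l \<otimes> l'\<close> kills it. The whole sum then has value \<open>1\<close>.\<close>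

lemma lead_plus_gt_nonzero:
  assumes nz: "\<rho> \<noteq> 0" "\<sigma> \<noteq> 0" and g: "g \<in> gt \<rho> \<sigma>"
  shows "iR \<rho> * iS \<sigma> + g \<noteq> 0"
proof
  assume eq: "iR \<rho> * iS \<sigma> + g = 0"
  obtain xs where xs: "g = tsum xs"
    and gt: "\<And>r s. (r, s) \<in> set xs \<Longrightarrow> r \<noteq> 0 \<and> s \<noteq> 0 \<and>
      (to_fract r / to_fract \<rho>, to_fract s / to_fract \<sigma>) \<in> N"
    using tsp_tsum[OF g[unfolded gt_def]] by auto
  obtain l where l: "R.linear_functional l" "\<And>w. w \<in> A.above \<rho> \<Longrightarrow> l w = 0" "l \<rho> = 1"
    using R.ex_separating_functional[OF A.subspace_above A.not_above[OF nz(1)]] by metis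
  obtain l' where l': "S.linear_functional l'" "\<And>w. w \<in> B.above \<sigma> \<Longrightarrow> l' w = 0" "l' \<sigma> = 1"
    using S.ex_separating_functional[OF B.subspace_above B.not_above[OF nz(2)]] by metis
  have z: "l r * l' s = 0" if rs: "(r, s) \<in> set xs" for r s
  proof (rule ccontr)
    assume "l r * l' s \<noteq> 0"
    then have "r \<notin> A.above \<rho>" "s \<notin> B.above \<sigma>" using l(2) l'(2) by auto
    then have "to_fract \<rho> / to_fract r \<in> V" "to_fract \<sigma> / to_fract s \<in> V'"
      by (auto intro: A.notin_above B.notin_above)
    then have "(to_fract \<rho> / to_fract r, to_fract \<sigma> / to_fract s) \<in> NU"
      using gt[OF rs] nz by (intro V_NU) auto
    then have "(to_fract \<rho> / to_fract r * (to_fract r / to_fract \<rho>),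
        to_fract \<sigma> / to_fract s * (to_fract s / to_fract \<sigma>)) \<in> N"
      using gt[OF rs] by (intro NU_mult_N) auto
    then show False using gt[OF rs] nz N_one by simp
  qed
  have "bval l l' zs = 0" if "set zs \<subseteq> set xs" for zs
    using that by (induction zs) (auto simp: z)
  then have "bval l l' ((\<rho>, \<sigma>) # xs) = 1" using l(3) l'(3) by simp
  moreover have "bval l l' ((\<rho>, \<sigma>) # xs) = 0"
    by (rule bval_eq_0[OF _ l(1) l'(1)]) (use eq xs in simp)
  ultimately show False by simp
qed

lemma lead_power:
  assumes nz: "\<rho> \<noteq> 0" "\<sigma> \<noteq> 0" and g: "g \<in> gt \<rho> \<sigma>"
  shows "\<exists>g'\<in>gt (\<rho> ^ m) (\<sigma> ^ m). (iR \<rho> * iS \<sigma> + g) ^ m = iR (\<rho> ^ m) * iS (\<sigma> ^ m) + g'"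
proof (induction m)
  case 0
  show ?case by (intro bexI[of _ 0]) (auto simp: iR_simps iS_simps gt_def tsp_0)
next
  case (Suc m)
  let ?h = "iR \<rho> * iS \<sigma>" and ?h' = "iR (\<rho> ^ m) * iS (\<sigma> ^ m)"
  from Suc obtain g' where g': "g' \<in> gt (\<rho> ^ m) (\<sigma> ^ m)" "(?h + g) ^ m = ?h' + g'" by blast
  have h: "?h \<in> ge \<rho> \<sigma>" by (rule lead_ge[OF nz])
  have h': "?h' \<in> ge (\<rho> ^ m) (\<sigma> ^ m)" by (rule lead_ge) (use nz in auto)
  have "(?h + g) ^ Suc m = (?h + g) * (?h' + g')" by (simp only: power_Suc g'(2))
  also have "\<dots> = ?h * ?h' + (?h * g' + (g * ?h' + g * g'))" by (simp add: algebra_simps)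
  also have "?h * ?h' = iR (\<rho> ^ Suc m) * iS (\<sigma> ^ Suc m)" by (simp add: iR_simps iS_simps ac_simps)
  finally have "(?h + g) ^ Suc m = iR (\<rho> ^ Suc m) * iS (\<sigma> ^ Suc m) + (?h * g' + (g * ?h' + g * g'))" .
  moreover have "?h * g' + (g * ?h' + g * g') \<in> gt (\<rho> * \<rho> ^ m) (\<sigma> * \<sigma> ^ m)"
    by (intro gt_add ge_mult_gt[OF h g'(1)] gt_mult_ge[OF g h'] gt_mult_ge[OF g gt_ge[OF g'(1)]])
  ultimately show ?case by (intro bexI[of _ "?h * g' + (g * ?h' + g * g')"]) simp_all
qed

text \<open>In an equation of degree \<open>n\<close> for \<open>t ^ q\<close>, the leading term of
  \<open>t ^ (q * n)\<close> is that of \<open>t\<close> raised to \<open>q * n\<close>. By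
  \<open>IJ\<close> and \<open>r0\<close> every other summand lies strictly beyond it, so the
  equation contradicts \<open>lead_plus_gt_nonzero\<close>.\<close>

lemma not_integral:
  assumes I: "is_ideal I" and J: "is_ideal J"
    and nz: "\<rho> \<noteq> 0" "\<sigma> \<noteq> 0" "r0 \<noteq> 0" "s0 \<noteq> 0"
    and g: "g \<in> gt \<rho> \<sigma>"
    and r0: "(to_fract r0 / to_fract \<rho>, to_fract s0 / to_fract \<sigma>) \<in> NU"
    and IJ: "\<And>x y a b i. x \<in> ideal_pow I a \<Longrightarrow> y \<in> ideal_pow J b \<Longrightarrow> x \<noteq> 0 \<Longrightarrow> y \<noteq> 0 \<Longrightarrow>
      a + b = P * i \<Longrightarrow> i > 0 \<Longrightarrow> (to_fract x / to_fract r0 ^ (q * i), to_fract y / to_fract s0 ^ (q * i)) \<in> N"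
  shows "(iR \<rho> * iS \<sigma> + g) ^ q \<notin>
    int_closure (ideal_pow (ideal_add (extension iR I) (extension iS J)) P)"
proof
  let ?t = "iR \<rho> * iS \<sigma> + g" and ?K = "ideal_add (extension iR I) (extension iS J)"
  assume "?t ^ q \<in> int_closure (ideal_pow ?K P)"
  then obtain n a where n: "n \<ge> 1" "\<forall>i\<in>{1..n}. a i \<in> ideal_pow (ideal_pow ?K P) i"
      and eq: "(?t ^ q) ^ n + (\<Sum>i=1..n. a i * (?t ^ q) ^ (n - i)) = 0"
    by (auto simp: int_closure_def)
  have tge: "?t ^ m \<in> ge (\<rho> ^ m) (\<sigma> ^ m)" for m
  proof -
    obtain g' where g': "g' \<in> gt (\<rho> ^ m) (\<sigma> ^ m)" "?t ^ m = iR (\<rho> ^ m) * iS (\<sigma> ^ m) + g'"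
      using lead_power[OF nz(1,2) g] by blast
    have "iR (\<rho> ^ m) * iS (\<sigma> ^ m) \<in> ge (\<rho> ^ m) (\<sigma> ^ m)" by (rule lead_ge) (use nz in auto)
    then show ?thesis using gt_ge[OF g'(1)] unfolding g'(2) ge_def by (rule tsp_add)
  qed
  have agt: "a i \<in> gt (\<rho> ^ (q * i)) (\<sigma> ^ (q * i))" if i: "i \<in> {1..n}" for i
  proof -
    have "a i \<in> ideal_pow ?K (P * i)" using n(2) i by (simp add: ideal_pow_ideal_pow)
    then have "a i \<in> tsp (\<lambda>x y. (\<exists>a b. x \<in> ideal_pow I a \<and> y \<in> ideal_pow J b \<and> a + b = P * i) \<and> x \<noteq> 0 \<and> y \<noteq> 0)"
      using ideal_pow_tsp[OF I J] by (intro tsp_nonzero) auto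
    then show ?thesis
      unfolding gt_def
    proof (rule tsp_mono)
      fix x y assume "(\<exists>a b. x \<in> ideal_pow I a \<and> y \<in> ideal_pow J b \<and> a + b = P * i) \<and> x \<noteq> 0 \<and> y \<noteq> 0"
      then obtain a b where h: "x \<in> ideal_pow I a" "y \<in> ideal_pow J b" "a + b = P * i" "x \<noteq> 0" "y \<noteq> 0"
        by blast
      have "(to_fract x / to_fract r0 ^ (q * i), to_fract y / to_fract s0 ^ (q * i)) \<in> N"
        by (rule IJ) (use h i in auto)
      from N_mult_NU[OF this NU_power[OF r0, of "q * i"]]
      have "(to_fract x / to_fract \<rho> ^ (q * i), to_fract y / to_fract \<sigma> ^ (q * i)) \<in> N"
        using nz by (simp add: power_divide)
      then show "x \<noteq> 0 \<and> y \<noteq> 0 \<and>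
          (to_fract x / to_fract (\<rho> ^ (q * i)), to_fract y / to_fract (\<sigma> ^ (q * i))) \<in> N"
        using h by (simp add: to_fract_power)
    qed
  qed
  have "(\<Sum>i=1..n. a i * (?t ^ q) ^ (n - i)) \<in> gt (\<rho> ^ (q * n)) (\<sigma> ^ (q * n))"
  proof (rule gt_sum)
    fix i assume i: "i \<in> {1..n}"
    have e: "q * i + q * (n - i) = q * n" using i by (simp add: distrib_left[symmetric])
    from gt_mult_ge[OF agt[OF i] tge[of "q * (n - i)"]]
    show "a i * (?t ^ q) ^ (n - i) \<in> gt (\<rho> ^ (q * n)) (\<sigma> ^ (q * n))"
      by (simp only: power_add[symmetric] e power_mult[of ?t])
  qed
  moreover obtain g' where g': "g' \<in> gt (\<rho> ^ (q * n)) (\<sigma> ^ (q * n))"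
    "?t ^ (q * n) = iR (\<rho> ^ (q * n)) * iS (\<sigma> ^ (q * n)) + g'"
    using lead_power[OF nz(1,2) g] by blast
  ultimately have "g' + (\<Sum>i=1..n. a i * (?t ^ q) ^ (n - i)) \<in> gt (\<rho> ^ (q * n)) (\<sigma> ^ (q * n))"
    by (intro gt_add)
  from lead_plus_gt_nonzero[OF _ _ this] nz
  have "iR (\<rho> ^ (q * n)) * iS (\<sigma> ^ (q * n)) + (g' + (\<Sum>i=1..n. a i * (?t ^ q) ^ (n - i))) \<noteq> 0"
    by simp
  moreover have "iR (\<rho> ^ (q * n)) * iS (\<sigma> ^ (q * n)) + (g' + (\<Sum>i=1..n. a i * (?t ^ q) ^ (n - i))) = 0"
    using eq unfolding power_mult[of ?t q n, symmetric] g'(2) by (simp only: add.assoc)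
  ultimately show False by contradiction
qed

text \<open>One family of coefficients serves both the tensor and its values under functionals. This
  lets \<open>ex_lead\<close> infer from a nonzero value that some small term occurs.\<close>

lemma ex_orthogonal_expansion:
  assumes E: "finite E" "fst ` set xs \<subseteq> R.vs.span E" and E': "finite E'" "snd ` set xs \<subseteq> S.vs.span E'"
  shows "\<exists>c. tsum xs = (\<Sum>e\<in>E. \<Sum>e'\<in>E'. phiT (c e e') * (iR e * iS e')) \<and>
    (\<forall>l l'. R.linear_functional l \<longrightarrow> S.linear_functional l' \<longrightarrow>
      bval l l' xs = (\<Sum>e\<in>E. \<Sum>e'\<in>E'. c e e' * (l e * l' e')))"
  using E(2) E'(2)
proof (induction xs)
  case Nil
  have "phiT 0 = 0" using iR_phi[of 0] by (simp add: iR_simps R.phi_simps)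
  then show ?case by (intro exI[of _ "\<lambda>_ _. 0"]) simp
next
  case (Cons x xs)
  obtain r s where x: "x = (r, s)" by force
  from Cons obtain c where c: "tsum xs = (\<Sum>e\<in>E. \<Sum>e'\<in>E'. phiT (c e e') * (iR e * iS e'))"
    "\<And>l l'. R.linear_functional l \<Longrightarrow> S.linear_functional l' \<Longrightarrow>
      bval l l' xs = (\<Sum>e\<in>E. \<Sum>e'\<in>E'. c e e' * (l e * l' e'))" by auto
  have "r \<in> R.vs.span E" "s \<in> S.vs.span E'" using Cons.prems by (auto simp: x)
  then obtain d d' where r: "r = (\<Sum>e\<in>E. phiR (d e) * e)" and s: "s = (\<Sum>e'\<in>E'. phiS (d' e') * e')"
    using R.vs.span_finite[OF E(1)] S.vs.span_finite[OF E'(1)] by auto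
  have phiT: "is_ring_hom phiT" using tp by (simp add: is_tensor_product_def)
  have "iR r * iS s = (\<Sum>e\<in>E. \<Sum>e'\<in>E'. phiT (d e * d' e') * (iR e * iS e'))"
    unfolding r s iR_simps iS_simps sum_product
    by (intro sum.cong refl) (simp add: iR_phi iS_phi is_ring_homD[OF phiT] ac_simps)
  then have "tsum (x # xs) = (\<Sum>e\<in>E. \<Sum>e'\<in>E'. phiT (d e * d' e' + c e e') * (iR e * iS e'))"
    by (simp add: x c(1) is_ring_homD(3)[OF phiT] distrib_right sum.distrib)
  moreover have "bval l l' (x # xs) = (\<Sum>e\<in>E. \<Sum>e'\<in>E'. (d e * d' e' + c e e') * (l e * l' e'))"
    if l: "R.linear_functional l" "S.linear_functional l'" for l l'
  proof -
    have "l r * l' s = (\<Sum>e\<in>E. \<Sum>e'\<in>E'. (d e * d' e') * (l e * l' e'))"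
      unfolding r s R.linear_functionalD(2,4)[OF l(1)] S.linear_functionalD(2,4)[OF l(2)] sum_product
      by (intro sum.cong refl) (simp add: ac_simps)
    then show ?thesis by (simp add: x c(2)[OF l] distrib_right sum.distrib)
  qed
  ultimately show ?case by (intro exI[of _ "\<lambda>e e'. d e * d' e' + c e e'"]) blast
qed

text \<open>The leading term is the least pair of orthogonal elements with nonzero coefficient. It
  is bounded by the pair of values of \<open>r0\<close> and \<open>s0\<close> because
  \<open>l \<otimes> l'\<close> is nonzero on one of the pairs that occur, and such a pair is at
  most that bound in each component.\<close>

lemma ex_lead:
  assumes l: "R.linear_functional l" "\<And>w. w \<in> A.above r0 \<Longrightarrow> l w = 0"
    and l': "S.linear_functional l'" "\<And>w. w \<in> B.above s0 \<Longrightarrow> l' w = 0"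
    and b: "bval l l' xs \<noteq> 0" and nz0: "r0 \<noteq> 0" "s0 \<noteq> 0"
  obtains \<rho> \<sigma> g where "\<rho> \<noteq> 0" "\<sigma> \<noteq> 0" "g \<in> gt \<rho> \<sigma>" "tsum xs = iR \<rho> * iS \<sigma> + g"
    "(to_fract r0 / to_fract \<rho>, to_fract s0 / to_fract \<sigma>) \<in> NU"
proof -
  obtain E where E: "finite E" "0 \<notin> E" "fst ` set xs \<subseteq> R.vs.span E"
    "\<And>e e'. e \<in> E \<Longrightarrow> e' \<in> E \<Longrightarrow> to_fract e / to_fract e' \<in> A.pl.U \<Longrightarrow> e = e'"
    using A.ex_orthogonal[of "fst ` set xs"] by auto
  obtain E' where E': "finite E'" "0 \<notin> E'" "snd ` set xs \<subseteq> S.vs.span E'"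
    "\<And>e e'. e \<in> E' \<Longrightarrow> e' \<in> E' \<Longrightarrow> to_fract e / to_fract e' \<in> B.pl.U \<Longrightarrow> e = e'"
    using B.ex_orthogonal[of "snd ` set xs"] by auto
  obtain c where c: "tsum xs = (\<Sum>e\<in>E. \<Sum>e'\<in>E'. phiT (c e e') * (iR e * iS e'))"
    "bval l l' xs = (\<Sum>e\<in>E. \<Sum>e'\<in>E'. c e e' * (l e * l' e'))"
    using ex_orthogonal_expansion[OF E(1,3) E'(1,3)] l(1) l'(1) by blast
  have phiT: "is_ring_hom phiT" using tp by (simp add: is_tensor_product_def)
  define Z where "Z = {z \<in> E \<times> E'. c (fst z) (snd z) \<noteq> 0}"
  have finZ: "finite Z" using E(1) E'(1) by (simp add: Z_def)
  have Znz: "fst z \<noteq> 0" "snd z \<noteq> 0" if "z \<in> Z" for z using that E(2) E'(2) by (auto simp: Z_def)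
  have "\<exists>z\<in>Z. l (fst z) \<noteq> 0 \<and> l' (snd z) \<noteq> 0"
  proof (rule ccontr)
    assume neg: "\<not> ?thesis"
    have "(\<Sum>e\<in>E. \<Sum>e'\<in>E'. c e e' * (l e * l' e')) = 0"
    proof (intro sum.neutral ballI)
      fix e e' assume "e \<in> E" "e' \<in> E'"
      then show "c e e' * (l e * l' e') = 0" using bspec[of Z _ "(e, e')"] neg by (auto simp: Z_def)
    qed
    then show False using b c(2) by simp
  qed
  then obtain z1 where z1: "z1 \<in> Z" "l (fst z1) \<noteq> 0" "l' (snd z1) \<noteq> 0" by blast
  define lt where "lt x y \<longleftrightarrow> (to_fract (fst y) / to_fract (fst x), to_fract (snd y) / to_fract (snd x)) \<in> N"
    for x y :: "'a \<times> 'b"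
  have "\<exists>m\<in>Z. \<forall>x\<in>Z. x \<noteq> m \<longrightarrow> \<not> lt x m"
  proof (rule Finite_Set.bex_min_element[OF finZ])
    show "Z \<noteq> {}" using z1 by auto
    show "asymp_on Z lt"
    proof (rule asymp_onI, rule notI)
      fix x y assume xy: "x \<in> Z" "y \<in> Z" "lt x y" "lt y x"
      from poD(3)[OF xy(3)[unfolded lt_def] xy(4)[unfolded lt_def]] Znz[OF xy(1)] Znz[OF xy(2)]
      show False using N_one by simp
    qed
    show "transp_on Z lt"
    proof (rule transp_onI)
      fix x y z assume xyz: "x \<in> Z" "y \<in> Z" "z \<in> Z" "lt x y" "lt y z"
      from poD(3)[OF xyz(4)[unfolded lt_def] xyz(5)[unfolded lt_def]] Znz[OF xyz(2)]
      show "lt x z" by (simp add: lt_def)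
    qed
  qed
  then obtain m where m: "m \<in> Z" "\<And>x. x \<in> Z \<Longrightarrow> x \<noteq> m \<Longrightarrow> \<not> lt x m" by blast
  \<comment> \<open>Different pairs differ in value by orthogonality, so minimality and totality
    give a strict inequality.\<close>
  have ltm: "lt m x" if x: "x \<in> Z" "x \<noteq> m" for x
  proof -
    have "\<not> (to_fract (fst x) / to_fract (fst m) \<in> A.pl.U \<and> to_fract (snd x) / to_fract (snd m) \<in> B.pl.U)"
      using E(4)[of "fst x" "fst m"] E'(4)[of "snd x" "snd m"] x m(1) by (auto simp: Z_def prod_eq_iff)
    then show ?thesis
      using total[of "to_fract (fst x) / to_fract (fst m)" "to_fract (snd x) / to_fract (snd m)"]
        m(2)[OF x] Znz[OF x(1)] Znz[OF m(1)] by (auto simp: lt_def)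
  qed
  define cm where "cm = c (fst m) (snd m)"
  have cm: "cm \<noteq> 0" using m(1) by (simp add: cm_def Z_def)
  \<comment> \<open>The coefficient is absorbed into \<rho>, which leaves its value unchanged
    because nonzero constants are units.\<close>
  define \<rho> where "\<rho> = phiR cm * fst m"
  define \<sigma> where "\<sigma> = snd m"
  have cU: "to_fract (phiR cm) \<in> A.pl.U" by (rule A.pl.phi_U[OF cm])
  have phiR0: "phiR d \<noteq> 0" if "d \<noteq> 0" for d using A.pl.U_nonzero[OF A.pl.phi_U[OF that]] by auto
  have nz: "\<rho> \<noteq> 0" "\<sigma> \<noteq> 0" using phiR0[OF cm] Znz[OF m(1)] by (auto simp: \<rho>_def \<sigma>_def)
  have scale: "(to_fract (phiR d) * u / to_fract \<rho>, v / to_fract \<sigma>) \<in> N"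
    if "(u / to_fract (fst m), v / to_fract (snd m)) \<in> N" "d \<noteq> 0" for u v d
  proof -
    have "to_fract (phiR d) * inverse (to_fract (phiR cm)) \<in> A.pl.U"
      by (intro A.pl.U_mult A.pl.U_inverse cU A.pl.phi_U that)
    from poD(4)[OF that(1) this B.pl.U_one]
    show ?thesis by (simp add: \<rho>_def \<sigma>_def field_simps)
  qed
  define g where "g = (\<Sum>z\<in>Z - {m}. iR (phiR (c (fst z) (snd z)) * fst z) * iS (snd z))"
  have "tsum xs = (\<Sum>z\<in>E \<times> E'. iR (phiR (c (fst z) (snd z)) * fst z) * iS (snd z))"
    unfolding c(1) sum.cartesian_product
    by (intro sum.cong) (auto simp: iR_simps iR_phi ac_simps)
  also have "\<dots> = (\<Sum>z\<in>Z. iR (phiR (c (fst z) (snd z)) * fst z) * iS (snd z))"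
    using E(1) E'(1)
    by (intro sum.mono_neutral_right) (auto simp: Z_def R.phi_simps iR_simps)
  also have "\<dots> = iR \<rho> * iS \<sigma> + g"
    unfolding g_def using finZ m(1) by (subst sum.remove[of Z m]) (auto simp: \<rho>_def \<sigma>_def cm_def)
  finally have t: "tsum xs = iR \<rho> * iS \<sigma> + g" .
  have "g \<in> gt \<rho> \<sigma>"
    unfolding g_def gt_def
  proof (rule tsp_sum, rule tsp_single)
    fix z assume z: "z \<in> Z - {m}"
    then have cz: "c (fst z) (snd z) \<noteq> 0" by (simp add: Z_def)
    have "lt m z" using ltm z by auto
    from scale[OF this[unfolded lt_def] cz]
    show "phiR (c (fst z) (snd z)) * fst z \<noteq> 0 \<and> snd z \<noteq> 0 \<and>
        (to_fract (phiR (c (fst z) (snd z)) * fst z) / to_fract \<rho>, to_fract (snd z) / to_fract \<sigma>) \<in> N"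
      using phiR0[OF cz] Znz[of z] z by simp
  qed
  moreover have "(to_fract r0 / to_fract \<rho>, to_fract s0 / to_fract \<sigma>) \<in> NU"
  proof -
    have "to_fract r0 / to_fract (fst z1) \<in> V" "to_fract s0 / to_fract (snd z1) \<in> V'"
      using z1(2,3) l(2) l'(2) by (auto intro: A.notin_above B.notin_above)
    then have 1: "(to_fract r0 / to_fract (fst z1), to_fract s0 / to_fract (snd z1)) \<in> NU"
      using nz0 Znz[OF z1(1)] by (intro V_NU) auto
    have 2: "(to_fract (fst z1) / to_fract (fst m), to_fract (snd z1) / to_fract (snd m)) \<in> NU"
    proof (cases "z1 = m")
      case True
      then show ?thesis using Znz[OF m(1)] NU_one by simp
    next
      case False
      then show ?thesis using ltm[OF z1(1)] N_NU by (simp add: lt_def)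
    qed
    have "(inverse (to_fract (phiR cm)), 1) \<in> NU"
      using A.pl.U_inverse[OF cU] B.pl.U_one by (simp add: NU_def)
    from NU_mult[OF this NU_mult[OF 1 2]]
    show ?thesis using Znz[OF z1(1)] by (simp add: \<rho>_def \<sigma>_def field_simps)
  qed
  ultimately show ?thesis using that nz t by blast
qed

end

section \<open>The zero ideal, separation by a pair of places, and the conclusion\<close>

lemma ideal_pow_zero:
  assumes "n > 0" shows "ideal_pow {0::'a::comm_ring_1} n = {0}"
proof -
  obtain k where n: "n = Suc k" using assms by (cases n) auto
  have "ideal_mult (ideal_pow {0::'a} k) {0} \<subseteq> {0}"
    by (rule ideal_mult_least) (auto simp: is_ideal_def)
  then show ?thesis using is_idealD(1)[OF is_ideal_ideal_pow, of "{0::'a}" n] by (auto simp: n)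
qed

lemma int_closure_zero:
  fixes x :: "'a::idom"
  assumes "x \<in> int_closure {0}" shows "x = 0"
proof -
  from assms obtain n a where n: "n \<ge> 1" "\<forall>i\<in>{1..n}. a i \<in> ideal_pow {0} i"
      and eq: "x ^ n + (\<Sum>i=1..n. a i * x ^ (n - i)) = 0"
    by (auto simp: int_closure_def)
  have "(\<Sum>i=1..n. a i * x ^ (n - i)) = 0"
  proof (intro sum.neutral ballI)
    fix i assume i: "i \<in> {1..n}"
    then have "a i \<in> ideal_pow {0} i" using n(2) by blast
    then show "a i * x ^ (n - i) = 0" using i by (simp add: ideal_pow_zero)
  qed
  then have "x ^ n = 0" using eq by simp
  then show ?thesis by simp
qed

text \<open>Used to read \<open>rat_pow_subset_sum\<close> with one ideal zero as a statement about
  the other. The exponent has to be positive, since exponent \<open>0\<close> gives the whole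
  ring.\<close>

lemma rat_pow_zero:
  assumes "p > 0" "q > 0"
  shows "rat_pow {0::'a::idom} (of_nat p / of_nat q) = {0}"
proof
  show "rat_pow {0::'a} (of_nat p / of_nat q) \<subseteq> {0}"
  proof
    fix x :: 'a assume "x \<in> rat_pow {0} (of_nat p / of_nat q)"
    then have "x ^ q \<in> int_closure {0}"
      by (simp add: rat_pow_eq[OF assms(2)] ideal_pow_zero[OF assms(1)])
    from int_closure_zero[OF this] show "x \<in> {0}" by simp
  qed
  show "{0} \<subseteq> rat_pow {0::'a} (of_nat p / of_nat q)"
    using is_idealD(1)[OF is_ideal_rat_pow, of "of_nat p / of_nat q" "{0::'a}"] by simp
qed

lemma (in alg_place) ideal_pow_positive:
  assumes g: "\<And>g. g \<in> L \<Longrightarrow> to_fract g / \<rho> \<in> M" and x: "x \<in> ideal_pow L m" "m > 0"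
  shows "to_fract x / \<rho> ^ m \<in> M"
proof -
  \<comment> \<open>Degree \<open>0\<close> is exempt from strictness because the zeroth power of
    \<open>L\<close> is the whole ring, where only value at least \<open>0\<close> is known.\<close>
  define D where "D n = {x. to_fract x / \<rho> ^ n \<in> V \<and> (n > 0 \<longrightarrow> to_fract x / \<rho> ^ n \<in> M)}" for n :: nat
  have "ideal_pow L m \<subseteq> D m"
  proof (rule ideal_pow_subset)
    fix x y n assume "x \<in> D n" "y \<in> L"
    then have "to_fract x / \<rho> ^ n * (to_fract y / \<rho>) \<in> M" using g by (intro pl.M_mult) (auto simp: D_def)
    then have "to_fract (x * y) / \<rho> ^ Suc n \<in> M" by (simp add: mult.commute)
    then show "x * y \<in> D (Suc n)" using pl.M_in_V unfolding D_def by blast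
  next
    fix n
    show "is_ideal (D n)"
      unfolding is_ideal_def D_def
      using pl.V_simps pl.zero_M pl.M_add pl.M_mult[OF R_V] R_V
      by (auto simp: add_divide_distrib times_divide_eq_right[symmetric] simp del: times_divide_eq_right)
  qed (auto simp: D_def R_V pl.V_simps)
  then show ?thesis using x by (auto simp: D_def)
qed

text \<open>The separating order is built from the two strict inequalities \<open>gI\<close> and
  \<open>gJ\<close>. The first form of \<open>P\<close> is for the sum of both ideals; the other two
  treat one ideal alone and serve the final equality.\<close>

lemma (in tensor_places) separated_not_integral:
  assumes I: "is_ideal I" and J: "is_ideal J" and pos: "p > 0" "p' > 0" "q > 0"
    and P: "P = p + p' \<or> (J = {0} \<and> P = p) \<or> (I = {0} \<and> P = p')"
    and nz: "r0 \<noteq> 0" "s0 \<noteq> 0"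
    and gI: "\<And>g. g \<in> ideal_pow I p \<Longrightarrow> to_fract g / to_fract (r0 ^ q) \<in> M"
    and gJ: "\<And>g. g \<in> ideal_pow J p' \<Longrightarrow> to_fract g / to_fract (s0 ^ q) \<in> M'"
    and l: "R.linear_functional l" "\<And>w. w \<in> A.above r0 \<Longrightarrow> l w = 0"
    and l': "S.linear_functional l'" "\<And>w. w \<in> B.above s0 \<Longrightarrow> l' w = 0"
    and b: "bval l l' xs \<noteq> 0"
  shows "tsum xs ^ q \<notin> int_closure (ideal_pow (ideal_add (extension iR I) (extension iS J)) P)"
proof -
  define \<rho> where "\<rho> = to_fract (r0 ^ q)"
  define \<sigma> where "\<sigma> = to_fract (s0 ^ q)"
  have nz': "\<rho> \<noteq> 0" "\<sigma> \<noteq> 0" using nz by (simp_all add: \<rho>_def \<sigma>_def)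
  have P0: "P > 0" using P pos by auto
  \<comment> \<open>The classes componentwise at least P (v(G), v'(H)) - (m + n) (v(\<rho>),
    v'(\<sigma>)), which is what has to become positive. Taking \<open>m = n = 0\<close> includes
    the componentwise order itself, and the last condition then removes the neutral class.\<close>
  define N0 where "N0 = {(a, b). a \<noteq> 0 \<and> b \<noteq> 0 \<and> (\<exists>m n G H. G \<in> ideal_pow I m \<and> H \<in> ideal_pow J n \<and>
    G \<noteq> 0 \<and> H \<noteq> 0 \<and> a * \<rho> ^ (m + n) / to_fract G ^ P \<in> V \<and> b * \<sigma> ^ (m + n) / to_fract H ^ P \<in> V' \<and>
    (m + n > 0 \<or> a \<in> M \<or> b \<in> M'))}"
  have N0I: "(a, b) \<in> N0"
    if "a \<noteq> 0" "b \<noteq> 0" "G \<in> ideal_pow I m" "H \<in> ideal_pow J n" "G \<noteq> 0" "H \<noteq> 0"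
      "a * \<rho> ^ (m + n) / to_fract G ^ P \<in> V" "b * \<sigma> ^ (m + n) / to_fract H ^ P \<in> V'"
      "m + n > 0 \<or> a \<in> M \<or> b \<in> M'" for a b G H m n
    unfolding N0_def using that by blast
  have N0E: "\<exists>m n G H. a \<noteq> 0 \<and> b \<noteq> 0 \<and> G \<in> ideal_pow I m \<and> H \<in> ideal_pow J n \<and>
    G \<noteq> 0 \<and> H \<noteq> 0 \<and> a * \<rho> ^ (m + n) / to_fract G ^ P \<in> V \<and> b * \<sigma> ^ (m + n) / to_fract H ^ P \<in> V' \<and>
    (m + n > 0 \<or> a \<in> M \<or> b \<in> M')" if "(a, b) \<in> N0" for a b
    using that unfolding N0_def by blast
  have aV: "a \<in> V" if "a / to_fract G ^ P \<in> V" "G \<noteq> 0" for a G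
    using A.pl.V_simps(6)[OF that(1) is_subring_power[OF A.pl.V_subring A.R_V], of G P] that(2) by simp
  have bV: "b \<in> V'" if "b / to_fract G ^ P \<in> V'" "G \<noteq> 0" for b G
    using B.pl.V_simps(6)[OF that(1) is_subring_power[OF B.pl.V_subring B.R_V], of G P] that(2) by simp
  have po: "tw.pre_order N0"
    unfolding tw.pre_order_def
  proof (intro conjI allI impI)
    fix a b assume "(a, b) \<in> N0"
    then show "a \<noteq> 0" "b \<noteq> 0" by (auto simp: N0_def)
  next
    fix a b c d assume ab: "(a, b) \<in> N0" and cd: "(c, d) \<in> N0"
    obtain m n G H where
      h: "a \<noteq> 0" "b \<noteq> 0" "G \<in> ideal_pow I m" "H \<in> ideal_pow J n" "G \<noteq> 0" "H \<noteq> 0"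
        "a * \<rho> ^ (m + n) / to_fract G ^ P \<in> V" "b * \<sigma> ^ (m + n) / to_fract H ^ P \<in> V'"
        "m + n > 0 \<or> a \<in> M \<or> b \<in> M'"
      using N0E[OF ab] by blast
    obtain m' n' G' H' where
      h': "c \<noteq> 0" "d \<noteq> 0" "G' \<in> ideal_pow I m'" "H' \<in> ideal_pow J n'" "G' \<noteq> 0" "H' \<noteq> 0"
        "c * \<rho> ^ (m' + n') / to_fract G' ^ P \<in> V" "d * \<sigma> ^ (m' + n') / to_fract H' ^ P \<in> V'"
        "m' + n' > 0 \<or> c \<in> M \<or> d \<in> M'"
      using N0E[OF cd] by blast
    show "(a * c, b * d) \<in> N0"
    proof (rule N0I)
      show "G * G' \<in> ideal_pow I (m + m')" "H * H' \<in> ideal_pow J (n + n')"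
        using h h' by (auto intro: ideal_pow_mult)
      have "(a * \<rho> ^ (m + n) / to_fract G ^ P) * (c * \<rho> ^ (m' + n') / to_fract G' ^ P) \<in> V"
        using h h' by (intro A.pl.V_simps)
      then show "a * c * \<rho> ^ (m + m' + (n + n')) / to_fract (G * G') ^ P \<in> V"
        by (simp add: power_add power_mult_distrib ac_simps)
      have "(b * \<sigma> ^ (m + n) / to_fract H ^ P) * (d * \<sigma> ^ (m' + n') / to_fract H' ^ P) \<in> V'"
        using h h' by (intro B.pl.V_simps)
      then show "b * d * \<sigma> ^ (m + m' + (n + n')) / to_fract (H * H') ^ P \<in> V'"
        by (simp add: power_add power_mult_distrib ac_simps)
      show "m + m' + (n + n') > 0 \<or> a * c \<in> M \<or> b * d \<in> M'"
      proof (cases "m + m' + (n + n') > 0")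
        case False
        then have z: "m + n = 0" "m' + n' = 0" by auto
        have "c \<in> V" "d \<in> V'" using aV[of c G'] bV[of d H'] h'(5-8) z(2) by simp_all
        then show ?thesis using h(9) z(1) A.pl.M_mult'[of a c] B.pl.M_mult'[of b d] by auto
      qed simp
    qed (use h h' in auto)
  next
    fix a b u u' assume ab: "(a, b) \<in> N0" and u: "u \<in> A.pl.U" "u' \<in> B.pl.U"
    obtain m n G H where
      h: "a \<noteq> 0" "b \<noteq> 0" "G \<in> ideal_pow I m" "H \<in> ideal_pow J n" "G \<noteq> 0" "H \<noteq> 0"
        "a * \<rho> ^ (m + n) / to_fract G ^ P \<in> V" "b * \<sigma> ^ (m + n) / to_fract H ^ P \<in> V'"
        "m + n > 0 \<or> a \<in> M \<or> b \<in> M'"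
      using N0E[OF ab] by blast
    have uV: "u \<in> V" "u' \<in> V'" "u \<noteq> 0" "u' \<noteq> 0"
      using u A.pl.U_nonzero B.pl.U_nonzero by (auto simp: A.pl.U_def B.pl.U_def)
    show "(u * a, u' * b) \<in> N0"
    proof (rule N0I[OF _ _ h(3-6)])
      show "u * a * \<rho> ^ (m + n) / to_fract G ^ P \<in> V"
        using A.pl.V_simps(6)[OF uV(1) h(7)] by (simp add: ac_simps)
      show "u' * b * \<sigma> ^ (m + n) / to_fract H ^ P \<in> V'"
        using B.pl.V_simps(6)[OF uV(2) h(8)] by (simp add: ac_simps)
      show "m + n > 0 \<or> u * a \<in> M \<or> u' * b \<in> M'"
        using h(9) A.pl.M_mult[OF uV(1)] B.pl.M_mult[OF uV(2)] by blast
    qed (use h uV in auto)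
  next
    \<comment> \<open>A neutral class gives P v(G) \<le> (m + n) v(\<rho>) and the same for
      \<open>H\<close> and \<sigma>. On the other hand \<open>gI\<close> gives m v(\<rho>) < p v(G)
      if \<open>m > 0\<close>, and \<open>gJ\<close> gives n v'(\<sigma>) < p' v'(H) if
      \<open>n > 0\<close>. By \<open>exponent_bound\<close>, m P < p (m + n) and n P < p' (m + n),
      which add up to a contradiction with \<open>P = p + p'\<close>.\<close>
    have False if ab: "(a, b) \<in> N0" and U: "a \<in> A.pl.U" "b \<in> B.pl.U" for a b
    proof -
      obtain m n G H where
        h: "a \<noteq> 0" "b \<noteq> 0" "G \<in> ideal_pow I m" "H \<in> ideal_pow J n" "G \<noteq> 0" "H \<noteq> 0"
          "a * \<rho> ^ (m + n) / to_fract G ^ P \<in> V" "b * \<sigma> ^ (m + n) / to_fract H ^ P \<in> V'"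
          "m + n > 0 \<or> a \<in> M \<or> b \<in> M'"
        using N0E[OF ab] by blast
      have k: "m + n > 0" using h(9) U by (auto simp: A.pl.U_def B.pl.U_def)
      have m: "m * P < p * (m + n)" if "m > 0"
      proof (rule A.pl.exponent_bound)
        show "to_fract G \<noteq> 0" using h by simp
        show "\<rho> \<in> V" unfolding \<rho>_def by (rule A.R_V)
        have "inverse a * (a * \<rho> ^ (m + n) / to_fract G ^ P) \<in> V"
          using A.pl.U_inverse[OF U(1)] h(7) by (intro A.pl.V_simps) (auto simp: A.pl.U_def)
        then show "\<rho> ^ (m + n) / to_fract G ^ P \<in> V" using h(1) by (simp add: field_simps)
        have "G ^ p \<in> ideal_pow (ideal_pow I p) m"
          using ideal_pow_power[OF h(3), of p] by (simp add: ideal_pow_ideal_pow mult.commute)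
        from A.ideal_pow_positive[OF _ this that, of \<rho>] gI
        show "to_fract G ^ p / \<rho> ^ m \<in> M" by (simp add: \<rho>_def to_fract_power)
      qed (use nz' P0 in auto)
      have n: "n * P < p' * (m + n)" if "n > 0"
      proof (rule B.pl.exponent_bound)
        show "to_fract H \<noteq> 0" using h by simp
        show "\<sigma> \<in> V'" unfolding \<sigma>_def by (rule B.R_V)
        have "inverse b * (b * \<sigma> ^ (m + n) / to_fract H ^ P) \<in> V'"
          using B.pl.U_inverse[OF U(2)] h(8) by (intro B.pl.V_simps) (auto simp: B.pl.U_def)
        then show "\<sigma> ^ (m + n) / to_fract H ^ P \<in> V'" using h(2) by (simp add: field_simps)
        have "H ^ p' \<in> ideal_pow (ideal_pow J p') n"
          using ideal_pow_power[OF h(4), of p'] by (simp add: ideal_pow_ideal_pow mult.commute)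
        from B.ideal_pow_positive[OF _ this that, of \<sigma>] gJ
        show "to_fract H ^ p' / \<sigma> ^ n \<in> M'" by (simp add: \<sigma>_def to_fract_power)
      qed (use nz' P0 in auto)
      have n0: "n = 0" if "J = {0}" using h(4,6) that by (cases "n = 0") (auto simp: ideal_pow_zero)
      have m0: "m = 0" if "I = {0}" using h(3,5) that by (cases "m = 0") (auto simp: ideal_pow_zero)
      from P show False
      proof (elim disjE conjE)
        assume PP: "P = p + p'"
        consider "m = 0" | "n = 0" | "m > 0" "n > 0" by auto
        then show False
        proof cases
          case 3
          then have "m * P + n * P < p * (m + n) + p' * (m + n)" using m n by simp
          then show False by (simp add: PP algebra_simps)
        qed (use m n k PP in \<open>auto simp: algebra_simps\<close>)
      qed (use m n k m0 n0 in \<open>auto simp: algebra_simps\<close>)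
    qed
    then show "N0 \<inter> A.pl.U \<times> B.pl.U = {}" by auto
  qed
  obtain N where N: "N0 \<subseteq> N" "tw.pre_order N"
    "\<And>a b. a \<noteq> 0 \<Longrightarrow> b \<noteq> 0 \<Longrightarrow> (a, b) \<in> N \<or> (inverse a, inverse b) \<in> N \<or> (a \<in> A.pl.U \<and> b \<in> B.pl.U)"
    using tw.ex_total_order[OF po] by metis
  interpret ordered_tensor phiR phiS phiT iR iS V M V' M' N
  proof
    show "tw.pre_order N" by (rule N(2))
    show "(a, b) \<in> N \<or> (inverse a, inverse b) \<in> N \<or> (a \<in> A.pl.U \<and> b \<in> B.pl.U)"
      if "a \<noteq> 0" "b \<noteq> 0" for a b by (rule N(3)[OF that])
    fix a b assume "a \<in> V" "b \<in> V'" "a \<noteq> 0" "b \<noteq> 0" "\<not> (a \<in> A.pl.U \<and> b \<in> B.pl.U)"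
    then have "(a, b) \<in> N0"
      by (intro N0I[of a b 1 0 1 0]) (auto simp: A.pl.U_def B.pl.U_def)
    then show "(a, b) \<in> N" using N(1) by auto
  qed
  obtain \<rho>' \<sigma>' g where lead: "\<rho>' \<noteq> 0" "\<sigma>' \<noteq> 0" "g \<in> gt \<rho>' \<sigma>'" "tsum xs = iR \<rho>' * iS \<sigma>' + g"
    "(to_fract r0 / to_fract \<rho>', to_fract s0 / to_fract \<sigma>') \<in> NU"
    using ex_lead[OF l l' b nz] by metis
  show ?thesis
    unfolding lead(4)
  proof (rule not_integral[OF I J lead(1,2) nz lead(3,5)])
    fix x y a b and i :: nat
    assume h: "x \<in> ideal_pow I a" "y \<in> ideal_pow J b" "x \<noteq> 0" "y \<noteq> 0" "a + b = P * i" "i > 0"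
    \<comment> \<open>As \<open>a + b = P * i\<close>, the \<open>P\<close>-th power is exactly the
      generator of \<open>N0\<close> given by \<open>G = x\<close> and \<open>H = y\<close>. Working
      with \<open>P\<close>-fold values keeps exponents integral, and \<open>N_root\<close> divides
      by \<open>P\<close> afterwards.\<close>
    have "((to_fract x / to_fract r0 ^ (q * i)) ^ P, (to_fract y / to_fract s0 ^ (q * i)) ^ P) \<in> N0"
    proof (rule N0I[OF _ _ h(1,2,3,4)])
      have "(to_fract r0 ^ (q * i)) ^ P = \<rho> ^ (a + b)" "(to_fract s0 ^ (q * i)) ^ P = \<sigma> ^ (a + b)"
        by (simp_all add: \<rho>_def \<sigma>_def to_fract_power h(5) power_mult[symmetric] ac_simps)
      then have "(to_fract x / to_fract r0 ^ (q * i)) ^ P * \<rho> ^ (a + b) / to_fract x ^ P = 1"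
        "(to_fract y / to_fract s0 ^ (q * i)) ^ P * \<sigma> ^ (a + b) / to_fract y ^ P = 1"
        using nz' h(3,4) by (simp_all add: power_divide)
      then show "(to_fract x / to_fract r0 ^ (q * i)) ^ P * \<rho> ^ (a + b) / to_fract x ^ P \<in> V"
        "(to_fract y / to_fract s0 ^ (q * i)) ^ P * \<sigma> ^ (a + b) / to_fract y ^ P \<in> V'"
        using A.pl.V_simps(2) B.pl.V_simps(2) by (simp_all only:)
      show "a + b > 0 \<or> (to_fract x / to_fract r0 ^ (q * i)) ^ P \<in> M \<or>
          (to_fract y / to_fract s0 ^ (q * i)) ^ P \<in> M'"
        using h(5,6) P0 by simp
    qed (use h nz in auto)
    then show "(to_fract x / to_fract r0 ^ (q * i), to_fract y / to_fract s0 ^ (q * i)) \<in> N"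
      by (rule N_root[OF subsetD[OF N(1)] P0])
  qed
qed

context tensor
begin

lemma rat_pow_subset_sum:
  assumes I: "is_ideal I" and J: "is_ideal J" and pos: "p > 0" "p' > 0" "q > 0"
    and P: "P = p + p' \<or> (J = {0} \<and> P = p) \<or> (I = {0} \<and> P = p')"
  shows "rat_pow (ideal_add (extension iR I) (extension iS J)) (of_nat P / of_nat q)
    \<subseteq> ideal_add (extension iR (rat_pow I (of_nat p / of_nat q)))
         (extension iS (rat_pow J (of_nat p' / of_nat q)))"
proof
  fix t assume t: "t \<in> rat_pow (ideal_add (extension iR I) (extension iS J)) (of_nat P / of_nat q)"
  let ?W = "rat_pow I (of_nat p / of_nat q)" and ?W' = "rat_pow J (of_nat p' / of_nat q)"
  have W: "R.vs.subspace ?W" "S.vs.subspace ?W'"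
    by (auto intro!: R.subspace_ideal S.subspace_ideal is_ideal_rat_pow)
  obtain xs where xs: "t = tsum xs" using ex_tsum by blast
  show "t \<in> ideal_add (extension iR ?W) (extension iS ?W')"
    unfolding xs
  proof (rule tsum_mem_extensions[OF W], rule ccontr)
    fix l l' assume l: "R.linear_functional l" "\<And>w. w \<in> ?W \<Longrightarrow> l w = 0"
      and l': "S.linear_functional l'" "\<And>w. w \<in> ?W' \<Longrightarrow> l' w = 0" and b: "bval l l' xs \<noteq> 0"
    \<comment> \<open>The slice of \<open>t\<close> along \<open>l'\<close>. Applying
      \<open>l\<close> to it gives the nonzero value of \<open>l \<otimes> l'\<close>, whereas
      \<open>l\<close> vanishes on \<open>?W\<close>.\<close>
    define r0 where "r0 = pair_sum (\<lambda>r s. phiR (l' s) * r) xs"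
    have r0: "k r0 = bval k l' xs" if "R.linear_functional k" for k
      unfolding r0_def
      by (induction xs) (auto simp: R.linear_functionalD[OF that] mult.commute[of "l' _"])
    have "r0 \<notin> ?W" using r0[OF l(1)] l(2) b by auto
    then have r0W: "r0 ^ q \<notin> int_closure (ideal_pow I p)" by (simp add: rat_pow_eq[OF pos(3)])
    obtain V M where VM: "place (\<lambda>c. to_fract (phiR c)) V M" "range to_fract \<subseteq> V"
      "\<And>g. g \<in> ideal_pow I p \<Longrightarrow> to_fract g / to_fract (r0 ^ q) \<in> M"
      using valuative_criterion[OF fgR r0W] by metis
    interpret A: alg_place phiR V M
      using VM(1,2) by (auto simp: alg_place_def alg_place_axioms_def R.C_algebra_axioms)
    have r00: "r0 \<noteq> 0" using r0[OF l(1)] b R.linear_functionalD(3)[OF l(1)] by auto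
    \<comment> \<open>The place found for \<open>r0\<close> replaces \<open>l\<close> by a
      functional \<open>k\<close> adapted to it.\<close>
    obtain k where k: "R.linear_functional k" "\<And>w. w \<in> A.above r0 \<Longrightarrow> k w = 0" "k r0 = 1"
      using R.ex_separating_functional[OF A.subspace_above A.not_above[OF r00]] by metis
    \<comment> \<open>The slice along \<open>k\<close>. Now \<open>l'\<close> takes on
      \<open>s0\<close> the value \<open>k r0 = 1\<close>, so \<open>s0\<close> lies outside
      \<open>?W'\<close>, and a place of the second fraction field can be chosen for it.\<close>
    define s0 where "s0 = pair_sum (\<lambda>r s. phiS (k r) * s) xs"
    have s0: "k' s0 = bval k k' xs" if "S.linear_functional k'" for k'
      unfolding s0_def
      by (induction xs) (auto simp: S.linear_functionalD[OF that])
    have "s0 \<notin> ?W'" using s0[OF l'(1)] r0[OF k(1)] l'(2) k(3) by force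
    then have s0W: "s0 ^ q \<notin> int_closure (ideal_pow J p')" by (simp add: rat_pow_eq[OF pos(3)])
    obtain V' M' where VM': "place (\<lambda>c. to_fract (phiS c)) V' M'" "range to_fract \<subseteq> V'"
      "\<And>g. g \<in> ideal_pow J p' \<Longrightarrow> to_fract g / to_fract (s0 ^ q) \<in> M'"
      using valuative_criterion[OF fgS s0W] by metis
    interpret B: alg_place phiS V' M'
      using VM'(1,2) by (auto simp: alg_place_def alg_place_axioms_def S.C_algebra_axioms)
    have s00: "s0 \<noteq> 0" using s0[OF l'(1)] r0[OF k(1)] k(3) S.linear_functionalD(3)[OF l'(1)] by auto
    obtain k' where k': "S.linear_functional k'" "\<And>w. w \<in> B.above s0 \<Longrightarrow> k' w = 0" "k' s0 = 1"
      using S.ex_separating_functional[OF B.subspace_above B.not_above[OF s00]] by metis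
    interpret tensor_places phiR phiS phiT iR iS V M V' M' ..
    have "bval k k' xs \<noteq> 0" using s0[OF k'(1)] k'(3) by simp
    from separated_not_integral[OF I J pos P r00 s00 VM(3) VM'(3) k(1,2) k'(1,2) this]
    show False using t by (simp add: xs rat_pow_eq[OF pos(3)])
  qed
qed

end

theorem theorem5p2:
  fixes phiR :: "complex \<Rightarrow> 'r::idom" and phiS :: "complex \<Rightarrow> 's::idom"
    and phiT :: "complex \<Rightarrow> 't::comm_ring_1"
    and iR :: "'r \<Rightarrow> 't" and iS :: "'s \<Rightarrow> 't"
    and I :: "'r set" and J :: "'s set"
  assumes "fg_C_algebra phiR" and "fg_C_algebra phiS"
    and "is_normal_domain TYPE('r)" and "is_normal_domain TYPE('s)"
    and "is_ideal I" and "I \<noteq> {0}" and "is_ideal J" and "J \<noteq> {0}"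
    and "is_tensor_product phiR phiS phiT iR iS"
  shows "\<exists>w0::rat. w0 > 0 \<and>
    (\<forall>w \<tau> :: rat. w0 \<le> \<tau> \<and> \<tau> \<le> w - w0 \<longrightarrow>
       ideal_gen (\<Union>\<alpha>\<in>{\<alpha>::rat. 0 \<le> \<alpha> \<and> \<alpha> \<le> w}.
            {iR a * iS b |a b. a \<in> rat_pow I \<alpha> \<and> b \<in> rat_pow J (w - \<alpha>)})
         \<subseteq> rat_pow (ideal_add (extension iR I) (extension iS J)) w
     \<and> rat_pow (ideal_add (extension iR I) (extension iS J)) w
         \<subseteq> ideal_add (extension iR (rat_pow I \<tau>)) (extension iS (rat_pow J (w - \<tau>)))
     \<and> ideal_add (extension iR (rat_pow I \<tau>)) (extension iS (rat_pow J (w - \<tau>)))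
         = ideal_add (rat_pow (extension iR I) \<tau>) (rat_pow (extension iS J) (w - \<tau>)))"
proof (intro exI[of _ 1] conjI allI impI)
  show "(1::rat) > 0" by simp
  interpret tensor phiR phiS phiT iR iS
    by unfold_locales (use assms in auto)
  note I = assms(5) and J = assms(7)
  let ?K = "ideal_add (extension iR I) (extension iS J)"
  fix w \<tau> :: rat assume h: "1 \<le> \<tau> \<and> \<tau> \<le> w - 1"
  then have \<tau>: "\<tau> \<ge> 0" "w - \<tau> \<ge> 0" by auto
  obtain p p' q where q: "q > 0" "\<tau> = of_nat p / of_nat q" "w - \<tau> = of_nat p' / of_nat q"
    by (rule nonneg_rats_common_denominator[OF \<tau>])
  have p: "p > 0" "p' > 0" using h q by (auto intro!: gr0I)
  have "w = \<tau> + (w - \<tau>)" by simp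
  also have "\<dots> = of_nat p / of_nat q + of_nat p' / of_nat q" by (rule arg_cong2[OF q(2,3)])
  also have "\<dots> = of_nat (p + p') / of_nat q" by (simp add: add_divide_distrib)
  finally have w: "w = of_nat (p + p') / of_nat q" .
  have IK: "iR ` I \<subseteq> ?K" "iS ` J \<subseteq> ?K"
    using ideal_add_supset[OF is_ideal_extension is_ideal_extension, of iR I iS J]
      ideal_add_supset(2)[OF is_ideal_extension is_ideal_extension, of iS J iR I]
      extension_base[of _ I iR] extension_base[of _ J iS] by blast+
  show "ideal_gen (\<Union>\<alpha>\<in>{\<alpha>::rat. 0 \<le> \<alpha> \<and> \<alpha> \<le> w}.
      {iR a * iS b |a b. a \<in> rat_pow I \<alpha> \<and> b \<in> rat_pow J (w - \<alpha>)}) \<subseteq> rat_pow ?K w"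
  proof (rule ideal_gen_least)
    show "is_ideal (rat_pow ?K w)" by (rule is_ideal_rat_pow) (use h in simp)
    have "iR a * iS b \<in> rat_pow ?K w"
      if "0 \<le> \<alpha>" "\<alpha> \<le> w" "a \<in> rat_pow I \<alpha>" "b \<in> rat_pow J (w - \<alpha>)" for \<alpha> a b
      using rat_pow_mult[OF that(1) _ ring_hom_rat_pow[OF homs(1) IK(1) that(3)]
        ring_hom_rat_pow[OF homs(2) IK(2) that(4)]] that(2) by simp
    then show "(\<Union>\<alpha>\<in>{\<alpha>::rat. 0 \<le> \<alpha> \<and> \<alpha> \<le> w}.
      {iR a * iS b |a b. a \<in> rat_pow I \<alpha> \<and> b \<in> rat_pow J (w - \<alpha>)}) \<subseteq> rat_pow ?K w"
      by auto
  qed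
  show "rat_pow ?K w \<subseteq> ideal_add (extension iR (rat_pow I \<tau>)) (extension iS (rat_pow J (w - \<tau>)))"
    unfolding q(3) unfolding q(2) w by (rule rat_pow_subset_sum[OF I J p q(1)]) simp
  let ?E = "ideal_add (extension iR (rat_pow I \<tau>)) (extension iS (rat_pow J (w - \<tau>)))"
  let ?F = "ideal_add (rat_pow (extension iR I) \<tau>) (rat_pow (extension iS J) (w - \<tau>))"
  have E: "is_ideal ?E" by (intro is_ideal_ideal_add is_ideal_extension)
  have rI: "is_ideal (rat_pow (extension iR I) \<tau>)" "is_ideal (rat_pow (extension iS J) (w - \<tau>))"
    by (intro is_ideal_rat_pow, use h in simp)+
  show "?E = ?F"
  proof
    have "extension iR (rat_pow I \<tau>) \<subseteq> rat_pow (extension iR I) \<tau>"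
      unfolding extension_def[of iR "rat_pow I \<tau>"]
      by (rule ideal_gen_least[OF rI(1)]) (auto intro!: ring_hom_rat_pow[OF homs(1)] extension_base)
    moreover have "extension iS (rat_pow J (w - \<tau>)) \<subseteq> rat_pow (extension iS J) (w - \<tau>)"
      unfolding extension_def[of iS "rat_pow J (w - \<tau>)"]
      by (rule ideal_gen_least[OF rI(2)]) (auto intro!: ring_hom_rat_pow[OF homs(2)] extension_base)
    ultimately show "?E \<subseteq> ?F" unfolding ideal_add_def by blast
  next
    have z: "is_ideal {0}" by (simp add: is_ideal_def)
    have extR0: "extension iR {0} = {0}" and extS0: "extension iS {0} = {0}"
      using ideal_gen_least[of "{0::'t}" "{0}"] subset_ideal_gen[of "{0::'t}"]
      by (auto simp: extension_def iR_simps iS_simps is_ideal_def)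
    have add0: "ideal_add A {0} = A" "ideal_add {0} A = A" for A :: "'t set"
      by (auto simp: ideal_add_def)
    \<comment> \<open>With \<open>{0}\<close> in place of \<open>J\<close>, both the extension of
      \<open>J\<close> and its rational power vanish, which leaves the inclusion for
      \<open>I\<close> alone.\<close>
    have "rat_pow (extension iR I) \<tau> \<subseteq> extension iR (rat_pow I \<tau>)"
      using rat_pow_subset_sum[OF I z p q(1), of p] rat_pow_zero[OF p(2) q(1), where 'a = 's]
      by (simp add: extS0 add0 q(2))
    moreover have "rat_pow (extension iS J) (w - \<tau>) \<subseteq> extension iS (rat_pow J (w - \<tau>))"
      using rat_pow_subset_sum[OF z J p q(1), of p'] rat_pow_zero[OF p(1) q(1), where 'a = 'r]
      by (simp add: extR0 add0 q(3))
    ultimately show "?F \<subseteq> ?E" unfolding ideal_add_def by blast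
  qed
qed

end
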